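(* Let $k$ be a positive integer, and let $C>0$ be a real number. There are infinitely many positive integers $a$ for which the equation $\sigma(n)=kn+a$ has more than $(\log a)^{C}$ solutions in positive integers $n\le a$ that are not of the form $mp$ or $mpq$ for any $k$-perfect number $m$ and any primes $p$, $q$.
   Context: $\sigma(n)$ denotes the sum of all positive divisors of the positive integer $n$. A positive integer $m$ is called $k$-perfect if $\sigma(m)=km$. *)

theory Defs
  imports Complex_Main "HOL-Computational_Algebra.Primes"
begin

definition sigma :: "nat \<Rightarrow> nat" where
  "sigma n = (\<Sum>d | d dvd n. d)"

definition k_perfect :: "nat \<Rightarrow> nat \<Rightarrow> bool" where
  "k_perfect k m \<longleftrightarrow> m > 0 \<and> sigma m = k * m"

text \<open>The primes \<open>p\<close> and \<open>q\<close> are arbitrary: they may coincide and may divide \<open>m\<close>.\<close>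

definition exceptional_form :: "nat \<Rightarrow> nat \<Rightarrow> bool" where
  "exceptional_form k n \<longleftrightarrow>
     (\<exists>m p. k_perfect k m \<and> prime p \<and> n = m * p) \<or>
     (\<exists>m p q. k_perfect k m \<and> prime p \<and> prime q \<and> n = m * p * q)"

end

theory Submission
  imports Defs "HOL-Analysis.Complex_Transcendental" "HOL-Analysis.Infinite_Sum"
    "HOL-Analysis.Harmonic_Numbers" "HOL-Number_Theory.Number_Theory"
begin

text \<open>
  Fix \<open>m\<close> with \<open>\<sigma>(m) > 4 k m\<close> and put \<open>s = \<sigma>(m)\<close>, \<open>t = s - k m\<close>. If \<open>q \<noteq> r\<close> are primes that do not
  divide \<open>m\<close>, then \<open>n = m q r\<close> solves \<open>\<sigma>(n) = k n + a\<close> for the number \<open>a\<close> determined by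
  \[ t a + s^2 - s t = (t q + s)(t r + s). \]
  So many solutions for one \<open>a\<close> arise from one number \<open>N\<close> with many factorisations into two factors
  \<open>t q + s\<close>, \<open>t r + s\<close>. These \<open>n\<close> satisfy \<open>n \<le> a\<close>, and they are not exceptional, because two
  more primes can raise \<open>\<sigma>(n)/n\<close> at most fourfold.

  To produce such \<open>N\<close>, let \<open>R\<close> be a product of \<open>J\<close> large primes and let \<open>e\<close> be large. For each of
  the \<open>(e + 1)^J\<close> divisors \<open>x\<close> of \<open>R^e\<close>, let \<open>q\<close> run through the primes for which \<open>t q + s\<close> is
  \<open>x R\<close> times a number congruent to 1 modulo \<open>R\<close>, and \<open>r\<close> through the primes for which \<open>t r + s\<close>
  is \<open>(R^e / x) R\<close> times a number congruent to 2. The divisor and the order of the two primes can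
  be recovered from the primes (\<open>class_unique\<close>), and every product is a multiple of \<open>R^(e+2)\<close>. If
  each class contains its share of the primes, the pairs outnumber what multiples of \<open>R^(e+2)\<close>
  can accommodate: if no large \<open>a\<close> had more than \<open>(ln a)^C\<close> solutions, then \<open>(e + 1)^J\<close> would be at
  most a power of the logarithm of the primes used, hence bounded by a polynomial in \<open>e\<close> whose degree
  does not depend on \<open>J\<close> (\<open>divisor_count_le\<close>). Taking \<open>J\<close> larger than this degree is a contradiction.

  What remains is a lower bound for the primes in a class modulo \<open>d\<close>, where \<open>d\<close> divides \<open>R^E\<close> and
  the logarithm of the primes is only a fixed power of \<open>E\<close> (\<open>primes_in_progression\<close>). The primes are
  counted with the weight \<open>(ln n)^k n^(-1-1/L)\<close>, where \<open>k\<close> is of order \<open>E\<close> and \<open>L\<close> of order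
  \<open>E^9\<close>. The sum \<open>S_k\<close> of \<open>\<chi>(n) \<Lambda>(n)\<close> against this weight and the sum \<open>L_k\<close> of \<open>\<chi>(n)\<close> satisfy
  \[ L_{k+1} = \sum_{j \le k} {k \choose j} S_j L_{k-j}, \]
  since \<open>ln\<close> is the divisor sum of \<open>\<Lambda>\<close>. For nontrivial \<open>\<chi>\<close>, partial summation bounds \<open>|L_j|\<close> by
  \<open>j! B^(j+1)\<close> with \<open>B\<close> of order \<open>E\<close>, and a lower bound for \<open>|L_0|\<close> turns the recursion into
  \<open>|S_k| \<le> k! A^(k+1)\<close> with \<open>A\<close> of order \<open>B^9\<close>; for the trivial character the same recursion gives
  \<open>S_k \<ge> k! L^(k+1) / 2\<close> up to a small error. As \<open>d \<le> 2^k\<close>, a constant ratio \<open>L / A\<close>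
  suffices for the trivial character to outweigh all the others together.

  The lower bound for \<open>|L_0|\<close> comes from the 3-4-1 inequality when \<open>\<chi>^2\<close> is nontrivial. The remaining
  characters are real, and a real character modulo \<open>d\<close> is already a character modulo \<open>R\<close>
  (\<open>real_char_descends\<close>); there are finitely many of these, and Monsky's elementary argument shows
  that their series do not vanish at 1.
\<close>

section \<open>Logarithmic weights\<close>

text \<open>
  With \<open>s = 1 + 1 / L\<close> the measure \<open>lw k s u du\<close> concentrates near \<open>ln u = k L\<close>, far beyond the
  logarithm of the modulus.
\<close>

definition lw :: "nat \<Rightarrow> real \<Rightarrow> real \<Rightarrow> real" where
  "lw k s u = ln u ^ k * u powr (-s)"

lemma lw_nonneg: "u \<ge> 1 \<Longrightarrow> lw k s u \<ge> 0"
  by (simp add: lw_def)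

lemma lw_zero [simp]: "lw k s 0 = 0"
  by (simp add: lw_def)

lemma lw_of_nat_nonneg: "lw k s (real n) \<ge> 0"
  by (cases "n = 0") (auto intro: lw_nonneg)

lemma power_le_fact_exp:
  assumes "x \<ge> (0::real)" shows "x ^ k \<le> fact k * exp x"
proof -
  have "(\<Sum>n\<in>{k}. x ^ n /\<^sub>R fact n) \<le> (\<Sum>n. x ^ n /\<^sub>R fact n)"
    by (rule sum_le_suminf) (use summable_exp_generic[of x] assms in auto)
  then show ?thesis by (simp add: exp_def field_simps)
qed

lemma ln_power_le:
  fixes u c :: real
  assumes "u \<ge> 1" "c > 0"
  shows "ln u ^ k \<le> fact k * (1 / c) ^ k * u powr c"
proof -
  have "(c * ln u) ^ k \<le> fact k * exp (c * ln u)"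
    by (rule power_le_fact_exp) (use assms in auto)
  then show ?thesis using assms by (simp add: power_mult_distrib powr_def field_simps)
qed

lemma ln_power_le_sqrt:
  fixes u :: real
  assumes "u \<ge> 1"
  shows "ln u ^ k \<le> fact k * 2 ^ k * u powr (1/2)"
  using ln_power_le[OF assms, of "1/2" k] by simp

definition lw_deriv :: "nat \<Rightarrow> real \<Rightarrow> real \<Rightarrow> real" where
  "lw_deriv k s u = (real k * ln u ^ (k - 1) - s * ln u ^ k) * u powr (-s-1)"

lemma lw_has_derivative:
  assumes "u > 0"
  shows "(lw k s has_real_derivative lw_deriv k s u) (at u)"
proof -
  have "((\<lambda>u. ln u ^ k * u powr (-s)) has_real_derivative
      (real k * ln u ^ (k - 1)) * (1/u) * u powr (-s) + ln u ^ k * ((-s) * u powr (-s-1))) (at u)"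
    using assms by (auto intro!: derivative_eq_intros simp: powr_diff)
  moreover have "(1/u) * u powr (-s) = u powr (-s-1)"
    using assms by (simp add: powr_diff)
  ultimately show ?thesis
    unfolding lw_def[abs_def] lw_deriv_def by (simp only: mult.assoc) (simp add: algebra_simps)
qed

text \<open>
  A bound with an explicit antiderivative, uniform in \<open>s\<close>; it controls the variation of the weight
  without locating its maximum.
\<close>

lemma abs_lw_deriv_le:
  assumes "u \<ge> 1" "1 \<le> s" "s \<le> 2"
  shows "\<bar>lw_deriv k s u\<bar> \<le> 3 * 2 ^ k * fact k * u powr (-3/2)"
proof -
  have a: "real k * ln u ^ (k - 1) \<le> fact k * 2 ^ k * u powr (1/2)"
  proof (cases k)
    case 0 then show ?thesis by simp
  next
    case (Suc j)
    have "real k * ln u ^ (k - 1) \<le> real k * (fact j * 2 ^ j * u powr (1/2))"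
      using ln_power_le_sqrt[OF assms(1), of j] Suc by (intro mult_left_mono) auto
    also have "\<dots> = fact k * 2 ^ j * u powr (1/2)" using Suc by simp
    also have "\<dots> \<le> fact k * 2 ^ k * u powr (1/2)" using Suc
      by (intro mult_right_mono mult_left_mono) auto
    finally show ?thesis .
  qed
  have b: "s * ln u ^ k \<le> 2 * (fact k * 2 ^ k * u powr (1/2))"
    using ln_power_le_sqrt[OF assms(1), of k] assms by (intro mult_mono) auto
  have c: "0 \<le> real k * ln u ^ (k - 1)" "0 \<le> s * ln u ^ k" using assms by auto
  have "\<bar>real k * ln u ^ (k - 1) - s * ln u ^ k\<bar> \<le> 3 * 2 ^ k * fact k * u powr (1/2)"
    using a b c by (simp add: algebra_simps abs_if)
  then have "\<bar>lw_deriv k s u\<bar> \<le> (3 * 2 ^ k * fact k * u powr (1/2)) * u powr (-s-1)"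
    unfolding lw_deriv_def abs_mult by (intro mult_mono) auto
  also have "\<dots> \<le> (3 * 2 ^ k * fact k * u powr (1/2)) * u powr (-2)"
    using assms by (intro mult_left_mono powr_mono) auto
  also have "\<dots> = 3 * 2 ^ k * fact k * (u powr (1/2) * u powr (-2))" by simp
  also have "u powr (1/2) * u powr (-2) = u powr (-3/2)"
    by (simp flip: powr_add)
  finally show ?thesis .
qed

text \<open>
  The decrements of this function are the integrals of the bound \<open>abs_lw_deriv_le\<close>, so they dominate
  the variation of \<open>lw k s\<close> for every \<open>s\<close> between 1 and 2.
\<close>

definition lw_var :: "nat \<Rightarrow> real \<Rightarrow> real" where
  "lw_var k u = 6 * 2 ^ k * fact k * u powr (-1/2)"

lemma lw_var_nonneg: "lw_var k u \<ge> 0"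
  by (simp add: lw_var_def)

lemma lw_var_le: "u \<ge> 1 \<Longrightarrow> lw_var k u \<le> 6 * 2 ^ k * fact k"
  unfolding lw_var_def using powr_mono[of "-1/2" 0 u] by (intro mult_left_le) auto

lemma abs_lw_diff_le:
  assumes "1 \<le> u" "u \<le> v" "1 \<le> s" "s \<le> 2"
  shows "\<bar>lw k s v - lw k s u\<bar> \<le> lw_var k u - lw_var k v"
proof -
  have dv: "(lw_var k has_real_derivative - (3 * 2 ^ k * fact k * x powr (-3/2))) (at x)" if "x > 0" for x
    unfolding lw_var_def[abs_def] using that
    by (auto intro!: derivative_eq_intros)
  have *: "lw_var k v + c * lw k s v \<le> lw_var k u + c * lw k s u" if c: "\<bar>c\<bar> = 1" for c
  proof (rule DERIV_nonpos_imp_nonincreasing[OF \<open>u \<le> v\<close>])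
    fix x assume x: "u \<le> x" "x \<le> v"
    have "((\<lambda>x. lw_var k x + c * lw k s x) has_real_derivative
       - (3 * 2 ^ k * fact k * x powr (-3/2)) + c * lw_deriv k s x) (at x)"
      using x assms by (auto intro!: derivative_eq_intros dv lw_has_derivative)
    moreover have "\<bar>c * lw_deriv k s x\<bar> \<le> 3 * 2 ^ k * fact k * x powr (-3/2)"
      using abs_lw_deriv_le[of x s k] x assms c by (simp add: abs_mult)
    ultimately show "\<exists>y. ((\<lambda>x. lw_var k x + c * lw k s x) has_real_derivative y) (at x) \<and> y \<le> 0"
      by (intro exI[of _ "- (3 * 2 ^ k * fact k * x powr (-3/2)) + c * lw_deriv k s x"]) auto
  qed
  show ?thesis using *[of 1] *[of "-1"] by (auto simp: abs_if)
qed

text \<open>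
  The primitive of \<open>lw k s\<close> that vanishes at infinity, by repeated partial integration.
\<close>

fun lw_int :: "nat \<Rightarrow> real \<Rightarrow> real \<Rightarrow> real" where
  "lw_int 0 s u = - (u powr (1 - s) / (s - 1))"
| "lw_int (Suc k) s u = - (u powr (1 - s) / (s - 1) * ln u ^ Suc k) + real (Suc k) / (s - 1) * lw_int k s u"

lemma lw_int_has_derivative:
  assumes "u > 0" "s > 1"
  shows "(lw_int k s has_real_derivative lw k s u) (at u)"
proof -
  have base: "((\<lambda>u. - (u powr (1 - s) / (s - 1))) has_real_derivative lw 0 s u) (at u)"
  proof -
    have "((\<lambda>u. - (u powr (1 - s) / (s - 1))) has_real_derivative - (((1 - s) * u powr (1 - s - 1)) / (s - 1))) (at u)"
      using assms by (auto intro!: derivative_eq_intros)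
    also have "- (((1 - s) * u powr (1 - s - 1)) / (s - 1)) = lw 0 s u"
      using assms by (simp add: lw_def divide_simps) (simp add: algebra_simps)
    finally show ?thesis .
  qed
  show ?thesis
  proof (induction k)
    case 0
    have "lw_int 0 s = (\<lambda>u. - (u powr (1 - s) / (s - 1)))" by (rule ext) simp
    with base show ?case by (simp only:)
  next
    case (Suc k)
    have "((\<lambda>u. - (u powr (1 - s) / (s - 1))) has_real_derivative lw 0 s u) (at u)"
      by (rule base)
    moreover have "((\<lambda>u. ln u ^ Suc k) has_real_derivative real (Suc k) * ln u ^ k * (1 / u)) (at u)"
      using DERIV_power[OF DERIV_ln[OF assms(1)], of "Suc k"] by (simp add: divide_inverse mult_ac)
    ultimately have "((\<lambda>u. - (u powr (1 - s) / (s - 1)) * ln u ^ Suc k + real (Suc k) / (s - 1) * lw_int k s u)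
       has_real_derivative lw 0 s u * ln u ^ Suc k
         + real (Suc k) * ln u ^ k * (1 / u) * - (u powr (1 - s) / (s - 1)) + real (Suc k) / (s - 1) * lw k s u) (at u)"
      by (intro DERIV_add DERIV_mult DERIV_cmult Suc)
    also have "lw 0 s u * ln u ^ Suc k
         + real (Suc k) * ln u ^ k * (1 / u) * - (u powr (1 - s) / (s - 1)) + real (Suc k) / (s - 1) * lw k s u
       = lw (Suc k) s u"
    proof -
      have p: "1 / u * u powr (1 - s) = u powr (-s)" using assms by (simp add: powr_diff powr_minus field_simps)
      have "real (Suc k) * ln u ^ k * (1 / u) * - (u powr (1 - s) / (s - 1))
          = - (real (Suc k) / (s - 1) * (ln u ^ k * (1 / u * u powr (1 - s))))"
        by (simp add: divide_inverse algebra_simps)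
      then show ?thesis unfolding p lw_def by simp
    qed
    finally show ?case by simp
  qed
qed

lemma lw_int_nonpos: "u \<ge> 1 \<Longrightarrow> s > 1 \<Longrightarrow> lw_int k s u \<le> 0"
proof (induction k)
  case (Suc k)
  then have "real (Suc k) / (s - 1) * lw_int k s u \<le> 0" by (intro mult_nonneg_nonpos) auto
  moreover have "u powr (1 - s) / (s - 1) * ln u ^ Suc k \<ge> 0" using Suc by simp
  ultimately show ?case by simp
qed auto

lemma lw_int_1: "lw_int k s 1 = - (fact k * (1 / (s - 1)) ^ Suc k)"
  by (induction k) (auto simp: field_simps)

lemma lw_int_tendsto:
  assumes "s > 1" shows "((\<lambda>u. lw_int k s u) \<longlongrightarrow> 0) at_top"
proof -
  have t: "((\<lambda>u. u powr (1 - s) * ln u ^ k) \<longlongrightarrow> 0) at_top" for k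
  proof (rule tendsto_sandwich[of "\<lambda>_. 0"])
    let ?c = "(s - 1) / 2"
    show "eventually (\<lambda>u. 0 \<le> u powr (1 - s) * ln u ^ k) at_top"
      using eventually_ge_at_top[of 1] by eventually_elim auto
    show "eventually (\<lambda>u. u powr (1 - s) * ln u ^ k \<le> fact k * (1/?c)^k * u powr (- ?c)) at_top"
      using eventually_ge_at_top[of 1]
    proof eventually_elim
      case (elim u)
      have "u powr (1 - s) * ln u ^ k \<le> u powr (1 - s) * (fact k * (1/?c)^k * u powr ?c)"
        using ln_power_le[OF elim, of ?c k] assms by (intro mult_left_mono) auto
      also have "\<dots> = fact k * (1/?c)^k * (u powr (1-s) * u powr ?c)" by simp
      also have "u powr (1-s) * u powr ?c = u powr (- ?c)"
        by (subst powr_add [symmetric]) (rule arg_cong[of _ _ "\<lambda>x. u powr x"], simp add: field_simps)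
      finally show ?case .
    qed
    have "((\<lambda>u. u powr (- ?c)) \<longlongrightarrow> 0) at_top"
      using assms by (intro tendsto_neg_powr filterlim_ident) auto
    then show "((\<lambda>u. fact k * (1/?c)^k * u powr (- ?c)) \<longlongrightarrow> 0) at_top"
      by (rule tendsto_mult_right_zero)
  qed auto
  show ?thesis
  proof (induction k)
    case 0
    show ?case using tendsto_divide[OF t[of 0] tendsto_const[of "s-1"]] assms
      by (auto dest: tendsto_minus)
  next
    case (Suc k)
    have "((\<lambda>u. - (u powr (1 - s) * ln u ^ Suc k / (s - 1)) + real (Suc k) / (s - 1) * lw_int k s u) \<longlongrightarrow> - (0 / (s - 1)) + real (Suc k) / (s - 1) * 0) at_top"
      using assms by (intro tendsto_intros t Suc) auto
    then show ?case by (simp add: field_simps)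
  qed
qed

text \<open>
  The mean value theorem compares the integral over one step with the value at its left end; the
  error is a decrement of \<open>lw_var\<close>, so the errors of all steps telescope. The step \<open>h\<close> serves sums
  over the multiples of \<open>h\<close>.
\<close>

lemma lw_sum_integral:
  assumes "h \<ge> 1" "1 < s" "s \<le> 2" "n \<ge> 1"
  shows "\<bar>lw_int k s (h * real (n + 1)) - lw_int k s (h * real n) - h * lw k s (h * real n)\<bar>
     \<le> h * (lw_var k (h * real n) - lw_var k (h * real (n + 1)))"
proof -
  let ?u = "h * real n" and ?v = "h * real (n + 1)"
  have u: "?u \<ge> 1" using assms mult_mono[of 1 h 1 "real n"] by auto
  have uv: "?u < ?v" using assms by auto
  obtain z where z: "?u < z" "z < ?v" "lw_int k s ?v - lw_int k s ?u = (?v - ?u) * lw k s z"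
    using MVT2[OF uv, of "lw_int k s" "lw k s"] lw_int_has_derivative u assms by force
  have "\<bar>lw k s z - lw k s ?u\<bar> \<le> lw_var k ?u - lw_var k z"
    using u z assms by (intro abs_lw_diff_le) auto
  moreover have "lw_var k z \<ge> lw_var k ?v"
    using abs_lw_diff_le[of z ?v s k] u z assms by auto
  ultimately have "\<bar>lw k s z - lw k s ?u\<bar> \<le> lw_var k ?u - lw_var k ?v" by linarith
  moreover have "lw_int k s ?v - lw_int k s ?u - h * lw k s ?u = h * (lw k s z - lw k s ?u)"
    unfolding z(3) by (simp add: algebra_simps)
  ultimately show ?thesis using assms by (simp add: abs_mult)
qed

lemma lw_partial_sums:
  assumes "h \<ge> 1" "1 < s" "s \<le> 2"
  shows "\<bar>lw_int k s (h * real (Suc N)) - lw_int k s h - h * (\<Sum>n=1..N. lw k s (h * real n))\<bar>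
     \<le> h * (6 * 2 ^ k * fact k)"
proof -
  have "\<bar>lw_int k s (h * real (Suc N)) - lw_int k s h - h * (\<Sum>n=1..N. lw k s (h * real n))\<bar>
     \<le> h * (lw_var k h - lw_var k (h * real (Suc N)))"
  proof (induction N)
    case 0 then show ?case by simp
  next
    case (Suc N)
    show ?case using Suc lw_sum_integral[OF assms, of "Suc N" k]
      by (simp add: algebra_simps del: lw_int.simps)
  qed
  also have "\<dots> \<le> h * (6 * 2 ^ k * fact k)"
    using assms lw_var_le[of h k] lw_var_nonneg[of k "h * real (Suc N)"]
    by (intro mult_left_mono) auto
  finally show ?thesis .
qed

text \<open>
  The multiples of \<open>h\<close> receive the share \<open>1 / h\<close> of the total weight; this is the upper bound against
  which the pairs of primes are counted in the end.
\<close>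

lemma lw_sum_multiples_le:
  assumes "h \<ge> 1" "1 < s" "s \<le> 2"
  shows "h * (\<Sum>n=1..N. lw k s (h * real n)) \<le> fact k * (1 / (s - 1)) ^ Suc k + h * (6 * 2 ^ k * fact k)"
proof -
  have "lw_int k s 1 \<le> lw_int k s h"
  proof (rule DERIV_nonneg_imp_nondecreasing[where f = "lw_int k s"])
    show "1 \<le> h" by fact
    fix x assume "1 \<le> x" "x \<le> h"
    then show "\<exists>y. (lw_int k s has_real_derivative y) (at x) \<and> y \<ge> 0"
      using assms by (intro exI[of _ "lw k s x"]) (auto intro: lw_int_has_derivative lw_nonneg)
  qed
  moreover have "lw_int k s (h * real (Suc N)) \<le> 0"
    using assms mult_mono[of 1 h 1 "real (Suc N)"] by (intro lw_int_nonpos) auto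
  ultimately show ?thesis
    using lw_partial_sums[OF assms, of k N] lw_int_1[of k s] by linarith
qed

lemma summable_lw:
  assumes "1 < s" "s \<le> 2"
  shows "summable (\<lambda>n. lw k s (real n))"
proof (rule summableI_nonneg_bounded)
  show "0 \<le> lw k s (real n)" for n by (rule lw_of_nat_nonneg)
  fix N
  have "(\<Sum>n<N. lw k s (real n)) \<le> (\<Sum>n\<in>{0..N}. lw k s (real n))"
    by (intro sum_mono2) (auto intro: lw_of_nat_nonneg)
  also have "\<dots> = (\<Sum>n=1..N. lw k s (real n))"
    by (subst sum.atLeast_Suc_atMost) auto
  also have "\<dots> \<le> fact k * (1 / (s - 1)) ^ Suc k + (6 * 2 ^ k * fact k)"
    using lw_sum_multiples_le[of 1 s k N] assms by simp
  finally show "(\<Sum>n<N. lw k s (real n)) \<le> fact k * (1 / (s - 1)) ^ Suc k + (6 * 2 ^ k * fact k)" .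
qed

lemma suminf_lw:
  assumes "1 < s" "s \<le> 2"
  shows "\<bar>(\<Sum>n. lw k s (real n)) - fact k * (1 / (s - 1)) ^ Suc k\<bar> \<le> 6 * 2 ^ k * fact k"
proof -
  have 1: "(\<lambda>N. \<Sum>n=1..N. lw k s (real n)) \<longlonglongrightarrow> (\<Sum>n. lw k s (real n))"
  proof -
    have "(\<lambda>N. \<Sum>n\<le>N. lw k s (real n)) \<longlonglongrightarrow> (\<Sum>n. lw k s (real n))"
      using summable_LIMSEQ'[OF summable_lw[OF assms]] .
    moreover have "(\<Sum>n\<le>N. lw k s (real n)) = (\<Sum>n=1..N. lw k s (real n))" for N
      by (simp add: atMost_atLeast0 sum.atLeast_Suc_atMost)
    ultimately show ?thesis by simp
  qed
  have 2: "(\<lambda>N. lw_int k s (real (Suc N))) \<longlonglongrightarrow> 0"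
    by (rule filterlim_compose[OF lw_int_tendsto[OF assms(1)]])
       (intro filterlim_compose[OF filterlim_real_sequentially] filterlim_Suc)
  have "(\<lambda>N. \<bar>lw_int k s (real (Suc N)) - lw_int k s 1 - (\<Sum>n=1..N. lw k s (real n))\<bar>)
     \<longlonglongrightarrow> \<bar>0 - lw_int k s 1 - (\<Sum>n. lw k s (real n))\<bar>"
    by (intro tendsto_intros 1 2)
  then have "\<bar>0 - lw_int k s 1 - (\<Sum>n. lw k s (real n))\<bar> \<le> 6 * 2 ^ k * fact k"
    by (rule LIMSEQ_le_const2) (use lw_partial_sums[of 1 s k] assms in auto)
  then show ?thesis by (simp add: lw_int_1 abs_minus_commute)
qed

section \<open>Dirichlet series, convolution and the Euler product\<close>

definition bounded_cmult :: "(nat \<Rightarrow> complex) \<Rightarrow> bool" where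
  "bounded_cmult f \<longleftrightarrow> f 1 = 1 \<and> (\<forall>a b. f (a * b) = f a * f b) \<and> (\<forall>n. norm (f n) \<le> 1)"

lemma bounded_cmultD:
  assumes "bounded_cmult f"
  shows "f (Suc 0) = 1" "f (a * b) = f a * f b" "norm (f n) \<le> 1"
  using assms by (auto simp: bounded_cmult_def)

text \<open>
  Up to sign, \<open>Lser f k s\<close> is the \<open>k\<close>-th derivative at \<open>s\<close> of the Dirichlet series of \<open>f\<close>, and
  \<open>Sser f k s\<close> the \<open>k\<close>-th derivative of its negative logarithmic derivative.
\<close>

definition Lser :: "(nat \<Rightarrow> complex) \<Rightarrow> nat \<Rightarrow> real \<Rightarrow> complex" where
  "Lser f k s = (\<Sum>\<^sub>\<infinity>n. f n * of_real (lw k s (real n)))"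

definition Sser :: "(nat \<Rightarrow> complex) \<Rightarrow> nat \<Rightarrow> real \<Rightarrow> complex" where
  "Sser f k s = (\<Sum>\<^sub>\<infinity>n. f n * mangoldt n * of_real (lw k s (real n)))"

lemma lw_Suc: "lw (Suc k) s u = ln u * lw k s u"
  by (simp add: lw_def)

lemma mangoldt_lw_le: "mangoldt n * lw k s (real n) \<le> lw (Suc k) s (real n)"
  by (cases "n = 0") (auto simp: lw_Suc intro!: mult_right_mono mangoldt_le lw_of_nat_nonneg)

lemma summable_on_lw:
  assumes "1 < s" "s \<le> 2"
  shows "(\<lambda>n. lw k s (real n)) summable_on (UNIV :: nat set)"
  using summable_lw[OF assms] by (intro norm_summable_imp_summable_on) (simp add: abs_of_nonneg lw_of_nat_nonneg)

lemma abs_summable_L: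
  assumes "\<And>n. norm (f n) \<le> 1" "1 < s" "s \<le> 2"
  shows "(\<lambda>n. f n * complex_of_real (lw k s (real n))) abs_summable_on (UNIV :: nat set)"
  by (rule summable_on_comparison_test[OF summable_on_lw[OF assms(2,3), of k]])
     (use assms in \<open>auto simp: norm_mult lw_of_nat_nonneg intro!: mult_left_le_one_le\<close>)

lemma abs_summable_S:
  assumes "\<And>n. norm (f n) \<le> 1" "1 < s" "s \<le> 2"
  shows "(\<lambda>n. f n * mangoldt n * complex_of_real (lw k s (real n))) abs_summable_on (UNIV :: nat set)"
proof (rule summable_on_comparison_test[OF summable_on_lw[OF assms(2,3), of "Suc k"]])
  fix n :: nat
  have "norm (f n * mangoldt n * complex_of_real (lw k s (real n))) = norm (f n) * (mangoldt n * lw k s (real n))"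
    by (simp add: norm_mult lw_of_nat_nonneg abs_of_nonneg)
  also have "\<dots> \<le> mangoldt n * lw k s (real n)"
    using assms by (intro mult_left_le_one_le) (auto simp: lw_of_nat_nonneg mangoldt_nonneg)
  also have "\<dots> \<le> lw (Suc k) s (real n)" by (rule mangoldt_lw_le)
  finally show "norm (f n * mangoldt n * complex_of_real (lw k s (real n))) \<le> lw (Suc k) s (real n)" .
qed auto

lemma L_sums:
  assumes "\<And>n. norm (f n) \<le> 1" "1 < s" "s \<le> 2"
  shows "(\<lambda>n. f n * complex_of_real (lw k s (real n))) sums Lser f k s"
  unfolding Lser_def using abs_summable_summable[OF abs_summable_L[OF assms]]
  by (intro has_sum_imp_sums has_sum_infsum)

lemma S_sums:
  assumes "\<And>n. norm (f n) \<le> 1" "1 < s" "s \<le> 2"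
  shows "(\<lambda>n. f n * mangoldt n * complex_of_real (lw k s (real n))) sums Sser f k s"
  unfolding Sser_def using abs_summable_summable[OF abs_summable_S[OF assms]]
  by (intro has_sum_imp_sums has_sum_infsum)

lemma has_sum_sum_finite:
  fixes g :: "'i \<Rightarrow> 'a \<Rightarrow> 'b :: topological_comm_monoid_add"
  assumes "finite I" "\<And>i. i \<in> I \<Longrightarrow> (g i has_sum h i) A"
  shows "((\<lambda>x. \<Sum>i\<in>I. g i x) has_sum (\<Sum>i\<in>I. h i)) A"
  using assms by (induction I rule: finite_induct) (auto intro!: has_sum_add)

lemma infsum_mult_pairs:
  fixes x y :: "nat \<Rightarrow> complex"
  assumes "x abs_summable_on UNIV" "y abs_summable_on UNIV"
  shows "(\<lambda>(a, b). x a * y b) abs_summable_on UNIV \<times> UNIV"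
    "infsum (\<lambda>(a, b). x a * y b) (UNIV \<times> UNIV) = infsum x UNIV * infsum y UNIV"
proof -
  show *: "(\<lambda>(a, b). x a * y b) abs_summable_on UNIV \<times> UNIV"
    unfolding abs_summable_on_Sigma_iff
  proof (intro conjI ballI)
    show "(\<lambda>b. case (a, b) of (a, b) \<Rightarrow> x a * y b) abs_summable_on UNIV" for a
      using assms(2) by (auto simp: norm_mult intro!: summable_on_cmult_right)
    have "(\<lambda>a. norm (x a) * infsum (\<lambda>b. norm (y b)) UNIV) summable_on UNIV"
      using assms(1) by (rule summable_on_cmult_left)
    then show "(\<lambda>a. \<Sum>\<^sub>\<infinity>b. norm (case (a, b) of (a, b) \<Rightarrow> x a * y b)) abs_summable_on UNIV"
      by (simp add: norm_mult infsum_cmult_right' infsum_nonneg abs_mult)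
  qed
  have "infsum (\<lambda>(a, b). x a * y b) (UNIV \<times> UNIV) = (\<Sum>\<^sub>\<infinity>a. \<Sum>\<^sub>\<infinity>b. x a * y b)"
    using infsum_Sigma'_banach[OF abs_summable_summable[OF *]] by simp
  also have "\<dots> = infsum x UNIV * infsum y UNIV"
    by (simp add: infsum_cmult_right' infsum_cmult_left')
  finally show "infsum (\<lambda>(a, b). x a * y b) (UNIV \<times> UNIV) = infsum x UNIV * infsum y UNIV" .
qed

lemma has_sum_pairs_divisors:
  fixes F :: "nat \<times> nat \<Rightarrow> complex"
  assumes "F summable_on {0<..} \<times> {0<..}"
  shows "((\<lambda>n. \<Sum>d | d dvd n. F (d, n div d)) has_sum infsum F ({0<..} \<times> {0<..})) {0<..}"
proof (rule has_sum_SigmaD)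
  let ?D = "Sigma {0<..} (\<lambda>n::nat. {d. d dvd n})"
  let ?g = "\<lambda>(n, d). (d, n div d)"
  have bij: "bij_betw ?g ?D ({0<..} \<times> {0<..})"
    by (rule bij_betwI[of _ _ _ "\<lambda>(a, b). (a * b, a)"]) (auto intro: dvd_pos_nat simp: dvd_div_eq_0_iff)
  show "((\<lambda>x. F (?g x)) has_sum infsum F ({0<..} \<times> {0<..})) ?D"
    using has_sum_reindex_bij_betw[OF bij, of F] has_sum_infsum[OF assms] by simp
  show "((\<lambda>d. F (?g (n, d))) has_sum (\<Sum>d | d dvd n. F (d, n div d))) {d. d dvd n}" if "n \<in> {0<..}" for n
    using that by (auto intro!: has_sum_finiteI)
qed

lemma infsum_UNIV_pos:
  assumes "x (0::nat) = 0"
  shows "infsum x UNIV = infsum x {0<..}"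
  using assms by (intro infsum_cong_neutral) auto

text \<open>
  In terms of derivatives this is Leibniz' rule for \<open>-L' = (-L'/L) L\<close>. It needs only that \<open>ln n\<close> is
  the sum of \<open>\<Lambda>\<close> over the divisors of \<open>n\<close>: the factor \<open>(ln n)^k\<close> is split by the binomial theorem
  along \<open>n = a b\<close>.
\<close>

lemma L_recursion:
  assumes f: "bounded_cmult f" and s: "1 < s" "s \<le> 2"
  shows "Lser f (Suc k) s = (\<Sum>j\<le>k. of_nat (k choose j) * Sser f j s * Lser f (k - j) s)"
proof -
  define x where "x = (\<lambda>j n. f n * mangoldt n * complex_of_real (lw j s (real n)))"
  define y where "y = (\<lambda>j n. f n * complex_of_real (lw j s (real n)))"
  have nf: "\<And>n. norm (f n) \<le> 1" using f by (simp add: bounded_cmult_def)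
  have xs: "x j abs_summable_on UNIV" for j unfolding x_def by (rule abs_summable_S[of f, OF nf s])
  have ys: "y j abs_summable_on UNIV" for j unfolding y_def by (rule abs_summable_L[of f, OF nf s])
  define H where "H = (\<lambda>(a, b). \<Sum>j\<le>k. of_nat (k choose j) * (x j a * y (k - j) b))"
  have H0: "H (a, b) = 0" if "a = 0 \<or> b = 0" for a b
    using that by (auto simp: H_def x_def y_def)
  have HS: "((\<lambda>(a, b). \<Sum>j\<le>k. of_nat (k choose j) * (x j a * y (k - j) b)) has_sum
      (\<Sum>j\<le>k. of_nat (k choose j) * (Sser f j s * Lser f (k - j) s))) (UNIV \<times> UNIV)"
    unfolding case_prod_beta
  proof (intro has_sum_sum_finite has_sum_cmult_right)
    fix j
    show "((\<lambda>p. x j (fst p) * y (k - j) (snd p)) has_sum Sser f j s * Lser f (k - j) s) (UNIV \<times> UNIV)"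
      using has_sum_infsum[OF abs_summable_summable[OF infsum_mult_pairs(1)[OF xs[of j] ys[of "k - j"]]]]
      unfolding infsum_mult_pairs(2)[OF xs[of j] ys[of "k - j"]]
      by (simp add: Sser_def Lser_def x_def y_def case_prod_beta)
  qed auto
  then have "(H has_sum (\<Sum>j\<le>k. of_nat (k choose j) * (Sser f j s * Lser f (k - j) s))) ({0<..} \<times> {0<..})"
  proof (rule iffD1[OF has_sum_cong_neutral, rotated -1])
    fix p :: "nat \<times> nat" assume "p \<in> UNIV \<times> UNIV - {0<..} \<times> {0<..}"
    then have "fst p = 0 \<or> snd p = 0" by (cases p) auto
    then show "(case p of (a, b) \<Rightarrow> \<Sum>j\<le>k. of_nat (k choose j) * (x j a * y (k - j) b)) = 0"
      using H0[of "fst p" "snd p"] by (simp add: H_def)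
  qed (auto simp: H_def)
  then have sm: "H summable_on {0<..} \<times> {0<..}" and
    eq: "infsum H ({0<..} \<times> {0<..}) = (\<Sum>j\<le>k. of_nat (k choose j) * (Sser f j s * Lser f (k - j) s))"
    by (auto simp: summable_on_def dest: infsumI)
  have Hval: "H (a, b) = f (a * b) * of_real (lw k s (real (a * b))) * mangoldt a" if "a > 0" "b > 0" for a b
  proof -
    have "complex_of_real (lw k s (real (a * b)))
       = of_real ((\<Sum>j\<le>k. of_nat (k choose j) * ln (real a) ^ j * ln (real b) ^ (k - j))
          * (real a powr (-s) * real b powr (-s)))"
      using that unfolding lw_def by (simp add: ln_mult powr_mult flip: binomial_ring)
    also have "\<dots> = (\<Sum>j\<le>k. of_nat (k choose j) * (complex_of_real (lw j s a) * of_real (lw (k - j) s b)))"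
      unfolding lw_def by (simp add: sum_distrib_right sum_distrib_left mult_ac)
    finally show ?thesis
      unfolding H_def x_def y_def using bounded_cmultD(2)[OF f]
      by (simp add: sum_distrib_right sum_distrib_left mult_ac)
  qed
  have "Lser f (Suc k) s = (\<Sum>\<^sub>\<infinity>n\<in>{0<..}. f n * of_real (lw (Suc k) s (real n)))"
    unfolding Lser_def by (rule infsum_UNIV_pos) simp
  also have "\<dots> = (\<Sum>\<^sub>\<infinity>n\<in>{0<..}. \<Sum>d | d dvd n. H (d, n div d))"
  proof (rule infsum_cong)
    fix n :: nat assume n: "n \<in> {0<..}"
    have "(\<Sum>d | d dvd n. H (d, n div d)) = (\<Sum>d | d dvd n. f n * of_real (lw k s (real n)) * mangoldt d)"
    proof (rule sum.cong)
      fix d assume "d \<in> {d. d dvd n}"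
      then have d: "d dvd n" by simp
      then have "d > 0" "n div d > 0" "d * (n div d) = n"
        using n by (auto intro: dvd_pos_nat simp: dvd_div_eq_0_iff)
      then show "H (d, n div d) = f n * of_real (lw k s (real n)) * mangoldt d"
        using Hval[of d "n div d"] by simp
    qed auto
    also have "\<dots> = f n * of_real (lw k s (real n)) * of_real (ln (real n))"
      using n by (simp add: mangoldt_sum flip: sum_distrib_left)
    finally show "f n * of_real (lw (Suc k) s (real n)) = (\<Sum>d | d dvd n. H (d, n div d))"
      by (simp add: lw_Suc)
  qed
  also have "\<dots> = infsum H ({0<..} \<times> {0<..})" by (rule infsumI[OF has_sum_pairs_divisors[OF sm]])
  finally show ?thesis unfolding eq by (simp add: mult_ac)
qed

text \<open>
  Multiplication by \<open>1 - f(p) p^(-s)\<close> removes the multiples of \<open>p\<close> from the sum.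
\<close>

lemma euler_partial:
  assumes f: "bounded_cmult f" and s: "1 < s" "s \<le> 2" and P: "finite P" "\<And>p. p \<in> P \<Longrightarrow> prime p"
  shows "(\<Sum>\<^sub>\<infinity>n\<in>{n. \<forall>p\<in>P. \<not> p dvd n}. f n * of_real (lw 0 s (real n)))
     = Lser f 0 s * (\<Prod>p\<in>P. 1 - f p * of_real (real p powr (-s)))"
  using P
proof (induction P rule: finite_induct)
  case empty
  show ?case by (simp add: Lser_def)
next
  case (insert p P)
  define x where "x = (\<lambda>n. f n * complex_of_real (lw 0 s (real n)))"
  have nf: "\<And>n. norm (f n) \<le> 1" using f by (simp add: bounded_cmult_def)
  have xs: "x summable_on A" for A
    using abs_summable_summable[OF abs_summable_L[of f s 0, OF nf s]] summable_on_subset_banach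
    unfolding x_def by blast
  have xm: "x (a * b) = x a * x b" for a b
    unfolding x_def lw_def using bounded_cmultD(2)[OF f] by (simp add: powr_mult)
  have p: "prime p" using insert by auto
  let ?A = "{n. \<forall>q\<in>P. \<not> q dvd n}" and ?B = "{n. \<forall>q\<in>insert p P. \<not> q dvd n}"
  have AB: "?A = ?B \<union> (*) p ` ?A"
  proof (intro equalityI subsetI)
    fix n assume n: "n \<in> ?A"
    show "n \<in> ?B \<union> (*) p ` ?A"
    proof (cases "p dvd n")
      case True
      then obtain m where m: "n = p * m" by auto
      with n have "m \<in> ?A" by auto
      with m show ?thesis by blast
    qed (use n in auto)
  next
    fix n assume "n \<in> ?B \<union> (*) p ` ?A"
    moreover have "\<not> q dvd p * m" if "q \<in> P" "m \<in> ?A" for q m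
    proof
      assume "q dvd p * m"
      moreover have "prime q" using insert that by auto
      ultimately have "q dvd p \<or> q dvd m" by (simp add: prime_dvd_mult_iff)
      then show False using that insert(2) p \<open>prime q\<close> primes_dvd_imp_eq[of q p] by auto
    qed
    ultimately show "n \<in> ?A" by auto
  qed
  have "infsum x ?A = infsum x ?B + infsum x ((*) p ` ?A)"
  proof -
    have "infsum x (?B \<union> (*) p ` ?A) = infsum x ?B + infsum x ((*) p ` ?A)"
      by (rule infsum_Un_disjoint) (auto intro: xs)
    then show ?thesis using AB by simp
  qed
  also have "infsum x ((*) p ` ?A) = infsum (\<lambda>n. x p * x n) ?A"
  proof -
    have "inj_on ((*) p) ?A" using p by (auto simp: inj_on_def dest: prime_gt_0_nat)
    then show ?thesis by (subst infsum_reindex) (auto simp: o_def xm)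
  qed
  also have "\<dots> = x p * infsum x ?A" by (rule infsum_cmult_right')
  finally have "infsum x ?B = infsum x ?A - x p * infsum x ?A"
    unfolding eq_diff_eq by (rule sym)
  then have "infsum x ?B = infsum x ?A * (1 - x p)"
    by (simp only: left_diff_distrib mult_1_left mult.commute[of "infsum x ?A"])
  moreover have "x p = f p * of_real (real p powr (-s))" by (simp add: x_def lw_def)
  ultimately show ?case using insert by (simp add: x_def mult_ac)
qed

text \<open>
  Besides 1, a number without prime factors up to \<open>N\<close> exceeds \<open>N\<close>, so only a tail of the convergent
  series is left.
\<close>

lemma euler_partial_tendsto:
  assumes f: "bounded_cmult f" and s: "1 < s" "s \<le> 2"
  shows "(\<lambda>N. Lser f 0 s * (\<Prod>p | prime p \<and> p \<le> N. 1 - f p * of_real (real p powr (-s)))) \<longlonglongrightarrow> 1"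
proof -
  define x where "x = (\<lambda>n. f n * complex_of_real (lw 0 s (real n)))"
  have nf: "\<And>n. norm (f n) \<le> 1" using f by (simp add: bounded_cmult_def)
  have xa: "x abs_summable_on A" for A
    using abs_summable_L[of f s 0, OF nf s] summable_on_subset_banach
    unfolding x_def by blast
  have xs: "x summable_on A" for A
    by (rule abs_summable_summable[OF xa])
  have x1: "x 1 = 1" using bounded_cmultD(1)[OF f] by (simp add: x_def lw_def)
  have x0: "x 0 = 0" by (simp add: x_def)
  let ?T = "\<lambda>N. \<Sum>n. lw 0 s (real (n + Suc N))"
  have T: "?T \<longlonglongrightarrow> 0"
  proof -
    have sm: "summable (\<lambda>n. lw 0 s (real n))" by (rule summable_lw[OF s])
    have "(\<lambda>N. (\<Sum>n. lw 0 s (real n)) - (\<Sum>n<Suc N. lw 0 s (real n))) \<longlonglongrightarrow> (\<Sum>n. lw 0 s (real n)) - (\<Sum>n. lw 0 s (real n))"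
      by (intro tendsto_intros LIMSEQ_Suc summable_LIMSEQ sm)
    moreover have "(\<Sum>n. lw 0 s (real n)) - (\<Sum>n<Suc N. lw 0 s (real n)) = ?T N" for N
      using suminf_minus_initial_segment[OF sm, of "Suc N"] by simp
    ultimately show ?thesis by simp
  qed
  have bnd: "norm (Lser f 0 s * (\<Prod>p | prime p \<and> p \<le> N. 1 - f p * of_real (real p powr (-s))) - 1) \<le> ?T N" for N
  proof -
    let ?A = "{n. \<forall>p\<in>{p. prime p \<and> p \<le> N}. \<not> p dvd n}"
    have A: "?A - {0} \<subseteq> insert 1 {N<..}"
    proof
      fix n assume n: "n \<in> ?A - {0}"
      show "n \<in> insert 1 {N<..}"
      proof (rule ccontr)
        assume "n \<notin> insert 1 {N<..}"
        then have "n \<noteq> 1" "n \<le> N" by auto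
        then obtain p where "prime p" "p dvd n" using prime_factor_nat by auto
        moreover from this have "p \<le> n" using n by (intro dvd_imp_le) auto
        ultimately show False using n \<open>n \<le> N\<close> by auto
      qed
    qed
    have one: "1 \<in> ?A - {0}" by (auto dest: prime_gt_1_nat)
    have "Lser f 0 s * (\<Prod>p | prime p \<and> p \<le> N. 1 - f p * of_real (real p powr (-s))) = infsum x ?A"
      unfolding x_def by (rule euler_partial[symmetric]) (use f s in auto)
    also have "\<dots> = infsum x (insert 1 (?A - {0} - {1}))"
      using one by (intro infsum_cong_neutral) (auto simp: x0)
    also have "\<dots> = 1 + infsum x (?A - {0} - {1})"
      by (subst infsum_insert) (auto intro: xs simp: x1[simplified])
    finally have "norm (Lser f 0 s * (\<Prod>p | prime p \<and> p \<le> N. 1 - f p * of_real (real p powr (-s))) - 1)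
        = norm (infsum x (?A - {0} - {1}))" by simp
    also have "\<dots> \<le> infsum (\<lambda>n. norm (x n)) (?A - {0} - {1})"
      by (rule norm_infsum_bound[OF xa])
    also have "\<dots> \<le> infsum (\<lambda>n. lw 0 s (real n)) {N<..}"
    proof (rule infsum_mono_neutral)
      show "(\<lambda>n. norm (x n)) summable_on ?A - {0} - {1}" using xa by simp
      show "(\<lambda>n. lw 0 s (real n)) summable_on {N<..}"
        using summable_on_lw[OF s] summable_on_subset_banach by blast
      show "norm (x n) \<le> lw 0 s (real n)" for n
        using nf[of n] lw_of_nat_nonneg[of 0 s n] unfolding x_def
        by (auto simp: norm_mult intro!: mult_left_le_one_le)
    qed (use A lw_of_nat_nonneg in auto)
    also have "\<dots> = infsum (\<lambda>n. lw 0 s (real (n + Suc N))) UNIV"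
    proof -
      have "bij_betw (\<lambda>n. n + Suc N) UNIV {N<..}"
        by (rule bij_betwI[of _ _ _ "\<lambda>n. n - Suc N"]) auto
      from infsum_reindex_bij_betw[OF this, of "\<lambda>n. lw 0 s (real n)"] show ?thesis by simp
    qed
    also have "\<dots> = ?T N"
    proof -
      have "(\<lambda>n. lw 0 s (real (n + Suc N))) summable_on UNIV"
        using summable_ignore_initial_segment[OF summable_lw[OF s, of 0], of "Suc N"]
        by (subst summable_on_UNIV_nonneg_real_iff) (use lw_of_nat_nonneg[of 0 s "n + Suc N" for n] in auto)
      from has_sum_imp_sums[OF has_sum_infsum[OF this]] show ?thesis by (simp add: sums_iff)
    qed
    finally show ?thesis .
  qed
  show ?thesis
    by (rule Lim_null_comparison[THEN LIM_zero_cancel]) (use bnd T in \<open>auto intro!: always_eventually\<close>)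
qed

section \<open>The 3-4-1 inequality and the recursion for the logarithmic derivative\<close>

lemma ln_norm_one_minus_sums:
  fixes w :: complex
  assumes "norm w < 1"
  shows "(\<lambda>n. - (Re (w ^ n) / real n)) sums ln (norm (1 - w))"
proof -
  have "(\<lambda>n. - ((- (-w)) ^ n) / of_nat n) sums ln (1 + (-w))"
    using assms by (intro Ln_series') simp
  then have "(\<lambda>n. Re (- (w ^ n) / of_nat n)) sums Re (ln (1 - w))"
    by (intro sums_Re) simp
  moreover have "1 - w \<noteq> 0" using assms by auto
  ultimately show ?thesis by (simp add: Re_divide_of_nat)
qed

text \<open>
  By the power series of \<open>ln (1 - w)\<close>, the logarithm of the left-hand side is the sum of
  \<open>-(x^i / i) (3 + 4 c + (2 c^2 - 1))\<close> with \<open>c = Re (z^i)\<close>, and the bracket is \<open>2 (1 + c)^2\<close>.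
\<close>

lemma three_four_one_local:
  fixes x :: real and z :: complex
  assumes x: "0 \<le> x" "x < 1" and z: "norm z = 1"
  shows "norm (1 - of_real x :: complex) ^ 3 * norm (1 - z * of_real x) ^ 4 * norm (1 - z ^ 2 * of_real x) \<le> 1"
proof -
  let ?a = "1 - of_real x :: complex" and ?b = "1 - z * of_real x" and ?c = "1 - z ^ 2 * of_real x"
  have n: "norm (of_real x :: complex) < 1" "norm (z * of_real x) < 1" "norm (z ^ 2 * of_real x) < 1"
    using x z by (auto simp: norm_mult norm_power)
  have pos: "norm ?a > 0" "norm ?b > 0" "norm ?c > 0" using n by auto
  have sm: "(\<lambda>i. 3 * - (Re (of_real x ^ i) / real i) + 4 * - (Re ((z * of_real x) ^ i) / real i)
      + - (Re ((z ^ 2 * of_real x) ^ i) / real i)) sums (3 * ln (norm ?a) + 4 * ln (norm ?b) + ln (norm ?c))"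
    by (intro sums_add sums_mult ln_norm_one_minus_sums n)
  have le: "3 * - (Re (of_real x ^ i) / real i) + 4 * - (Re ((z * of_real x) ^ i) / real i)
      + - (Re ((z ^ 2 * of_real x) ^ i) / real i) \<le> 0" for i
  proof -
    define u where "u = z ^ i"
    have nu: "norm u = 1" using z by (simp add: u_def norm_power)
    have "(Re u)\<^sup>2 + (Im u)\<^sup>2 = 1" using nu by (simp add: cmod_def)
    then have re: "Re (u ^ 2) = 2 * (Re u)\<^sup>2 - 1" by (simp add: power2_eq_square)
    have zz: "(z ^ 2) ^ i = u ^ 2" by (simp add: u_def flip: power_mult) (simp add: mult.commute)
    have e1: "Re (of_real x ^ i) = x ^ i" by (simp flip: of_real_power)
    have e2: "Re ((z * of_real x) ^ i) = Re u * x ^ i"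
      by (simp add: power_mult_distrib u_def flip: of_real_power)
    have e3: "Re ((z ^ 2 * of_real x) ^ i) = (2 * (Re u)\<^sup>2 - 1) * x ^ i"
      unfolding power_mult_distrib zz by (simp add: re flip: of_real_power)
    have "3 * - (Re (of_real x ^ i) / real i) + 4 * - (Re ((z * of_real x) ^ i) / real i)
      + - (Re ((z ^ 2 * of_real x) ^ i) / real i) = - (x ^ i / real i * (2 * (1 + Re u)\<^sup>2))"
      unfolding e1 e2 e3 by (cases "i = 0") (auto simp: field_simps power2_eq_square)
    also have "\<dots> \<le> 0" using x by simp
    finally show ?thesis .
  qed
  have "3 * ln (norm ?a) + 4 * ln (norm ?b) + ln (norm ?c) \<le> 0"
    by (rule sums_le[OF le sm sums_zero])
  moreover have "ln (norm ?a ^ 3 * norm ?b ^ 4 * norm ?c) = 3 * ln (norm ?a) + 4 * ln (norm ?b) + ln (norm ?c)"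
    using pos by (simp add: ln_mult ln_realpow)
  ultimately show ?thesis using pos by (subst ln_le_zero_iff [symmetric]) auto
qed

lemma three_four_one:
  assumes f: "bounded_cmult f" and f01: "\<And>n. f n = 0 \<or> norm (f n) = 1" and s: "1 < s" "s \<le> 2"
  shows "1 \<le> norm (Lser (\<lambda>_. 1) 0 s) ^ 3 * norm (Lser f 0 s) ^ 4 * norm (Lser (\<lambda>n. f n ^ 2) 0 s)"
proof -
  have f1: "bounded_cmult (\<lambda>_. 1)" by (simp add: bounded_cmult_def)
  have f2: "bounded_cmult (\<lambda>n. f n ^ 2)"
    using f by (auto simp: bounded_cmult_def power_mult_distrib norm_power power_le_one)
  define E where "E = (\<lambda>g N. Lser g 0 s * (\<Prod>p | prime p \<and> p \<le> N. 1 - g p * complex_of_real (real p powr (-s))))"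
  define g2 where "g2 = (\<lambda>n. f n ^ 2)"
  define o1 where "o1 = (\<lambda>_::nat. 1::complex)"
  have lim: "(\<lambda>N. norm (E o1 N) ^ 3 * norm (E f N) ^ 4 * norm (E g2 N)) \<longlonglongrightarrow> norm (1::complex) ^ 3 * norm (1::complex) ^ 4 * norm (1::complex)"
    unfolding E_def o1_def g2_def by (intro tendsto_intros euler_partial_tendsto f f1 f2 s)
  have "norm (E o1 N) ^ 3 * norm (E f N) ^ 4 * norm (E g2 N)
     \<le> norm (Lser o1 0 s) ^ 3 * norm (Lser f 0 s) ^ 4 * norm (Lser g2 0 s)" for N
  proof -
    let ?P = "{p. prime p \<and> p \<le> N}"
    let ?x = "\<lambda>p. complex_of_real (real p powr (-s))"
    have "(\<Prod>p\<in>?P. norm (1 - o1 p * ?x p) ^ 3 * norm (1 - f p * ?x p) ^ 4 * norm (1 - g2 p * ?x p)) \<le> 1"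
    proof (rule prod_le_1)
      fix p assume "p \<in> ?P"
      then have p: "p > 1" by (auto dest: prime_gt_1_nat)
      have x: "0 \<le> real p powr (-s)" "real p powr (-s) < 1"
        using p s powr_less_mono[of "-s" 0 "real p"] by auto
      have "norm (1 - o1 p * ?x p) ^ 3 * norm (1 - f p * ?x p) ^ 4 * norm (1 - g2 p * ?x p) \<le> 1"
      proof (cases "f p = 0")
        case True
        have "norm (1 - ?x p) \<le> 1" using x
          by (metis abs_of_nonneg diff_ge_0_iff_ge less_eq_real_def norm_of_real of_real_1 of_real_diff diff_le_eq le_add_same_cancel1)
        then show ?thesis using True by (simp add: o1_def g2_def power_le_one)
      next
        case False
        then show ?thesis using three_four_one_local[OF x, of "f p"] f01[of p] by (simp add: o1_def g2_def)
      qed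
      then show "0 \<le> norm (1 - o1 p * ?x p) ^ 3 * norm (1 - f p * ?x p) ^ 4 * norm (1 - g2 p * ?x p) \<and>
         norm (1 - o1 p * ?x p) ^ 3 * norm (1 - f p * ?x p) ^ 4 * norm (1 - g2 p * ?x p) \<le> 1" by simp
    qed
    then have "(norm (Lser o1 0 s) ^ 3 * norm (Lser f 0 s) ^ 4 * norm (Lser g2 0 s)) *
       (\<Prod>p\<in>?P. norm (1 - o1 p * ?x p) ^ 3 * norm (1 - f p * ?x p) ^ 4 * norm (1 - g2 p * ?x p))
       \<le> (norm (Lser o1 0 s) ^ 3 * norm (Lser f 0 s) ^ 4 * norm (Lser g2 0 s)) * 1"
      by (intro mult_left_mono) auto
    then show ?thesis
      by (simp add: E_def norm_mult power_mult_distrib prod.distrib prod_power_distrib flip: prod_norm)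
         (simp add: mult_ac)
  qed
  then have "norm (1::complex) ^ 3 * norm (1::complex) ^ 4 * norm (1::complex)
    \<le> norm (Lser o1 0 s) ^ 3 * norm (Lser f 0 s) ^ 4 * norm (Lser g2 0 s)"
    by (intro LIMSEQ_le_const2[OF lim]) auto
  then show ?thesis by (simp add: o1_def g2_def)
qed

text \<open>
  With \<open>t_j = S_j / (j! L^(j+1))\<close> and the analogous normalisation of \<open>Z\<close>, the recursion says that
  \<open>t_0 + ... + t_k\<close> is \<open>k + 1\<close> up to a relative error of order \<open>1 / L\<close>. Two consecutive partial sums
  then determine \<open>t_k\<close> up to an error of order \<open>k / L\<close>.
\<close>

lemma recursion_lower_bound:
  fixes S Z :: "nat \<Rightarrow> real"
  assumes rec: "\<And>k. Z (Suc k) = (\<Sum>j\<le>k. real (k choose j) * S j * Z (k - j))"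
    and S: "\<And>j. S j \<ge> 0"
    and Z: "\<And>j. \<bar>Z j - fact j * L ^ Suc j\<bar> \<le> 6 * 2 ^ j * fact j"
    and L: "L \<ge> 120 * real (k + 1)"
  shows "S k \<ge> fact k * L ^ Suc k / 2"
proof -
  have L120: "L \<ge> 120" using L by (simp add: algebra_simps)
  define z where "z = (\<lambda>j. Z j / (fact j * L ^ Suc j))"
  define t where "t = (\<lambda>j. S j / (fact j * L ^ Suc j))"
  define A where "A = (\<lambda>k. \<Sum>j\<le>k. t j)"
  have t0: "t j \<ge> 0" for j using S L120 by (simp add: t_def)
  have z1: "\<bar>z j - 1\<bar> \<le> 6 / L" for j
  proof -
    have p: "fact j * L ^ Suc j > 0" using L120 by (intro mult_pos_pos zero_less_power) auto
    have "z j - 1 = (Z j - fact j * L ^ Suc j) / (fact j * L ^ Suc j)"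
      using p unfolding z_def by (subst diff_divide_distrib) (simp only: divide_self_if split: if_splits, auto)
    then have "\<bar>z j - 1\<bar> = \<bar>Z j - fact j * L ^ Suc j\<bar> / (fact j * L ^ Suc j)"
      using p by (simp only: abs_divide abs_of_pos)
    also have "\<dots> \<le> (6 * 2 ^ j * fact j) / (fact j * L ^ Suc j)"
      using Z[of j] p by (intro divide_right_mono) auto
    also have "\<dots> = 6 / L * (2 ^ j / L ^ j)" using L120 by (simp add: field_simps)
    also have "\<dots> \<le> 6 / L * 1"
      using L120 by (intro mult_left_mono) (auto intro!: power_mono)
    finally show ?thesis by simp
  qed
  have rec': "real (k + 1) * z (Suc k) = (\<Sum>j\<le>k. t j * z (k - j))" for k
  proof -
    have "fact (Suc k) * L ^ Suc (Suc k) = real (k + 1) * (fact k * L ^ (k + 2))" by simp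
    then have "real (k + 1) * z (Suc k) = Z (Suc k) / (fact k * L ^ (k + 2))"
      unfolding z_def by (simp only: mult_divide_mult_cancel_left_if times_divide_eq_right) simp
    also have "\<dots> = (\<Sum>j\<le>k. real (k choose j) * S j * Z (k - j) / (fact k * L ^ (k + 2)))"
      unfolding rec by (simp add: sum_divide_distrib)
    also have "\<dots> = (\<Sum>j\<le>k. t j * z (k - j))"
    proof (rule sum.cong)
      fix j assume j: "j \<in> {..k}"
      have "L ^ (k + 2) = L ^ Suc j * L ^ Suc (k - j)" using j by (simp flip: power_add)
      moreover have "real (k choose j) = fact k / (fact j * fact (k - j))" using j by (simp add: binomial_fact)
      ultimately show "real (k choose j) * S j * Z (k - j) / (fact k * L ^ (k + 2)) = t j * z (k - j)"
        using L120 unfolding t_def z_def by (simp add: field_simps)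
    qed simp
    finally show ?thesis .
  qed
  have A1: "\<bar>A k - real (k + 1)\<bar> \<le> real (k + 1) * (30 / L)" for k
  proof -
    have L6: "6 / L \<le> 1 / 2" using L120 by (simp add: field_simps)
    have zb: "1/2 \<le> z j" "z j \<le> 2" for j using z1[of j] L6 by linarith+
    have "A k * (1 / 2) \<le> (\<Sum>j\<le>k. t j * z (k - j))"
      unfolding A_def sum_distrib_right by (intro sum_mono mult_left_mono zb t0)
    also have "\<dots> \<le> real (k + 1) * 2"
      using rec'[of k] zb[of "Suc k"] by (metis mult_left_mono of_nat_0_le_iff)
    finally have Ak: "A k \<le> real (k + 1) * 4" by simp
    have "A k - real (k + 1) = real (k + 1) * (z (Suc k) - 1) - (\<Sum>j\<le>k. t j * (z (k - j) - 1))"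
      using rec'[of k] by (simp add: A_def algebra_simps sum_subtractf)
    also have "\<bar>\<dots>\<bar> \<le> real (k + 1) * \<bar>z (Suc k) - 1\<bar> + (\<Sum>j\<le>k. t j * \<bar>z (k - j) - 1\<bar>)"
    proof -
      have "\<bar>\<Sum>j\<le>k. t j * (z (k - j) - 1)\<bar> \<le> (\<Sum>j\<le>k. t j * \<bar>z (k - j) - 1\<bar>)"
        by (rule order.trans[OF sum_abs]) (auto simp: abs_mult t0)
      moreover have "\<bar>real (k + 1) * (z (Suc k) - 1)\<bar> = real (k + 1) * \<bar>z (Suc k) - 1\<bar>"
        by (simp only: abs_mult abs_of_nat)
      ultimately show ?thesis by linarith
    qed
    also have "\<dots> \<le> real (k + 1) * (6 / L) + (\<Sum>j\<le>k. t j * (6 / L))"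
      by (intro add_mono sum_mono mult_left_mono z1 t0) auto
    also have "\<dots> = (real (k + 1) + A k) * (6 / L)" unfolding A_def distrib_right sum_distrib_right ..
    also have "\<dots> \<le> (real (k + 1) * 5) * (6 / L)"
      using Ak L120 by (intro mult_right_mono) auto
    finally show ?thesis by (simp add: mult_ac)
  qed
  have "t k \<ge> 1 / 2"
  proof -
    have "t k \<ge> 1 - 2 * (real (k + 1) * (30 / L))"
    proof (cases k)
      case 0
      then show ?thesis using A1[of 0] L120 by (simp add: A_def abs_if split: if_splits)
    next
      case (Suc m)
      define X where "X = real (k + 1) * (30 / L)"
      have "A k = A m + t k" "real (k + 1) = real (m + 1) + 1" using Suc by (simp_all add: A_def)
      moreover have "real (m + 1) * (30 / L) \<le> X"
        unfolding X_def using Suc L120 by (intro mult_right_mono) auto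
      ultimately have "t k \<ge> 1 - 2 * X"
        using A1[of k, folded X_def] A1[of m] by linarith
      then show ?thesis by (simp add: X_def)
    qed
    moreover have "2 * (real (k + 1) * (30 / L)) \<le> 1 / 2" using L L120 by (simp add: field_simps)
    ultimately show ?thesis by linarith
  qed
  then show ?thesis using L120 by (simp add: t_def field_simps)
qed

text \<open>
  The recursion is solved for \<open>S_k Z_0\<close>. The terms with \<open>j < k\<close> form a geometric sum dominated by its
  last term \<open>A^k B^2\<close>, and \<open>A = 8 B^2 / \<eta>\<close> is the rate for which this closes the induction.
\<close>

lemma recursion_upper_bound:
  fixes S Z :: "nat \<Rightarrow> complex"
  assumes rec: "\<And>k. Z (Suc k) = (\<Sum>j\<le>k. of_nat (k choose j) * S j * Z (k - j))"
    and Z: "\<And>j. norm (Z j) \<le> fact j * B ^ Suc j"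
    and Z0: "norm (Z 0) \<ge> \<eta>" and \<eta>: "0 < \<eta>" "\<eta> \<le> 1" and B: "B \<ge> 1"
  shows "norm (S k) \<le> fact k * (8 * B\<^sup>2 / \<eta>) ^ Suc k"
proof (induction k rule: less_induct)
  case (less k)
  define A where "A = 8 * B\<^sup>2 / \<eta>"
  have "2 * B \<le> 8 * B\<^sup>2" using B by (simp add: power2_eq_square)
  also have "\<dots> \<le> 8 * B\<^sup>2 / \<eta>" using \<eta> B by (simp add: field_simps)
  finally have AB: "2 * B \<le> A" by (simp add: A_def)
  have T: "(\<Sum>j<k. A ^ Suc j * B ^ Suc (k - j)) \<le> 2 * A ^ k * B\<^sup>2" for k
  proof (induction k)
    case (Suc k)
    have "(\<Sum>j<Suc k. A ^ Suc j * B ^ Suc (Suc k - j)) = B * (\<Sum>j<k. A ^ Suc j * B ^ Suc (k - j)) + A ^ Suc k * B\<^sup>2"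
      by (simp add: sum_distrib_left power2_eq_square Suc_diff_le mult_ac)
    also have "\<dots> \<le> B * (2 * A ^ k * B\<^sup>2) + A ^ Suc k * B\<^sup>2"
      using Suc B by (intro add_right_mono mult_left_mono) auto
    also have "\<dots> = (2 * B) * (A ^ k * B\<^sup>2) + A ^ Suc k * B\<^sup>2" by simp
    also have "\<dots> \<le> A * (A ^ k * B\<^sup>2) + A ^ Suc k * B\<^sup>2"
      using AB B by (intro add_right_mono mult_right_mono) auto
    finally show ?case by simp
  qed (use B in auto)
  have "S k * Z 0 = Z (Suc k) - (\<Sum>j<k. of_nat (k choose j) * S j * Z (k - j))"
    unfolding rec by (simp add: lessThan_Suc_atMost[symmetric])
  then have "norm (S k) * norm (Z 0) = norm (Z (Suc k) - (\<Sum>j<k. of_nat (k choose j) * S j * Z (k - j)))"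
    by (metis norm_mult)
  also have "\<dots> \<le> norm (Z (Suc k)) + (\<Sum>j<k. norm (of_nat (k choose j) * S j * Z (k - j)))"
    by (rule order.trans[OF norm_triangle_ineq4]) (auto intro: norm_sum)
  also have "\<dots> \<le> fact (Suc k) * B ^ Suc (Suc k) + (\<Sum>j<k. fact k * (A ^ Suc j * B ^ Suc (k - j)))"
  proof (intro add_mono sum_mono Z)
    fix j assume j: "j \<in> {..<k}"
    have "norm (of_nat (k choose j) * S j * Z (k - j)) = real (k choose j) * norm (S j) * norm (Z (k - j))"
      by (simp add: norm_mult)
    also have "\<dots> \<le> real (k choose j) * (fact j * A ^ Suc j) * (fact (k - j) * B ^ Suc (k - j))"
      using less[of j] j Z AB B unfolding A_def[symmetric]
      by (intro mult_mono mult_nonneg_nonneg) auto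
    also have "\<dots> = fact k * (A ^ Suc j * B ^ Suc (k - j))" using j by (simp add: binomial_fact)
    finally show "norm (of_nat (k choose j) * S j * Z (k - j)) \<le> fact k * (A ^ Suc j * B ^ Suc (k - j))" .
  qed
  also have "\<dots> = fact (Suc k) * B ^ Suc (Suc k) + fact k * (\<Sum>j<k. A ^ Suc j * B ^ Suc (k - j))"
    by (simp add: sum_distrib_left)
  also have "\<dots> \<le> fact k * (A ^ k * B\<^sup>2) + fact k * (2 * A ^ k * B\<^sup>2)"
  proof (intro add_mono mult_left_mono T)
    have "real (Suc k) * B ^ k \<le> 2 ^ k * B ^ k"
      using B of_nat_le_iff[of "Suc k" "2 ^ k", where 'a = real] by (intro mult_right_mono) (auto simp: Suc_le_eq simp del: of_nat_Suc)
    also have "\<dots> \<le> A ^ k" using AB B by (subst power_mult_distrib [symmetric]) (intro power_mono, auto)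
    finally have "real (Suc k) * B ^ k * B\<^sup>2 \<le> A ^ k * B\<^sup>2" by (intro mult_right_mono) auto
    then have "fact k * (real (Suc k) * B ^ k * B\<^sup>2) \<le> fact k * (A ^ k * B\<^sup>2)" by (intro mult_left_mono) auto
    then show "fact (Suc k) * B ^ Suc (Suc k) \<le> fact k * (A ^ k * B\<^sup>2)"
      by (simp add: power2_eq_square mult_ac)
  qed auto
  also have "\<dots> = 3 * (fact k * A ^ k * B\<^sup>2)" by simp
  also have "\<dots> \<le> 8 * (fact k * A ^ k * B\<^sup>2)" using AB B by (intro mult_right_mono) auto
  also have "\<dots> = fact k * A ^ Suc k * \<eta>" using \<eta> by (simp add: A_def)
  finally have *: "norm (S k) * norm (Z 0) \<le> fact k * A ^ Suc k * \<eta>" .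
  have "norm (S k) * \<eta> \<le> norm (S k) * norm (Z 0)" using Z0 by (intro mult_left_mono) auto
  with * have "norm (S k) * \<eta> \<le> fact k * A ^ Suc k * \<eta>" by linarith
  then show ?case using \<eta>(1) unfolding A_def[symmetric] by (rule mult_right_le_imp_le)
qed

lemma Lser_one:
  assumes "1 < s" "s \<le> 2"
  shows "Lser (\<lambda>_. 1) k s = of_real (\<Sum>n. lw k s (real n))"
proof -
  have "(\<lambda>n. complex_of_real (lw k s (real n))) sums Lser (\<lambda>_. 1) k s"
    using L_sums[of "\<lambda>_. 1", OF _ assms] by simp
  moreover have "(\<lambda>n. complex_of_real (lw k s (real n))) sums of_real (\<Sum>n. lw k s (real n))"
    using summable_sums[OF summable_lw[OF assms]] by (rule sums_of_real)
  ultimately show ?thesis by (rule sums_unique2)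
qed

lemma summable_mangoldt_lw:
  assumes "1 < s" "s \<le> 2"
  shows "summable (\<lambda>n. mangoldt n * lw k s (real n))"
  by (rule summable_comparison_test'[OF summable_lw[OF assms, of "Suc k"], of 0])
     (auto simp: abs_mult mangoldt_nonneg lw_of_nat_nonneg intro: mangoldt_lw_le)

lemma Sser_one:
  assumes "1 < s" "s \<le> 2"
  shows "Sser (\<lambda>_. 1) k s = of_real (\<Sum>n. mangoldt n * lw k s (real n))"
proof -
  have "(\<lambda>n. mangoldt n * complex_of_real (lw k s (real n))) sums Sser (\<lambda>_. 1) k s"
    using S_sums[of "\<lambda>_. 1", OF _ assms] by simp
  moreover have "(\<lambda>n. complex_of_real (mangoldt n * lw k s (real n))) sums of_real (\<Sum>n. mangoldt n * lw k s (real n))"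
    using summable_sums[OF summable_mangoldt_lw[OF assms]] by (rule sums_of_real)
  ultimately show ?thesis by (simp add: sums_unique2)
qed

lemma mangoldt_lw_sum_ge:
  assumes L: "L \<ge> 120 * real (k + 1)"
  shows "(\<Sum>n. mangoldt n * lw k (1 + 1 / L) (real n)) \<ge> fact k * L ^ Suc k / 2"
proof (rule recursion_lower_bound[OF _ _ _ L])
  have L1: "L \<ge> 120" using L by (simp add: algebra_simps)
  let ?s = "1 + 1 / L"
  have s: "1 < ?s" "?s \<le> 2" using L1 by (auto simp: field_simps)
  let ?Z = "\<lambda>j. \<Sum>n. lw j ?s (real n)" and ?S = "\<lambda>j. \<Sum>n. mangoldt n * lw j ?s (real n)"
  fix j
  show "?S j \<ge> 0" by (intro suminf_nonneg summable_mangoldt_lw s mult_nonneg_nonneg mangoldt_nonneg lw_of_nat_nonneg)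
  show "\<bar>?Z j - fact j * L ^ Suc j\<bar> \<le> 6 * 2 ^ j * fact j"
    using suminf_lw[OF s, of j] by simp
  have "complex_of_real (?Z (Suc j)) = (\<Sum>i\<le>j. of_nat (j choose i) * of_real (?S i) * of_real (?Z (j - i)))"
    using L_recursion[of "\<lambda>_. 1" ?s j] s by (simp add: bounded_cmult_def Lser_one Sser_one)
  also have "\<dots> = of_real (\<Sum>i\<le>j. real (j choose i) * ?S i * ?Z (j - i))" by simp
  finally show "?Z (Suc j) = (\<Sum>i\<le>j. real (j choose i) * ?S i * ?Z (j - i))"
    by (simp only: of_real_eq_iff)
qed

section \<open>Dirichlet characters to odd moduli\<close>

text \<open>
  The characters of the units modulo \<open>d\<close>, extended by 0 to a periodic function on all numbers.
\<close>

definition dchars :: "nat \<Rightarrow> (nat \<Rightarrow> complex) set" where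
  "dchars d = {\<xi>. \<xi> 1 = 1 \<and> (\<forall>a b. \<xi> (a * b) = \<xi> a * \<xi> b) \<and> (\<forall>n. \<xi> (n + d) = \<xi> n)
      \<and> (\<forall>n. \<xi> n = 0 \<longleftrightarrow> \<not> coprime n d)}"

definition trivial_char :: "nat \<Rightarrow> nat \<Rightarrow> complex" where
  "trivial_char d n = of_bool (coprime n d)"

lemma dcharsD:
  assumes "\<xi> \<in> dchars d"
  shows "\<xi> (Suc 0) = 1" "\<xi> (a * b) = \<xi> a * \<xi> b" "\<xi> (n + d) = \<xi> n" "\<xi> n = 0 \<longleftrightarrow> \<not> coprime n d"
  using assms by (auto simp: dchars_def)

lemma dchars_power: "\<xi> \<in> dchars d \<Longrightarrow> \<xi> (a ^ n) = \<xi> a ^ n"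
  by (induction n) (auto simp: dcharsD)

lemma dchars_mod:
  assumes "\<xi> \<in> dchars d" shows "\<xi> (n mod d) = \<xi> n"
proof -
  have "\<xi> (m + q * d) = \<xi> m" for m q
  proof (induction q)
    case (Suc q)
    have "m + Suc q * d = (m + q * d) + d" by simp
    then show ?case using Suc dcharsD(3)[OF assms, of "m + q * d"] by (simp only:)
  qed simp
  from this[of "n mod d" "n div d"] show ?thesis by simp
qed

lemma dchars_cong: "\<xi> \<in> dchars d \<Longrightarrow> [a = b] (mod d) \<Longrightarrow> \<xi> a = \<xi> b"
  by (metis dchars_mod cong_def)

lemma dchars_root:
  assumes "\<xi> \<in> dchars d" "coprime n d"
  shows "\<xi> n ^ totient d = 1"
proof -
  have "[n ^ totient d = 1] (mod d)" by (rule euler_theorem) (use assms in \<open>simp add: coprime_commute\<close>)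
  then show ?thesis using dchars_cong[OF assms(1)] dchars_power[OF assms(1)] dcharsD(1)[OF assms(1)] by force
qed

lemma norm_dchars:
  assumes "\<xi> \<in> dchars d" "coprime n d" "d > 0"
  shows "norm (\<xi> n) = 1"
proof -
  have "norm (\<xi> n) ^ totient d = 1" using dchars_root[OF assms(1,2)] by (metis norm_power norm_one)
  then show ?thesis using assms(3) power_eq_1_iff[of "norm (\<xi> n)" "totient d"] by auto
qed

lemma dchars_01:
  assumes "\<xi> \<in> dchars d" "d > 0"
  shows "\<xi> n = 0 \<or> norm (\<xi> n) = 1"
  using norm_dchars[OF assms(1) _ assms(2)] dcharsD(4)[OF assms(1)] by blast

lemma norm_dchars_le: "\<xi> \<in> dchars d \<Longrightarrow> d > 0 \<Longrightarrow> norm (\<xi> n) \<le> 1"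
  using dchars_01[of \<xi> d n] by auto

lemma bounded_cmult_dchars: "\<xi> \<in> dchars d \<Longrightarrow> d > 0 \<Longrightarrow> bounded_cmult \<xi>"
  by (auto simp: bounded_cmult_def dcharsD norm_dchars_le)

lemma trivial_char_in_dchars: "trivial_char d \<in> dchars d"
proof -
  have "coprime (n + d) d \<longleftrightarrow> coprime n d" for n by (simp only: coprime_iff_gcd_eq_1 gcd_add1)
  then show ?thesis by (auto simp: dchars_def trivial_char_def)
qed

lemma dchars_mult: "\<xi> \<in> dchars d \<Longrightarrow> \<psi> \<in> dchars d \<Longrightarrow> (\<lambda>n. \<xi> n * \<psi> n) \<in> dchars d"
  by (auto simp: dchars_def)

lemma dchars_cnj: "\<xi> \<in> dchars d \<Longrightarrow> (\<lambda>n. cnj (\<xi> n)) \<in> dchars d"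
  by (auto simp: dchars_def)

lemma dchars_mult_cnj:
  assumes "\<xi> \<in> dchars d" "d > 0"
  shows "\<xi> n * cnj (\<xi> n) = trivial_char d n"
  using norm_dchars[OF assms(1) _ assms(2), of n] dcharsD(4)[OF assms(1), of n]
  by (auto simp: trivial_char_def complex_norm_square[symmetric])

lemma dchars_mult_trivial_char: "\<xi> \<in> dchars d \<Longrightarrow> \<xi> n * trivial_char d n = \<xi> n"
  using dcharsD(4)[of \<xi> d n] by (auto simp: trivial_char_def)

lemma finite_dchars:
  assumes "d > 0" shows "finite (dchars d)"
proof -
  let ?V = "insert 0 {z::complex. z ^ totient d = 1}"
  have fin: "finite (PiE {..<d} (\<lambda>_. ?V))" using assms by (intro finite_PiE) (auto intro!: finite_roots_unity simp: Suc_le_eq)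
  have "(\<lambda>\<xi>. restrict \<xi> {..<d}) ` dchars d \<subseteq> PiE {..<d} (\<lambda>_. ?V)"
  proof
    fix f assume "f \<in> (\<lambda>\<xi>. restrict \<xi> {..<d}) ` dchars d"
    then obtain \<xi> where c: "\<xi> \<in> dchars d" "f = restrict \<xi> {..<d}" by auto
    have "\<xi> n \<in> ?V" for n using dchars_root[OF c(1), of n] dcharsD(4)[OF c(1), of n] by auto
    then show "f \<in> PiE {..<d} (\<lambda>_. ?V)" using c by auto
  qed
  moreover have "inj_on (\<lambda>\<xi>. restrict \<xi> {..<d}) (dchars d)"
  proof (rule inj_onI, rule ext)
    fix \<xi> \<psi> n assume c: "\<xi> \<in> dchars d" "\<psi> \<in> dchars d" "restrict \<xi> {..<d} = restrict \<psi> {..<d}"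
    have "n mod d < d" using assms by simp
    with c(3) have "\<xi> (n mod d) = \<psi> (n mod d)" by (metis lessThan_iff restrict_apply')
    then show "\<xi> n = \<psi> n" using c dchars_mod by metis
  qed
  ultimately show ?thesis using fin finite_imageD finite_subset by blast
qed

text \<open>
  The units modulo \<open>p^k\<close> are the powers of a primitive root \<open>g\<close>; sending \<open>g\<close> to a root of unity of
  order \<open>\<phi>(p^k)\<close> defines a character with trivial kernel.
\<close>

lemma dchars_separate_prime_power:
  assumes p: "prime p" "odd p" and k: "k > 0" and n: "coprime n (p ^ k)" "\<not> [n = 1] (mod p ^ k)"
  shows "\<exists>\<xi>\<in>dchars (p ^ k). \<xi> n \<noteq> 1"
proof -
  let ?m = "p ^ k"
  have p1: "p > 1" using p prime_gt_1_nat by auto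
  have m1: "?m > 1" using p1 k by (metis one_less_power)
  obtain g where g: "residue_primroot ?m g"
    using residue_primroot_odd_prime_power_exists[OF p] k by metis
  have ord: "ord ?m g = totient ?m" and cg: "coprime ?m g" using g by (auto simp: residue_primroot_def)
  have tpos: "totient ?m > 0" using p1 by simp
  have gen: "\<exists>i. [g ^ i = a] (mod ?m)" if "coprime a ?m" for a
  proof -
    have cm: "coprime (a mod ?m) ?m" using that p1 by (subst coprime_mod_left_iff) auto
    have "a mod ?m > 0"
    proof (rule ccontr)
      assume "\<not> a mod ?m > 0"
      then have "coprime 0 ?m" using cm by simp
      then show False using m1 by (metis coprime_0_left_iff nat_dvd_1_iff_1 less_irrefl)
    qed
    with cm have "a mod ?m \<in> totatives ?m" using p1 by (auto simp: totatives_def intro!: less_imp_le mod_less_divisor)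
    then have "a mod ?m \<in> (\<lambda>i. g ^ i mod ?m) ` {..<totient ?m}"
      using residue_primroot_is_generator[OF m1 g] by (auto simp: bij_betw_def)
    then show ?thesis by (auto simp: cong_def)
  qed
  define ind where "ind = (\<lambda>a. SOME i. [g ^ i = a] (mod ?m))"
  have ind: "[g ^ ind a = a] (mod ?m)" if "coprime a ?m" for a
    unfolding ind_def by (rule someI_ex[OF gen[OF that]])
  define \<omega> where "\<omega> = exp (2 * of_real pi * \<i> * of_nat 1 / of_nat (totient ?m))"
  have w: "\<omega> ^ i = \<omega> ^ j \<longleftrightarrow> [i = j] (mod totient ?m)" for i j
  proof -
    have "\<omega> ^ i = exp (2 * of_real pi * \<i> * of_nat i / of_nat (totient ?m))" for i
      unfolding \<omega>_def exp_of_nat_mult[symmetric] by (simp add: mult_ac)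
    then show ?thesis using complex_root_unity_eq[of "totient ?m" i j] tpos
      by (simp add: cong_def Suc_le_eq)
  qed
  have gi: "[g ^ i = g ^ j] (mod ?m) \<longleftrightarrow> [i = j] (mod totient ?m)" for i j
    using order_divides_expdiff[of ?m g i j] cg ord by simp
  define \<xi> where "\<xi> = (\<lambda>a. if coprime a ?m then \<omega> ^ ind a else 0)"
  have ev: "\<xi> a = \<omega> ^ i" if "[g ^ i = a] (mod ?m)" for a i
  proof -
    have "coprime (g ^ i) ?m" using cg by (subst coprime_power_left_iff) (simp only: coprime_commute simp_thms)
    then have ca: "coprime a ?m" using that cong_imp_coprime by blast
    have "[g ^ ind a = g ^ i] (mod ?m)" using ind[OF ca] that by (metis cong_sym cong_trans)
    then show ?thesis using gi w ca by (simp add: \<xi>_def)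
  qed
  have "\<xi> \<in> dchars ?m"
    unfolding dchars_def
  proof (intro CollectI conjI allI)
    show "\<xi> 1 = 1" using ev[of 0 1] by simp
    show "\<xi> (a * b) = \<xi> a * \<xi> b" for a b
    proof (cases "coprime a ?m \<and> coprime b ?m")
      case True
      then have "[g ^ (ind a + ind b) = a * b] (mod ?m)" using ind by (simp add: power_add cong_mult)
      then have "\<xi> (a * b) = \<omega> ^ (ind a + ind b)" by (rule ev)
      then show ?thesis using True by (simp add: \<xi>_def power_add)
    qed (auto simp: \<xi>_def)
    show "\<xi> (a + ?m) = \<xi> a" for a
    proof (cases "coprime a ?m")
      case True
      have "[g ^ ind a = a + ?m] (mod ?m)" using ind[OF True] by (simp add: cong_def)
      then show ?thesis using ev True by (simp add: \<xi>_def)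
    next
      case False
      have "coprime (a + ?m) ?m \<longleftrightarrow> coprime a ?m" by (simp only: coprime_iff_gcd_eq_1 gcd_add1)
      then show ?thesis using False by (simp only: \<xi>_def if_False)
    qed
    show "\<xi> a = 0 \<longleftrightarrow> \<not> coprime a ?m" for a by (auto simp: \<xi>_def \<omega>_def)
  qed
  moreover have "\<xi> n \<noteq> 1"
  proof
    assume "\<xi> n = 1"
    then have "\<omega> ^ ind n = \<omega> ^ 0" using n by (simp add: \<xi>_def)
    then have "[g ^ ind n = g ^ 0] (mod ?m)" unfolding w gi .
    then have "[n = 1] (mod ?m)" using ind[OF n(1)] by (metis cong_sym cong_trans power_0)
    then show False using n by simp
  qed
  ultimately show ?thesis by blast
qed

text \<open>
  If \<open>n\<close> is not 1 modulo \<open>d\<close>, then it is not 1 modulo some prime power exactly dividing \<open>d\<close>, and a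
  character modulo this prime power can be restricted to the units modulo \<open>d\<close>.
\<close>

lemma dchars_separate:
  assumes d: "odd d" "d > 0" and n: "coprime n d" "\<not> [n = 1] (mod d)"
  shows "\<exists>\<xi>\<in>dchars d. \<xi> n \<noteq> 1"
proof -
  have "\<exists>p. prime p \<and> p dvd d \<and> \<not> [n = 1] (mod p ^ multiplicity p d)"
  proof (rule ccontr)
    assume H: "\<not> ?thesis"
    have n1: "n > 1"
    proof -
      have "d \<noteq> 1" using n by (auto simp: cong_def)
      then have "n \<noteq> 0" using n(1) by (metis coprime_0_left_iff nat_dvd_1_iff_1)
      moreover have "n \<noteq> 1" using n by auto
      ultimately show ?thesis by simp
    qed
    have "d dvd n - 1"
    proof (rule multiplicity_le_imp_dvd)
      fix p :: nat assume p: "prime p"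
      show "multiplicity p d \<le> multiplicity p (n - 1)"
      proof (cases "p dvd d")
        case True
        then have "p ^ multiplicity p d dvd n - 1"
          using H p n1 by (auto simp: cong_altdef_nat)
        then show ?thesis using n1 p by (intro multiplicity_geI) auto
      qed (simp add: not_dvd_imp_multiplicity_0)
    qed (use d in auto)
    then show False using n n1 by (simp add: cong_altdef_nat)
  qed
  then obtain p where p: "prime p" "p dvd d" "\<not> [n = 1] (mod p ^ multiplicity p d)" by blast
  let ?m = "p ^ multiplicity p d"
  have md: "?m dvd d" by (rule multiplicity_dvd)
  have mp: "multiplicity p d > 0" using p d by (simp add: prime_multiplicity_gt_zero_iff)
  have cm: "coprime n ?m" using n(1) md by (metis coprime_divisors dvd_refl)
  have op: "odd p" using p(2) d by auto
  obtain \<xi> where c: "\<xi> \<in> dchars ?m" "\<xi> n \<noteq> 1" using dchars_separate_prime_power[OF p(1) op mp cm p(3)] by blast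
  define \<psi> where "\<psi> = (\<lambda>a. \<xi> a * trivial_char d a)"
  have "\<psi> \<in> dchars d" unfolding dchars_def \<psi>_def
  proof (intro CollectI conjI allI)
    fix a
    show "\<xi> (a + d) * trivial_char d (a + d) = \<xi> a * trivial_char d a"
    proof -
      have "[a + d = a] (mod ?m)" using md by (simp add: cong_altdef_nat)
      then show ?thesis using dchars_cong[OF c(1)] dcharsD(3)[OF trivial_char_in_dchars] by metis
    qed
    have "coprime a ?m" if "coprime a d" using that md by (metis coprime_divisors dvd_refl)
    then show "\<xi> a * trivial_char d a = 0 \<longleftrightarrow> \<not> coprime a d"
      using dcharsD(4)[OF c(1), of a] by (auto simp: trivial_char_def)
  qed (use dcharsD[OF c(1)] in \<open>auto simp: trivial_char_def\<close>)
  moreover have "\<psi> n \<noteq> 1" using c n by (simp add: \<psi>_def trivial_char_def)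
  ultimately show ?thesis by blast
qed

text \<open>
  Multiplication by a character that separates \<open>n\<close> from 1 permutes the characters.
\<close>

lemma sum_dchars_eq_0:
  assumes d: "odd d" "d > 0" and n: "coprime n d" "\<not> [n = 1] (mod d)"
  shows "(\<Sum>\<xi>\<in>dchars d. \<xi> n) = 0"
proof -
  obtain \<psi> where p: "\<psi> \<in> dchars d" "\<psi> n \<noteq> 1" using dchars_separate[OF assms] by blast
  have pc: "\<psi> a * cnj (\<psi> a) = trivial_char d a" for a by (rule dchars_mult_cnj[OF p(1) d(2)])
  have bij: "bij_betw (\<lambda>\<xi> a. \<xi> a * \<psi> a) (dchars d) (dchars d)"
  proof (rule bij_betwI[of _ _ _ "\<lambda>\<xi> a. \<xi> a * cnj (\<psi> a)"])
    show "(\<lambda>a. \<xi> a * \<psi> a * cnj (\<psi> a)) = \<xi>" if "\<xi> \<in> dchars d" for \<xi>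
      by (rule ext) (simp only: mult.assoc pc dchars_mult_trivial_char[OF that])
    show "(\<lambda>a. \<xi> a * cnj (\<psi> a) * \<psi> a) = \<xi>" if "\<xi> \<in> dchars d" for \<xi>
    proof
      fix a
      have "\<xi> a * cnj (\<psi> a) * \<psi> a = \<xi> a * (\<psi> a * cnj (\<psi> a))" by (simp only: mult_ac)
      then show "\<xi> a * cnj (\<psi> a) * \<psi> a = \<xi> a"
        using dchars_mult_trivial_char[OF that, of a] by (simp only: pc)
    qed
  qed (use dchars_mult p dchars_cnj[OF p(1)] in auto)
  have "(\<Sum>\<xi>\<in>dchars d. \<xi> n) = (\<Sum>\<xi>\<in>dchars d. \<xi> n * \<psi> n)"
    using sum.reindex_bij_betw[OF bij, of "\<lambda>\<xi>. \<xi> n"] by simp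
  also have "\<dots> = (\<Sum>\<xi>\<in>dchars d. \<xi> n) * \<psi> n" by (simp add: sum_distrib_right)
  finally have "(\<Sum>\<xi>\<in>dchars d. \<xi> n) * (1 - \<psi> n) = 0" by (simp add: algebra_simps)
  then show ?thesis using p by simp
qed

lemma dchars_orthogonality:
  assumes d: "odd d" "d > 0" and b: "coprime b d"
  shows "(\<Sum>\<xi>\<in>dchars d. cnj (\<xi> b) * \<xi> n) = (if [n = b] (mod d) then of_nat (card (dchars d)) else 0)"
proof (cases "coprime n d")
  case False
  then have "\<xi> n = 0" if "\<xi> \<in> dchars d" for \<xi> using dcharsD(4)[OF that] by blast
  moreover have "\<not> [n = b] (mod d)" using False b cong_imp_coprime cong_sym by blast
  ultimately show ?thesis by (auto intro!: sum.neutral)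
next
  case True
  obtain b' where b': "[b * b' = 1] (mod d)" using cong_solve_coprime_nat[OF b] by auto
  have cb': "coprime b' d" 
    using b' by (metis cong_imp_coprime cong_sym coprime_1_left coprime_mult_left_iff)
  have *: "cnj (\<xi> b) * \<xi> n = \<xi> (b' * n)" if c: "\<xi> \<in> dchars d" for \<xi>
  proof -
    have 1: "\<xi> b * \<xi> b' = 1" using dchars_cong[OF c b'] dcharsD[OF c] by simp
    have 2: "\<xi> b * cnj (\<xi> b) = 1" using dchars_mult_cnj[OF c d(2), of b] b by (simp add: trivial_char_def)
    have "cnj (\<xi> b) = \<xi> b'" using 1 2 by (metis mult_left_cancel mult_zero_left zero_neq_one)
    then show ?thesis using dcharsD(2)[OF c] by simp
  qed
  have eq: "[b' * n = 1] (mod d) \<longleftrightarrow> [n = b] (mod d)"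
  proof
    assume "[b' * n = 1] (mod d)"
    then have "[b * (b' * n) = b * 1] (mod d)" by (rule cong_scalar_left)
    moreover have "[b * b' * n = 1 * n] (mod d)" using b' by (rule cong_scalar_right)
    ultimately show "[n = b] (mod d)" by (simp add: mult.assoc) (metis cong_sym cong_trans)
  next
    assume "[n = b] (mod d)"
    then have "[b' * n = b' * b] (mod d)" by (rule cong_scalar_left)
    then show "[b' * n = 1] (mod d)" using b' by (metis cong_trans mult.commute)
  qed
  have "(\<Sum>\<xi>\<in>dchars d. cnj (\<xi> b) * \<xi> n) = (\<Sum>\<xi>\<in>dchars d. \<xi> (b' * n))" using * by simp
  also have "\<dots> = (if [n = b] (mod d) then of_nat (card (dchars d)) else 0)"
  proof (cases "[n = b] (mod d)")
    case t: True
    then have "\<xi> (b' * n) = 1" if "\<xi> \<in> dchars d" for \<xi>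
      using dchars_cong[OF that, of "b' * n" 1] eq dcharsD(1)[OF that] by simp
    then have "(\<Sum>\<xi>\<in>dchars d. \<xi> (b' * n)) = (\<Sum>\<xi>\<in>dchars d. 1)" by (intro sum.cong) auto
    then show ?thesis using t by simp
  next
    case False
    then show ?thesis using sum_dchars_eq_0[OF d, of "b' * n"] eq True cb' by simp
  qed
  finally show ?thesis .
qed

lemma sum_nonprincipal_eq_0:
  assumes c: "\<xi> \<in> dchars d" "\<xi> \<noteq> trivial_char d" and d: "d > 0"
  shows "(\<Sum>n<d. \<xi> n) = 0"
proof -
  have "\<exists>a. coprime a d \<and> \<xi> a \<noteq> 1"
  proof (rule ccontr)
    assume "\<not> ?thesis"
    then have "\<xi> a = trivial_char d a" for a using dcharsD(4)[OF c(1), of a] by (auto simp: trivial_char_def)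
    then show False using c by auto
  qed
  then obtain a where a: "coprime a d" "\<xi> a \<noteq> 1" by blast
  have inj: "inj_on (\<lambda>n. a * n mod d) {..<d}"
  proof (rule inj_onI)
    fix x y assume xy: "x \<in> {..<d}" "y \<in> {..<d}" "a * x mod d = a * y mod d"
    then have "[a * x = a * y] (mod d)" by (simp add: cong_def)
    then have "[x = y] (mod d)" using a by (simp add: cong_mult_lcancel_nat)
    then show "x = y" using xy by (simp add: cong_def)
  qed
  have im: "(\<lambda>n. a * n mod d) ` {..<d} = {..<d}"
    using inj d by (intro endo_inj_surj) auto
  have "(\<Sum>n<d. \<xi> n) = (\<Sum>n<d. \<xi> (a * n mod d))"
    using sum.reindex[OF inj, of \<xi>] unfolding im by simp
  also have "\<dots> = (\<Sum>n<d. \<xi> a * \<xi> n)"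
    using dchars_mod[OF c(1)] dcharsD(2)[OF c(1)] by simp
  also have "\<dots> = \<xi> a * (\<Sum>n<d. \<xi> n)" by (simp add: sum_distrib_left)
  finally have "(1 - \<xi> a) * (\<Sum>n<d. \<xi> n) = 0" by (simp add: algebra_simps)
  then show ?thesis using a by simp
qed

lemma card_dchars:
  assumes d: "odd d" "d > 1"
  shows "card (dchars d) = totient d"
proof -
  have d0: "d > 0" using d by simp
  have "of_nat (card (dchars d)) = (\<Sum>n<d. \<Sum>\<xi>\<in>dchars d. cnj (\<xi> 1) * \<xi> n)"
  proof -
    have "(\<Sum>n<d. \<Sum>\<xi>\<in>dchars d. cnj (\<xi> 1) * \<xi> n) = (\<Sum>n<d. if n = 1 then of_nat (card (dchars d)) else 0)"
      using d by (intro sum.cong) (auto simp: dchars_orthogonality[OF d(1) d0] cong_def simp del: One_nat_def)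
    then show ?thesis using d by simp
  qed
  also have "\<dots> = (\<Sum>\<xi>\<in>dchars d. \<Sum>n<d. \<xi> n)"
    by (subst sum.swap) (simp add: dcharsD)
  also have "\<dots> = (\<Sum>\<xi>\<in>{trivial_char d}. \<Sum>n<d. \<xi> n)"
    using finite_dchars[OF d0] trivial_char_in_dchars sum_nonprincipal_eq_0[OF _ _ d0]
    by (intro sum.mono_neutral_right) auto
  also have "\<dots> = of_nat (card {n. n < d \<and> coprime n d})"
    by (simp add: trivial_char_def of_bool_def sum.If_cases Int_def lessThan_def)
  also have "{n. n < d \<and> coprime n d} = totatives d"
  proof (intro equalityI subsetI)
    fix n assume n: "n \<in> {n. n < d \<and> coprime n d}"
    then have "n \<noteq> 0" using d by (metis coprime_0_left_iff mem_Collect_eq nat_dvd_1_iff_1 less_irrefl)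
    then show "n \<in> totatives d" using n by (auto simp: totatives_def)
  next
    fix n assume "n \<in> totatives d"
    then show "n \<in> {n. n < d \<and> coprime n d}" using d totatives_less[of n d] by (auto simp: totatives_def)
  qed
  finally show ?thesis by (simp add: totient_def)
qed

lemma norm_dchars_partial_sum_le:
  assumes c: "\<xi> \<in> dchars d" "\<xi> \<noteq> trivial_char d" and d: "d > 0"
  shows "norm (\<Sum>n<N. \<xi> n) \<le> d"
proof (induction N rule: less_induct)
  case (less N)
  show ?case
  proof (cases "N \<le> d")
    case True
    have "norm (\<Sum>n<N. \<xi> n) \<le> (\<Sum>n<N. 1)" using norm_dchars_le[OF c(1) d] by (intro sum_norm_le)
    then show ?thesis using True by simp
  next
    case False
    have "(\<Sum>n<N. \<xi> n) = (\<Sum>n<d. \<xi> n) + (\<Sum>n=d..<N. \<xi> n)"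
      using False by (simp add: sum.atLeastLessThan_concat lessThan_atLeast0)
    also have "(\<Sum>n=d..<N. \<xi> n) = (\<Sum>n<N-d. \<xi> (n + d))"
      using False sum.shift_bounds_nat_ivl[of \<xi> 0 d "N - d"] by (simp add: lessThan_atLeast0)
    finally have "(\<Sum>n<N. \<xi> n) = (\<Sum>n<N-d. \<xi> n)"
      by (simp add: sum_nonprincipal_eq_0[OF c d] dcharsD(3)[OF c(1)])
    then show ?thesis using less[of "N - d"] False d by simp
  qed
qed

section \<open>Bounds for the series of nontrivial characters\<close>

text \<open>
  Partial summation; the variation of \<open>g\<close> is dominated by the decrements of \<open>v\<close>.
\<close>

lemma abel_bound:
  fixes a :: "nat \<Rightarrow> complex" and g v :: "nat \<Rightarrow> real"
  assumes P: "\<And>n. norm (\<Sum>i<n. a i) \<le> D" and g: "\<And>n. n \<ge> N \<Longrightarrow> \<bar>g (Suc n) - g n\<bar> \<le> v n - v (Suc n)"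
    and v: "\<And>n. n \<ge> N \<Longrightarrow> v n \<ge> 0" and M: "N \<le> M"
  shows "norm (\<Sum>n=N..<M. a n * of_real (g n)) \<le> 2 * D * (\<bar>g N\<bar> + v N)"
proof -
  define A where "A = (\<lambda>n. \<Sum>i<n. a i)"
  have D: "D \<ge> 0" using P[of 0] by simp
  have "norm ((\<Sum>n=N..<M. a n * of_real (g n)) - A M * of_real (g M) + A N * of_real (g N)) \<le> D * (v N - v M)
      \<and> \<bar>g M\<bar> \<le> \<bar>g N\<bar> + v N - v M"
    using M
  proof (induction M rule: dec_induct)
    case base
    show ?case by simp
  next
    case (step m)
    have "(\<Sum>n=N..<Suc m. a n * of_real (g n)) - A (Suc m) * of_real (g (Suc m)) + A N * of_real (g N)
      = ((\<Sum>n=N..<m. a n * of_real (g n)) - A m * of_real (g m) + A N * of_real (g N))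
        - A (Suc m) * of_real (g (Suc m) - g m)"
      using step.hyps by (simp add: A_def algebra_simps)
    also have "norm \<dots> \<le> D * (v N - v m) + norm (A (Suc m) * of_real (g (Suc m) - g m))"
      using step.IH by (intro order.trans[OF norm_triangle_ineq4] add_mono) auto
    also have "norm (A (Suc m) * of_real (g (Suc m) - g m)) \<le> D * (v m - v (Suc m))"
      unfolding norm_mult norm_of_real using P[of "Suc m"] g[of m] step.hyps D by (intro mult_mono) (auto simp: A_def simp del: sum.lessThan_Suc)
    finally have "norm ((\<Sum>n=N..<Suc m. a n * of_real (g n)) - A (Suc m) * of_real (g (Suc m)) + A N * of_real (g N))
      \<le> D * (v N - v (Suc m))" by (simp add: algebra_simps)
    moreover have "\<bar>g (Suc m)\<bar> \<le> \<bar>g N\<bar> + v N - v (Suc m)" using step g[of m] by linarith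
    ultimately show ?case by blast
  qed
  then have 1: "norm ((\<Sum>n=N..<M. a n * of_real (g n)) - A M * of_real (g M) + A N * of_real (g N)) \<le> D * (v N - v M)"
    and 2: "\<bar>g M\<bar> \<le> \<bar>g N\<bar> + v N - v M" by auto
  have "(\<Sum>n=N..<M. a n * of_real (g n))
     = ((\<Sum>n=N..<M. a n * of_real (g n)) - A M * of_real (g M) + A N * of_real (g N)) + A M * of_real (g M) - A N * of_real (g N)"
    by simp
  also have "norm \<dots> \<le> D * (v N - v M) + D * (\<bar>g N\<bar> + v N - v M) + D * \<bar>g N\<bar>"
  proof -
    have tri: "norm (x + y - z) \<le> norm x + norm y + norm z" for x y z :: complex
      using norm_triangle_ineq4[of "x + y" z] norm_triangle_ineq[of x y] by linarith
    have "norm (A M * of_real (g M)) \<le> D * (\<bar>g N\<bar> + v N - v M)"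
      unfolding norm_mult norm_of_real using P[of M] 2 D by (intro mult_mono) (auto simp: A_def)
    moreover have "norm (A N * of_real (g N)) \<le> D * \<bar>g N\<bar>"
      unfolding norm_mult norm_of_real using P[of N] D by (intro mult_mono) (auto simp: A_def)
    ultimately show ?thesis using 1 by (intro order.trans[OF tri] add_mono)
  qed
  also have "\<dots> = 2 * D * (\<bar>g N\<bar> + v N) - 2 * D * v M" by (simp add: algebra_simps)
  also have "\<dots> \<le> 2 * D * (\<bar>g N\<bar> + v N)" using D v[OF M] by simp
  finally show ?thesis .
qed

lemma lw_le_var: "u \<ge> 1 \<Longrightarrow> s \<ge> 1 \<Longrightarrow> lw k s u \<le> lw_var k u"
proof -
  assume u: "u \<ge> 1" and s: "s \<ge> 1"
  have "lw k s u \<le> (fact k * 2 ^ k * u powr (1/2)) * u powr (-1)"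
    unfolding lw_def using ln_power_le_sqrt[OF u, of k] u s by (intro mult_mono powr_mono) auto
  also have "\<dots> = fact k * 2 ^ k * (u powr (1/2) * u powr (-1))" by (simp only: mult.assoc)
  also have "u powr (1/2) * u powr (-1) = u powr (-1/2)" by (subst powr_add [symmetric]) simp
  also have "1 * (fact k * 2 ^ k * u powr (-1/2)) \<le> 6 * (fact k * 2 ^ k * u powr (-1/2))"
    by (intro mult_right_mono) auto
  then have "fact k * 2 ^ k * u powr (-1/2) \<le> lw_var k u" by (simp add: lw_var_def mult_ac)
  finally show ?thesis .
qed

lemma nontrivial_char_tail_le:
  assumes c: "\<xi> \<in> dchars d" "\<xi> \<noteq> trivial_char d" and d: "d > 0" and s: "1 \<le> s" "s \<le> 2" and N: "1 \<le> N" "N \<le> M"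
  shows "norm (\<Sum>n=N..<M. \<xi> n * of_real (lw k s (real n))) \<le> 4 * real d * lw_var k (real N)"
proof -
  have "norm (\<Sum>n=N..<M. \<xi> n * of_real (lw k s (real n))) \<le> 2 * real d * (\<bar>lw k s (real N)\<bar> + lw_var k (real N))"
    by (rule abel_bound[where v = "\<lambda>n. lw_var k (real n)"])
       (use norm_dchars_partial_sum_le[OF c d] abs_lw_diff_le s N lw_var_nonneg in auto)
  also have "\<dots> \<le> 2 * real d * (lw_var k (real N) + lw_var k (real N))"
    using lw_le_var[of "real N" s k] lw_of_nat_nonneg[of k s N] N s by (intro mult_left_mono add_right_mono) auto
  finally show ?thesis by simp
qed

text \<open>
  The summand \<open>1 + 2 ln d\<close> bounds the terms up to \<open>d^2\<close> of a nontrivial character's series, the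
  remaining 24 the tail; see \<open>nontrivial_char_partial_le\<close>.
\<close>

definition L_bound :: "real \<Rightarrow> real" where "L_bound d = 25 + 2 * ln d"

text \<open>
  Up to \<open>d^2\<close> the terms are bounded trivially. Beyond \<open>d^2\<close> partial summation applies: the variation
  of the weight there is of order \<open>1 / d\<close>, which compensates the bound \<open>d\<close> for the character sums.
\<close>

lemma nontrivial_char_partial_le:
  assumes c: "\<xi> \<in> dchars d" "\<xi> \<noteq> trivial_char d" and d: "d \<ge> 1" and s: "1 \<le> s" "s \<le> 2"
  shows "norm (\<Sum>n<M. \<xi> n * of_real (lw k s (real n))) \<le> fact k * L_bound d ^ Suc k"
proof -
  let ?N = "min M (Suc (d\<^sup>2))"
  have d0: "d > 0" using d by simp
  have l: "0 \<le> ln (real d)" using d by simp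
  have "norm (\<Sum>n<?N. \<xi> n * of_real (lw k s (real n))) \<le> (1 + 2 * ln d) ^ Suc k"
  proof -
    have "norm (\<Sum>n<?N. \<xi> n * of_real (lw k s (real n))) \<le> (\<Sum>n<?N. lw k s (real n))"
      using norm_dchars_le[OF c(1) d0]
      by (intro sum_norm_le) (auto simp: norm_mult lw_of_nat_nonneg intro!: mult_left_le_one_le)
    also have "\<dots> \<le> (\<Sum>n\<le>d\<^sup>2. lw k s (real n))"
      by (intro sum_mono2) (auto simp: lw_of_nat_nonneg)
    also have "\<dots> = (\<Sum>n=1..d\<^sup>2. lw k s (real n))"
      by (simp add: atMost_atLeast0 sum.atLeast_Suc_atMost)
    also have "\<dots> \<le> (\<Sum>n=1..d\<^sup>2. (2 * ln d) ^ k * inverse (real n))"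
    proof (rule sum_mono)
      fix n assume n: "n \<in> {1..d\<^sup>2}"
      have "ln (real n) \<le> ln (real (d\<^sup>2))" using n d0 by (subst ln_le_cancel_iff) (auto simp flip: of_nat_power)
      also have "\<dots> = 2 * ln d" using d by (simp add: ln_realpow)
      finally have "ln (real n) ^ k \<le> (2 * ln d) ^ k" using n by (intro power_mono) auto
      moreover have "real n powr (-s) \<le> real n powr (-1)" using n s by (intro powr_mono) auto
      ultimately show "lw k s (real n) \<le> (2 * ln d) ^ k * inverse (real n)"
        unfolding lw_def using n l by (intro mult_mono) (auto simp: powr_minus)
    qed
    also have "\<dots> = (2 * ln d) ^ k * harm (d\<^sup>2)" by (simp add: harm_def sum_distrib_left)
    also have "\<dots> \<le> (2 * ln d) ^ k * (1 + 2 * ln d)"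
    proof (rule mult_left_mono)
      have "harm (d\<^sup>2) \<le> 1 + ln (real (d\<^sup>2))"
        using euler_mascheroni_sequence_decreasing[of 1 "d\<^sup>2"] d by (simp add: harm_expand)
      also have "\<dots> = 1 + 2 * ln d" using d by (simp add: ln_realpow)
      finally show "harm (d\<^sup>2) \<le> 1 + 2 * ln d" .
    qed (use l in simp)
    also have "(2 * ln d) ^ k * (1 + 2 * ln d) \<le> (1 + 2 * ln d) ^ k * (1 + 2 * ln d)"
      using l by (intro mult_right_mono power_mono) auto
    finally show ?thesis by (simp only: power_Suc2)
  qed
  moreover have "norm (\<Sum>n=?N..<M. \<xi> n * of_real (lw k s (real n))) \<le> 24 * 2 ^ k * fact k"
  proof (cases "M \<le> Suc (d\<^sup>2)")
    case False
    then have N: "?N = Suc (d\<^sup>2)" by simp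
    have "norm (\<Sum>n=?N..<M. \<xi> n * of_real (lw k s (real n))) \<le> 4 * real d * lw_var k (real (Suc (d\<^sup>2)))"
      unfolding N by (rule nontrivial_char_tail_le[OF c d0 s]) (use False in auto)
    also have "\<dots> \<le> 4 * real d * (6 * 2 ^ k * fact k * (1 / real d))"
    proof -
      have "real (Suc (d\<^sup>2)) powr (-1/2) \<le> real (d\<^sup>2) powr (-1/2)"
        using d by (intro powr_mono2') auto
      also have "\<dots> = 1 / real d"
      proof -
        have "real (d\<^sup>2) = real d powr 2" using d by (simp add: powr_numeral)
        then have "real (d\<^sup>2) powr (-1/2) = real d powr (-1)" by (simp only: powr_powr) simp
        then show ?thesis using d by (simp add: powr_minus_divide)
      qed
      finally show ?thesis unfolding lw_var_def by (intro mult_left_mono) auto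
    qed
    also have "\<dots> = 24 * 2 ^ k * fact k" using d by simp
    finally show ?thesis .
  qed simp
  moreover have "(\<Sum>n<M. \<xi> n * of_real (lw k s (real n)))
     = (\<Sum>n<?N. \<xi> n * of_real (lw k s (real n))) + (\<Sum>n=?N..<M. \<xi> n * of_real (lw k s (real n)))"
    by (simp add: lessThan_atLeast0 sum.atLeastLessThan_concat)
  ultimately have "norm (\<Sum>n<M. \<xi> n * of_real (lw k s (real n))) \<le> (1 + 2 * ln d) ^ Suc k + 24 * 2 ^ k * fact k"
    by (simp only:) (rule norm_triangle_mono)
  also have "\<dots> \<le> fact k * (1 + 2 * ln d) * L_bound d ^ k + fact k * 24 * L_bound d ^ k"
  proof (rule add_mono)
    have "(1 + 2 * ln d) ^ Suc k \<le> (1 + 2 * ln d) * L_bound d ^ k"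
      using l by (auto simp: L_bound_def intro!: mult_left_mono power_mono)
    also have "\<dots> \<le> fact k * ((1 + 2 * ln d) * L_bound d ^ k)"
      using l by (intro mult_right_mono[of 1 "fact k", simplified]) (auto simp: L_bound_def fact_ge_1)
    finally show "(1 + 2 * ln d) ^ Suc k \<le> fact k * (1 + 2 * ln d) * L_bound d ^ k" by simp
    have "(2::real) ^ k \<le> L_bound d ^ k" using l by (intro power_mono) (auto simp: L_bound_def)
    then show "24 * 2 ^ k * fact k \<le> fact k * 24 * L_bound d ^ k" by simp
  qed
  also have "\<dots> = fact k * L_bound d ^ Suc k" by (simp add: L_bound_def algebra_simps)
  finally show ?thesis .
qed

lemma norm_Lser_le:
  assumes c: "\<xi> \<in> dchars d" "\<xi> \<noteq> trivial_char d" and d: "d \<ge> 1" and s: "1 < s" "s \<le> 2"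
  shows "norm (Lser \<xi> k s) \<le> fact k * L_bound d ^ Suc k"
proof -
  have "(\<lambda>M. norm (\<Sum>n<M. \<xi> n * of_real (lw k s (real n)))) \<longlonglongrightarrow> norm (Lser \<xi> k s)"
    using L_sums[of \<xi> s k] norm_dchars_le[OF c(1)] d s unfolding sums_def by (intro tendsto_norm) auto
  then show ?thesis
    by (rule LIMSEQ_le_const2) (use nontrivial_char_partial_le[OF c d, where k = k and s = s] s in auto)
qed

lemma nontrivial_char_partial_lipschitz:
  assumes c: "\<xi> \<in> dchars d" "\<xi> \<noteq> trivial_char d" and d: "d \<ge> 1" and s: "s \<in> {1..2}" "s' \<in> {1..2}"
  shows "norm ((\<Sum>n<M. \<xi> n * of_real (lw 0 s (real n))) - (\<Sum>n<M. \<xi> n * of_real (lw 0 s' (real n))))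
     \<le> (L_bound d)\<^sup>2 * \<bar>s - s'\<bar>"
proof -
  let ?f = "\<lambda>s. \<Sum>n<M. \<xi> n * complex_of_real (lw 0 s (real n))"
  let ?f' = "\<lambda>s. - (\<Sum>n<M. \<xi> n * complex_of_real (lw 1 s (real n)))"
  have der: "(?f has_vector_derivative ?f' x) (at x within {1..2})" for x
  proof -
    have "((\<lambda>s. complex_of_real (lw 0 s (real n))) has_vector_derivative of_real (- lw 1 x (real n))) (at x within {1..2})" for n
    proof (rule has_vector_derivative_of_real)
      show "((\<lambda>s. lw 0 s (real n)) has_field_derivative - lw 1 x (real n)) (at x within {1..2})"
      proof (cases "n = 0")
        case False
        then show ?thesis unfolding lw_def
          by (auto intro!: derivative_eq_intros simp: powr_def)
      qed simp
    qed
    then have "((\<lambda>s. \<Sum>n<M. \<xi> n * complex_of_real (lw 0 s (real n))) has_vector_derivative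
        (\<Sum>n<M. \<xi> n * of_real (- lw 1 x (real n)))) (at x within {1..2})"
      by (intro has_vector_derivative_sum has_vector_derivative_mult_right)
    then show ?thesis by (simp add: sum_negf)
  qed
  have "norm (?f s - ?f s') \<le> (L_bound d)\<^sup>2 * norm (s - s')"
  proof (rule differentiable_bound[of "{1..2}" ?f "\<lambda>x h. h *\<^sub>R ?f' x"])
    show "(?f has_derivative (\<lambda>h. h *\<^sub>R ?f' x)) (at x within {1..2})" for x
      using der[of x] unfolding has_vector_derivative_def .
    show "onorm (\<lambda>h. h *\<^sub>R ?f' x) \<le> (L_bound d)\<^sup>2" if "x \<in> {1..2}" for x
    proof (rule onorm_le)
      fix h :: real
      have "norm (?f' x) \<le> (L_bound d)\<^sup>2"
        using nontrivial_char_partial_le[OF c d, where k = 1 and M = M and s = x] that by (simp add: power2_eq_square)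
      then show "norm (h *\<^sub>R ?f' x) \<le> (L_bound d)\<^sup>2 * norm h"
        by (simp only: norm_scaleR real_norm_def mult.commute[of "\<bar>h\<bar>"]) (rule mult_right_mono, auto)
    qed
  qed (use s in auto)
  then show ?thesis by simp
qed

lemma Lser_lipschitz:
  assumes c: "\<xi> \<in> dchars d" "\<xi> \<noteq> trivial_char d" and d: "d \<ge> 1" and s: "s \<in> {1<..2}" "s' \<in> {1<..2}"
  shows "norm (Lser \<xi> 0 s - Lser \<xi> 0 s') \<le> (L_bound d)\<^sup>2 * \<bar>s - s'\<bar>"
proof -
  have "(\<lambda>M. norm ((\<Sum>n<M. \<xi> n * of_real (lw 0 s (real n))) - (\<Sum>n<M. \<xi> n * of_real (lw 0 s' (real n)))))
     \<longlonglongrightarrow> norm (Lser \<xi> 0 s - Lser \<xi> 0 s')"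
    using L_sums[of \<xi> s 0] L_sums[of \<xi> s' 0] norm_dchars_le[OF c(1)] d s unfolding sums_def
    by (intro tendsto_norm tendsto_diff) auto
  then show ?thesis
    by (rule LIMSEQ_le_const2) (use nontrivial_char_partial_lipschitz[OF c d, where s = s and s' = s'] s in auto)
qed

text \<open>
  At \<open>1 + \<theta>\<close> the 3-4-1 inequality bounds the series below by \<open>(\<theta>^3 / (8 B))^(1/4)\<close>, while moving from
  \<open>1 + \<theta>\<close> to \<open>s\<close> changes it by at most \<open>B^2 \<theta>\<close>. The value \<open>\<theta> = 1 / (128 B^9)\<close> makes the former
  twice the latter.
\<close>

lemma Lser_complex_char_ge:
  assumes c: "\<xi> \<in> dchars d" "\<xi> \<noteq> trivial_char d" and c2: "(\<lambda>n. \<xi> n ^ 2) \<noteq> trivial_char d" and d: "d \<ge> 1"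
    and B: "B \<ge> L_bound d" and s: "1 < s" "s \<le> 1 + 1 / (128 * B ^ 9)"
  shows "norm (Lser \<xi> 0 s) \<ge> 1 / (128 * B ^ 7)"
proof -
  define \<theta> where "\<theta> = 1 / (128 * B ^ 9)"
  have d0: "d > 0" using d by simp
  have "0 \<le> ln (real d)" using d by simp
  then have B25: "B \<ge> 25" using B by (simp add: L_bound_def)
  have Bpos: "B > 0" using B25 by simp
  have "(1::real) \<le> B ^ 9" using B25 by (intro one_le_power) auto
  then have th: "0 < \<theta>" "\<theta> \<le> 1 / 128" using Bpos by (auto simp: \<theta>_def field_simps)
  let ?s = "1 + \<theta>"
  have s0: "1 < ?s" "?s \<le> 2" using th by auto
  have sq: "(\<lambda>n. \<xi> n ^ 2) \<in> dchars d" using dchars_mult[OF c(1) c(1)] by (simp add: power2_eq_square)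
  have "1 \<le> norm (Lser (\<lambda>_. 1) 0 ?s) ^ 3 * norm (Lser \<xi> 0 ?s) ^ 4 * norm (Lser (\<lambda>n. \<xi> n ^ 2) 0 ?s)"
    by (rule three_four_one[OF bounded_cmult_dchars[OF c(1) d0] dchars_01[OF c(1) d0] s0])
  also have "\<dots> \<le> (2 / \<theta>) ^ 3 * norm (Lser \<xi> 0 ?s) ^ 4 * B"
  proof (intro mult_mono power_mono)
    have z: "\<bar>(\<Sum>n. lw 0 ?s (real n)) - 1 / \<theta>\<bar> \<le> 6" using suminf_lw[OF s0, of 0] by simp
    moreover have "6 \<le> 1 / \<theta>" using th by (simp add: field_simps)
    ultimately have "\<bar>\<Sum>n. lw 0 ?s (real n)\<bar> \<le> 2 / \<theta>" by linarith
    then show "norm (Lser (\<lambda>_. 1) 0 ?s) \<le> 2 / \<theta>" by (simp only: Lser_one[OF s0] norm_of_real)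
    show "norm (Lser (\<lambda>n. \<xi> n ^ 2) 0 ?s) \<le> B"
      using norm_Lser_le[OF sq c2 d s0, of 0] B by simp
  qed (use th in auto)
  finally have "1 \<le> (2 / \<theta>) ^ 3 * norm (Lser \<xi> 0 ?s) ^ 4 * B" .
  then have "\<theta> ^ 3 \<le> 8 * B * norm (Lser \<xi> 0 ?s) ^ 4"
    using th by (simp add: field_simps power_divide)
  moreover have "8 * B * (2 * \<theta> * B\<^sup>2) ^ 4 = \<theta> ^ 3"
  proof -
    have "8 * B * (2 * \<theta> * B\<^sup>2) ^ 4 = \<theta> ^ 3 * (\<theta> * (128 * B ^ 9))"
      by (simp add: power_mult_distrib flip: power_mult) (simp add: eval_nat_numeral)
    then show ?thesis using Bpos by (simp add: \<theta>_def)
  qed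
  ultimately have "8 * B * (2 * \<theta> * B\<^sup>2) ^ 4 \<le> 8 * B * norm (Lser \<xi> 0 ?s) ^ 4" by simp
  then have "(2 * \<theta> * B\<^sup>2) ^ 4 \<le> norm (Lser \<xi> 0 ?s) ^ 4" using Bpos by simp
  then have 1: "2 * \<theta> * B\<^sup>2 \<le> norm (Lser \<xi> 0 ?s)" using power_mono_iff[of "2 * \<theta> * B\<^sup>2" "norm (Lser \<xi> 0 ?s)" 4] th by auto
  have "norm (Lser \<xi> 0 ?s - Lser \<xi> 0 s) \<le> (L_bound d)\<^sup>2 * \<bar>?s - s\<bar>"
    using s(1) s(2)[folded \<theta>_def] s0 th by (intro Lser_lipschitz[OF c d]) auto
  also have "\<dots> \<le> B\<^sup>2 * \<theta>"
    using s B d by (intro mult_mono power_mono) (auto simp: \<theta>_def L_bound_def)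
  finally have 2: "norm (Lser \<xi> 0 ?s - Lser \<xi> 0 s) \<le> B\<^sup>2 * \<theta>" .
  have "norm (Lser \<xi> 0 ?s) \<le> norm (Lser \<xi> 0 s) + norm (Lser \<xi> 0 ?s - Lser \<xi> 0 s)"
    by (metis add.commute diff_add_cancel norm_triangle_ineq)
  with 1 2 have "norm (Lser \<xi> 0 s) \<ge> \<theta> * B\<^sup>2" by (simp add: algebra_simps)
  also have "\<theta> * B\<^sup>2 = 1 / (128 * B ^ 7)" using Bpos by (simp add: \<theta>_def field_simps flip: power_add)
  finally show ?thesis .
qed

section \<open>Real characters\<close>

lemma bij_betw_divisors_coprime:
  assumes "coprime a b" "a > 0" "b > (0::nat)"
  shows "bij_betw (\<lambda>(x, y). x * y) ({d. d dvd a} \<times> {d. d dvd b}) {d. d dvd a * b}"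
  unfolding bij_betw_def
proof
  have g: "gcd (x * y) a = x" "gcd (x * y) b = y" if "x dvd a" "y dvd b" for x y
  proof -
    have "coprime a y" using assms(1) that(2) coprime_divisors[of a a y b] by simp
    then show "gcd (x * y) a = x"
      using that(1) by (simp add: gcd_mult_left_right_cancel gcd_nat.absorb1 coprime_commute)
    have "coprime x b" using assms(1) that(1) coprime_divisors[of x a b b] by simp
    then show "gcd (x * y) b = y"
      using that(2) by (simp add: gcd_mult_left_left_cancel gcd_nat.absorb1 coprime_commute)
  qed
  show "inj_on (\<lambda>(x, y). x * y) ({d. d dvd a} \<times> {d. d dvd b})"
    by (rule inj_onI) (auto, (metis g)+)
  show "(\<lambda>(x, y). x * y) ` ({d. d dvd a} \<times> {d. d dvd b}) = {d. d dvd a * b}"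
    by (auto simp: mult_dvd_mono image_iff) (metis division_decomp)
qed

lemma sum_divisors_coprime:
  assumes "coprime a b" "a > 0" "b > (0::nat)"
  shows "(\<Sum>d | d dvd a * b. g d) = (\<Sum>x | x dvd a. \<Sum>y | y dvd b. g (x * y))"
  using sum.reindex_bij_betw[OF bij_betw_divisors_coprime[OF assms], of g]
  by (simp add: sum.cartesian_product case_prod_beta)

lemma nat_prime_power_induct [consumes 1, case_names one power]:
  assumes "n > 0" "P (1::nat)" and step: "\<And>p i m. prime p \<Longrightarrow> i > 0 \<Longrightarrow> m > 0 \<Longrightarrow> coprime p m \<Longrightarrow> P m \<Longrightarrow> P (p ^ i * m)"
  shows "P n"
  using assms(1)
proof (induction n rule: less_induct)
  case (less n)
  show ?case
  proof (cases "n = 1")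
    case False
    then obtain p where p: "prime p" "p dvd n" using prime_factor_nat by auto
    have "n \<noteq> 0" "\<not> is_unit p" using less.prems p(1) not_prime_unit by auto
    from multiplicity_decompose'[OF this]
    obtain m where m: "n = p ^ multiplicity p n * m" "\<not> p dvd m" by metis
    have i: "multiplicity p n > 0" using p less.prems by (simp add: prime_multiplicity_gt_zero_iff)
    have m0: "m > 0" using m less.prems by (cases "m = 0") auto
    have "p ^ multiplicity p n > 1" using i prime_gt_1_nat[OF p(1)] by (intro one_less_power) auto
    then have "m < n" using m(1) m0 by (metis mult_less_cancel2 nat_mult_1)
    then have "P m" using less.IH m0 by blast
    moreover have "coprime p m" using m(2) p(1) by (simp add: prime_imp_coprime)
    ultimately show ?thesis using step[OF p(1) i m0] m(1) by metis
  qed (use assms(2) in simp)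
qed

lemma divisors_prime_power_nat:
  assumes "prime (p::nat)" shows "{d. d dvd p ^ i} = (\<lambda>j. p ^ j) ` {..i}"
  using assms by (auto simp: divides_primepow_nat)

lemma sum_divisors_prime_power:
  assumes "prime (p::nat)" shows "(\<Sum>d | d dvd p ^ i. g d) = (\<Sum>j\<le>i. g (p ^ j))"
proof -
  have "inj_on (\<lambda>j. p ^ j) {..i}" using prime_gt_1_nat[OF assms] by (auto simp: inj_on_def)
  then show ?thesis unfolding divisors_prime_power_nat[OF assms] by (simp add: sum.reindex)
qed

lemma real_char_value:
  assumes "\<xi> \<in> dchars d" "d > 0" "\<And>n. cnj (\<xi> n) = \<xi> n"
  shows "\<xi> n \<in> {-1, 0, 1}"
proof (cases "coprime n d")
  case True
  have "\<xi> n * \<xi> n = 1" using dchars_mult_cnj[OF assms(1,2), of n] assms(3)[of n] True by (simp add: trivial_char_def)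
  then show ?thesis by (auto simp: square_eq_1_iff)
qed (use dcharsD(4)[OF assms(1)] in auto)

text \<open>
  The divisor sum is multiplicative, and at \<open>p^i\<close> it equals \<open>1 + \<chi>(p) + ... + \<chi>(p)^i\<close> with
  \<open>\<chi>(p)\<close> one of -1, 0, 1.
\<close>

lemma real_char_divisor_sum:
  assumes c: "\<xi> \<in> dchars d" "d > 0" "\<And>n. cnj (\<xi> n) = \<xi> n"
  defines "f \<equiv> \<lambda>m. \<Sum>a | a dvd m. Re (\<xi> a)"
  shows "m > 0 \<Longrightarrow> f m \<ge> 0" "m > 0 \<Longrightarrow> f (m\<^sup>2) \<ge> 1"
proof -
  have Re_mult: "Re (\<xi> (a * b)) = Re (\<xi> a) * Re (\<xi> b)" for a b
    using real_char_value[OF c, of a] real_char_value[OF c, of b] dcharsD(2)[OF c(1), of a b] by auto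
  have mult: "f (a * b) = f a * f b" if "coprime a b" "a > 0" "b > 0" for a b
    unfolding f_def sum_divisors_coprime[OF that] by (simp add: Re_mult sum_product)
  have f1: "f 1 = 1" using dcharsD(1)[OF c(1)] by (simp add: f_def)
  have Re_pow: "Re (\<xi> (p ^ j)) = Re (\<xi> p) ^ j" for p j
    by (induction j) (auto simp: Re_mult dcharsD(1)[OF c(1)])
  have fp: "f (p ^ i) = (\<Sum>j\<le>i. Re (\<xi> p) ^ j)" if "prime p" for p i
    unfolding f_def by (simp add: sum_divisors_prime_power[OF that] Re_pow)
  have val: "Re (\<xi> p) \<in> {-1, 0, 1}" for p using real_char_value[OF c, of p] by auto
  have m1: "(\<Sum>j\<le>i. (-1) ^ j) = (if even i then 1 else (0::real))" for i
    by (induction i) auto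
  have fp0: "f (p ^ i) \<ge> 0" if "prime p" for p i
    using val[of p] unfolding fp[OF that] by (auto simp: m1 intro: sum_nonneg)
  have fp1: "f (p ^ (2 * i)) \<ge> 1" if "prime p" for p i
    using val[of p] unfolding fp[OF that]
    by (auto simp: m1) (simp add: power_0_left)
  show "m > 0 \<Longrightarrow> f m \<ge> 0"
  proof (induction m rule: nat_prime_power_induct)
    case (power p i m)
    then have "f (p ^ i * m) = f (p ^ i) * f m" by (intro mult) (auto simp: prime_gt_0_nat)
    then show ?case using fp0 power by simp
  qed (use f1 in simp_all)
  show "m > 0 \<Longrightarrow> f (m\<^sup>2) \<ge> 1"
  proof (induction m rule: nat_prime_power_induct)
    case (power p i m)
    have "(p ^ i * m)\<^sup>2 = p ^ (2 * i) * m\<^sup>2" by (simp add: power_mult_distrib power_mult[symmetric] mult.commute)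
    moreover have "f (p ^ (2 * i) * m\<^sup>2) = f (p ^ (2 * i)) * f (m\<^sup>2)"
      using power by (intro mult) (auto simp: prime_gt_0_nat)
    moreover have "1 * 1 \<le> f (p ^ (2 * i)) * f (m\<^sup>2)" using fp1[OF power(1), of i] power by (intro mult_mono) auto
    ultimately show ?case by simp
  qed (use f1 in simp_all)
qed

text \<open>
  By the inequality of the means, the \<open>i\<close>-th term from the left and the \<open>i\<close>-th from the right add up
  to at least \<open>2 y^(n-1)\<close>.
\<close>

lemma geometric_ge:
  fixes y :: real assumes "y \<ge> 0"
  shows "real n * y ^ (n - 1) \<le> (\<Sum>i<n. (y\<^sup>2) ^ i)"
proof -
  have "2 * y ^ (n - 1) \<le> (y\<^sup>2) ^ i + (y\<^sup>2) ^ (n - Suc i)" if "i < n" for i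
  proof -
    have "y ^ (n - 1) = y ^ i * y ^ (n - Suc i)" using that by (simp flip: power_add)
    moreover have "0 \<le> (y ^ i - y ^ (n - Suc i))\<^sup>2" by simp
    ultimately show ?thesis by (simp add: power2_diff power_mult[symmetric] mult.commute[of 2])
  qed
  then have "(\<Sum>i<n. 2 * y ^ (n - 1)) \<le> (\<Sum>i<n. (y\<^sup>2) ^ i + (y\<^sup>2) ^ (n - Suc i))"
    by (intro sum_mono) auto
  also have "\<dots> = 2 * (\<Sum>i<n. (y\<^sup>2) ^ i)"
    by (simp add: sum.distrib sum.nat_diff_reindex[of "\<lambda>i. (y\<^sup>2) ^ i" n])
  finally show ?thesis by simp
qed

text \<open>
  The coefficients in Monsky's proof that \<open>L(1, \<chi>) \<noteq> 0\<close>: a multiple of \<open>1 / n\<close> minus the coefficient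
  of a Lambert series. They decrease in \<open>n\<close>, and the first is 1 for every \<open>x < 1\<close>.
\<close>

definition monsky :: "real \<Rightarrow> nat \<Rightarrow> real" where
  "monsky x n = 1 / (real n * (1 - x)) - x ^ n / (1 - x ^ n)"

text \<open>
  The claim amounts to \<open>(1 - x)^2 x^n n (n + 1) \<le> (1 - x^n) (1 - x^(n+1))\<close>, which follows from two
  instances of \<open>geometric_ge\<close> for the square root of \<open>x\<close>.
\<close>

lemma monsky_decreasing:
  assumes x: "0 < x" "x < 1" and n: "n \<ge> 1"
  shows "monsky x (Suc n) \<le> monsky x n"
proof -
  define y where "y = sqrt x"
  have y: "0 < y" "y < 1" "x = y\<^sup>2" using x by (auto simp: y_def)
  have a: "1 - x ^ m \<ge> (1 - x) * (real m * y ^ (m - 1))" for m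
    using geometric_ge[of y m] x y one_diff_power_eq[of x m] by (simp add: mult_left_mono)
  have "(1 - x) * (real n * y ^ n) \<le> (1 - x) * (real n * y ^ (n - 1))"
    using x y by (intro mult_left_mono power_decreasing) auto
  then have a1: "(1 - x) * (real n * y ^ n) \<le> 1 - x ^ n" using a[of n] by linarith
  have a2: "(1 - x) * (real (Suc n) * y ^ n) \<le> 1 - x ^ Suc n" using a[of "Suc n"] by simp
  have "((1 - x) * (real n * y ^ n)) * ((1 - x) * (real (Suc n) * y ^ n)) \<le> (1 - x ^ n) * (1 - x ^ Suc n)"
    using a1 a2 x y by (intro mult_mono) (auto intro: power_le_one)
  moreover have "y ^ n * y ^ n = x ^ n" unfolding y(3) by (simp add: power_mult[symmetric] mult_2 flip: power_add)
  moreover have "((1 - x) * (real n * y ^ n)) * ((1 - x) * (real (Suc n) * y ^ n))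
      = (1 - x)\<^sup>2 * (y ^ n * y ^ n) * (real n * real (Suc n))"
    by (simp only: power2_eq_square mult_ac)
  ultimately have key: "(1 - x)\<^sup>2 * x ^ n * (real n * real (Suc n)) \<le> (1 - x ^ n) * (1 - x ^ Suc n)"
    by (simp only:)
  have xn: "x ^ n < 1" "x ^ Suc n < 1" using x n power_Suc_less_one[of x n] power_Suc_less_one[of x "n - 1"] by auto
  have "x ^ n / (1 - x ^ n) - x ^ Suc n / (1 - x ^ Suc n) = x ^ n * (1 - x) / ((1 - x ^ n) * (1 - x ^ Suc n))"
    using xn by (simp add: divide_simps) (simp add: algebra_simps)
  also have "\<dots> \<le> 1 / (real n * (1 - x)) - 1 / (real (Suc n) * (1 - x))"
  proof -
    have "1 / (real n * (1 - x)) - 1 / (real (Suc n) * (1 - x)) = 1 / (real n * real (Suc n) * (1 - x))"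
      using x n by (simp add: divide_simps)
    moreover have "x ^ n * (1 - x) * (real n * real (Suc n) * (1 - x)) \<le> (1 - x ^ n) * (1 - x ^ Suc n)"
      using key by (simp add: power2_eq_square mult_ac)
    ultimately show ?thesis using x n xn by (simp only: divide_le_eq_1 frac_le_eq) (simp add: divide_simps)
  qed
  finally show ?thesis unfolding monsky_def by linarith
qed

lemma monsky_1: "x < 1 \<Longrightarrow> monsky x 1 = 1"
  by (simp add: monsky_def diff_divide_distrib[symmetric])

lemma monsky_nonneg:
  assumes x: "0 < x" "x < 1" and n: "n \<ge> 1"
  shows "monsky x n \<ge> 0"
proof -
  have "(\<lambda>n. monsky x n) \<longlonglongrightarrow> 0 - 0 / (1 - 0)"
  proof -
    have "(\<lambda>n. inverse (real n) * (1 / (1 - x))) \<longlonglongrightarrow> 0 * (1 / (1 - x))"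
      by (intro tendsto_intros lim_inverse_n)
    then have 1: "(\<lambda>n. 1 / (real n * (1 - x))) \<longlonglongrightarrow> 0" by (simp add: field_simps)
    have 2: "(\<lambda>n. x ^ n) \<longlonglongrightarrow> 0" using x by (intro LIMSEQ_realpow_zero) auto
    show ?thesis unfolding monsky_def by (intro tendsto_intros 1 2) auto
  qed
  then have lim: "(\<lambda>m. monsky x (m + n)) \<longlonglongrightarrow> 0" by (simp add: LIMSEQ_ignore_initial_segment)
  have "decseq (\<lambda>m. monsky x (m + n))" using monsky_decreasing[OF x] n by (intro decseq_SucI) auto
  from decseq_ge[OF this lim, of 0] show ?thesis by simp
qed

lemma has_sum_geometric_pos:
  fixes q :: real
  assumes "0 < q" "q < 1"
  shows "((\<lambda>j. q ^ j) has_sum q / (1 - q)) {0<..}"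
proof -
  have "(\<lambda>j. q * q ^ j) sums (q * (1 / (1 - q)))"
    using assms by (intro sums_mult geometric_sums) auto
  then have "((\<lambda>j. q ^ Suc j) has_sum q / (1 - q)) UNIV"
    using assms by (intro sums_nonneg_imp_has_sum) auto
  moreover have "bij_betw Suc UNIV {0<..}"
    by (rule bij_betwI[of _ _ _ "\<lambda>n. n - 1"]) auto
  ultimately show ?thesis using has_sum_reindex_bij_betw[of Suc UNIV "{0<..}" "\<lambda>j. q ^ j"] by simp
qed

lemma lambert_series:
  assumes c: "\<xi> \<in> dchars d" "d > 0" and x: "0 < x" "x < (1::real)"
  shows "(\<lambda>n. \<xi> n * of_real (x ^ n / (1 - x ^ n))) sums (\<Sum>\<^sub>\<infinity>n\<in>{0<..}. (\<Sum>a | a dvd n. \<xi> a) * of_real (x ^ n))"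
    "(\<lambda>n. (\<Sum>a | a dvd n. \<xi> a) * of_real (x ^ n)) summable_on {0<..}"
proof -
  define F where "F = (\<lambda>(a, j). \<xi> a * complex_of_real ((x ^ a) ^ j))"
  have xa: "0 < x ^ a" "x ^ a < 1" "x ^ a \<le> x" if "a > 0" for a
    using x that power_decreasing[of 1 a x] by (auto simp: power_less_one_iff)
  have gs: "((\<lambda>j. (x ^ a) ^ j) has_sum x ^ a / (1 - x ^ a)) {0<..}" if "a > 0" for a
    by (rule has_sum_geometric_pos) (use xa[OF that] in auto)
  have abs: "F abs_summable_on {0<..} \<times> {0<..}"
    unfolding abs_summable_on_Sigma_iff
  proof (intro conjI ballI)
    fix a :: nat assume "a \<in> {0<..}"
    then have a: "a > 0" by simp
    show "(\<lambda>j. F (a, j)) abs_summable_on {0<..}"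
      unfolding F_def using x by (auto simp: norm_mult norm_power intro!: summable_on_cmult_right has_sum_imp_summable[OF gs[OF a]])
  next
    have eq: "(\<Sum>\<^sub>\<infinity>j\<in>{0<..}. norm (F (a, j))) = norm (\<xi> a) * (x ^ a / (1 - x ^ a))" if "a > 0" for a
      using x infsumI[OF gs[OF that]] by (simp add: F_def norm_mult norm_power infsum_cmult_right')
    have "(\<lambda>a. norm (\<xi> a) * (x ^ a / (1 - x ^ a))) summable_on {0<..}"
    proof (rule summable_on_comparison_test)
      show "(\<lambda>a. x ^ a * (1 / (1 - x))) summable_on {0<..}"
        by (intro summable_on_cmult_left has_sum_imp_summable[OF has_sum_geometric_pos] x)
      fix a :: nat assume "a \<in> {0<..}"
      then have a: "a > 0" by simp
      have "norm (\<xi> a) * (x ^ a / (1 - x ^ a)) \<le> 1 * (x ^ a / (1 - x ^ a))"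
        using norm_dchars_le[OF c, of a] xa[OF a] by (intro mult_right_mono) auto
      also have "\<dots> \<le> x ^ a * (1 / (1 - x))"
        using xa[OF a] x by (auto intro!: divide_left_mono)
      finally show "norm (\<xi> a) * (x ^ a / (1 - x ^ a)) \<le> x ^ a * (1 / (1 - x))" .
      show "0 \<le> norm (\<xi> a) * (x ^ a / (1 - x ^ a))" using xa[OF a] by simp
    qed
    then have "(\<lambda>a. \<Sum>\<^sub>\<infinity>j\<in>{0<..}. norm (F (a, j))) summable_on {0<..}"
      by (rule summable_on_cong[THEN iffD1, rotated]) (simp add: eq)
    then show "(\<lambda>a. \<Sum>\<^sub>\<infinity>j\<in>{0<..}. norm (F (a, j))) abs_summable_on {0<..}"
      by (simp add: infsum_nonneg)
  qed
  have sm: "F summable_on {0<..} \<times> {0<..}" by (rule abs_summable_summable[OF abs])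
  have div: "(\<Sum>a | a dvd n. F (a, n div a)) = (\<Sum>a | a dvd n. \<xi> a) * of_real (x ^ n)" for n
    unfolding F_def sum_distrib_right by (intro sum.cong) (auto simp flip: power_mult)
  show "(\<lambda>n. (\<Sum>a | a dvd n. \<xi> a) * of_real (x ^ n)) summable_on {0<..}"
    using has_sum_imp_summable[OF has_sum_pairs_divisors[OF sm]] unfolding div .
  have "((\<lambda>a. \<xi> a * of_real (x ^ a / (1 - x ^ a))) has_sum infsum F ({0<..} \<times> {0<..})) {0<..}"
  proof (rule has_sum_SigmaD)
    show "(F has_sum infsum F ({0<..} \<times> {0<..})) ({0<..} \<times> {0<..})" using sm by simp
    fix a :: nat assume "a \<in> {0<..}"
    then have "a > 0" by simp
    from has_sum_cmult_right[OF has_sum_of_real[OF gs[OF this], where 'a = complex], of "\<xi> a"]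
    show "((\<lambda>j. F (a, j)) has_sum \<xi> a * of_real (x ^ a / (1 - x ^ a))) {0<..}"
      unfolding F_def by simp
  qed
  then have "((\<lambda>a. \<xi> a * of_real (x ^ a / (1 - x ^ a))) has_sum infsum F ({0<..} \<times> {0<..})) UNIV"
    by (subst has_sum_cong_neutral[where T = "{0<..}" and S = UNIV]) auto
  then show "(\<lambda>n. \<xi> n * of_real (x ^ n / (1 - x ^ n))) sums (\<Sum>\<^sub>\<infinity>n\<in>{0<..}. (\<Sum>a | a dvd n. \<xi> a) * of_real (x ^ n))"
    unfolding infsumI[OF has_sum_pairs_divisors[OF sm], unfolded div] by (rule has_sum_imp_sums)
qed

text \<open>
  If the series vanished at 1, then the Lambert series of \<open>\<chi>\<close> would be minus the sum of the
  \<open>\<chi>(n) monsky x n\<close>, which partial summation bounds by \<open>4 d\<close> for all \<open>x < 1\<close>. But the Lambert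
  series is the power series of the divisor sums of \<open>\<chi>\<close>; these are nonnegative and at least 1 at
  squares, so it is unbounded as \<open>x\<close> tends to 1.
\<close>

lemma real_char_L1_nonzero:
  assumes c: "\<xi> \<in> dchars d" "\<xi> \<noteq> trivial_char d" and d: "d \<ge> 1" and r: "\<And>n. cnj (\<xi> n) = \<xi> n"
  obtains l where "(\<lambda>M. \<Sum>n<M. \<xi> n * of_real (lw 0 1 (real n))) \<longlonglongrightarrow> l" "l \<noteq> 0"
proof -
  have d0: "d > 0" using d by simp
  have "Cauchy (\<lambda>M. \<Sum>n<M. \<xi> n * of_real (lw 0 1 (real n)))"
  proof (rule CauchyI')
    fix e :: real assume e: "e > 0"
    have "(\<lambda>N. 4 * real d * (6 * (real N powr (-1/2)))) \<longlonglongrightarrow> 4 * real d * (6 * 0)"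
      by (intro tendsto_intros tendsto_neg_powr filterlim_real_sequentially) auto
    then have "eventually (\<lambda>N. 4 * real d * (6 * (real N powr (-1/2))) < e) sequentially"
      using e by (intro order_tendstoD(2)) auto
    then obtain N where N: "N \<ge> 1" "\<And>n. n \<ge> N \<Longrightarrow> 4 * real d * (6 * (real n powr (-1/2))) < e"
      unfolding eventually_sequentially by (metis le_add2 le_trans nat_le_linear add.commute le_add1)
    show "\<exists>M. \<forall>m\<ge>M. \<forall>n>m. dist (\<Sum>n<m. \<xi> n * of_real (lw 0 1 (real n))) (\<Sum>n<n. \<xi> n * of_real (lw 0 1 (real n))) < e"
    proof (intro exI[of _ N] allI impI)
      fix m n assume mn: "m \<ge> N" "n > m"
      have "(\<Sum>n<n. \<xi> n * of_real (lw 0 1 (real n))) = (\<Sum>n<m. \<xi> n * of_real (lw 0 1 (real n))) + (\<Sum>n=m..<n. \<xi> n * of_real (lw 0 1 (real n)))"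
        using mn by (simp add: lessThan_atLeast0 sum.atLeastLessThan_concat)
      then have "dist (\<Sum>n<m. \<xi> n * of_real (lw 0 1 (real n))) (\<Sum>n<n. \<xi> n * of_real (lw 0 1 (real n)))
        = norm (\<Sum>n=m..<n. \<xi> n * complex_of_real (lw 0 1 (real n)))" by (simp add: dist_norm)
      also have "\<dots> \<le> 4 * real d * lw_var 0 (real m)" using mn N by (intro nontrivial_char_tail_le[OF c d0]) auto
      also have "\<dots> < e" using N(2)[OF mn(1)] by (simp add: lw_var_def)
      finally show "dist (\<Sum>n<m. \<xi> n * of_real (lw 0 1 (real n))) (\<Sum>n<n. \<xi> n * of_real (lw 0 1 (real n))) < e" .
    qed
  qed
  then obtain l where l: "(\<lambda>M. \<Sum>n<M. \<xi> n * of_real (lw 0 1 (real n))) \<longlonglongrightarrow> l"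
    by (auto simp: Cauchy_convergent_iff convergent_def)
  have "l \<noteq> 0"
  proof
    assume l0: "l = 0"
    define K where "K = 8 * d + 1"
    define x where "x = root (K\<^sup>2) (1/2)"
    have K: "K > 0" "K\<^sup>2 > 0" by (auto simp: K_def)
    have xK: "x ^ K\<^sup>2 = 1/2" unfolding x_def using K by (intro real_root_pow_pos2) auto
    have x0: "x > 0" using K by (simp add: x_def)
    have x1: "x < 1" using K real_root_lt_1_iff[of "K\<^sup>2" "1/2"] by (simp add: x_def)
    let ?f = "\<lambda>n. \<Sum>a | a dvd n. \<xi> a"
    let ?F = "\<Sum>\<^sub>\<infinity>n\<in>{0<..}. ?f n * of_real (x ^ n)"
    have "(\<lambda>M. of_real (1 / (1 - x)) * (\<Sum>n<M. \<xi> n * of_real (lw 0 1 (real n))) - (\<Sum>n<M. \<xi> n * of_real (x ^ n / (1 - x ^ n))))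
        \<longlonglongrightarrow> of_real (1 / (1 - x)) * l - ?F"
      using lambert_series(1)[OF c(1) d0 x0 x1] unfolding sums_def by (intro tendsto_intros l)
    moreover have "norm (of_real (1 / (1 - x)) * (\<Sum>n<M. \<xi> n * of_real (lw 0 1 (real n))) - (\<Sum>n<M. \<xi> n * of_real (x ^ n / (1 - x ^ n)))) \<le> 4 * real d"
      if "M \<ge> 1" for M
    proof -
      have "of_real (1 / (1 - x)) * (\<Sum>n<M. \<xi> n * of_real (lw 0 1 (real n))) - (\<Sum>n<M. \<xi> n * of_real (x ^ n / (1 - x ^ n)))
         = (\<Sum>n<M. \<xi> n * complex_of_real (monsky x n))"
      proof -
        have "1 / (1 - x) * lw 0 1 (real n) - x ^ n / (1 - x ^ n) = monsky x n" for n
          by (cases "n = 0") (auto simp: lw_def monsky_def powr_minus divide_inverse)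
        then have "complex_of_real (1 / (1 - x)) * of_real (lw 0 1 (real n)) - of_real (x ^ n / (1 - x ^ n)) = of_real (monsky x n)" for n
          by (metis of_real_diff of_real_mult)
        then have "\<xi> n * complex_of_real (monsky x n)
          = of_real (1 / (1 - x)) * (\<xi> n * of_real (lw 0 1 (real n))) - \<xi> n * of_real (x ^ n / (1 - x ^ n))" for n
          by (metis (no_types, lifting) mult.left_commute right_diff_distrib)
        then show ?thesis by (simp only: sum_distrib_left sum_subtractf)
      qed
      also have "\<dots> = \<xi> 0 * of_real (monsky x 0) + (\<Sum>n=1..<M. \<xi> n * complex_of_real (monsky x n))"
        using that by (simp add: lessThan_atLeast0 sum.atLeast_Suc_lessThan)
      also have "monsky x 0 = 0" by (simp add: monsky_def)
      finally have "norm (of_real (1 / (1 - x)) * (\<Sum>n<M. \<xi> n * of_real (lw 0 1 (real n))) - (\<Sum>n<M. \<xi> n * of_real (x ^ n / (1 - x ^ n))))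
         = norm (\<Sum>n=1..<M. \<xi> n * complex_of_real (monsky x n))" by simp
      also have "\<dots> \<le> 2 * real d * (\<bar>monsky x 1\<bar> + monsky x 1)"
        by (rule abel_bound)
           (use norm_dchars_partial_sum_le[OF c d0] monsky_decreasing[OF x0 x1] monsky_nonneg[OF x0 x1] that in auto)
      also have "\<dots> = 4 * real d" using monsky_1[OF x1] by simp
      finally show ?thesis .
    qed
    ultimately have "norm (of_real (1 / (1 - x)) * l - ?F) \<le> 4 * real d"
      by (intro LIMSEQ_le_const2[OF tendsto_norm]) auto
    then have F: "norm ?F \<le> 4 * real d" using l0 by simp
    have "real K / 2 \<le> Re ?F"
    proof -
      have ss: "(\<lambda>n. ?f n * of_real (x ^ n)) summable_on {0<..}" by (rule lambert_series(2)[OF c(1) d0 x0 x1])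
      have hs: "((\<lambda>n. Re (?f n * of_real (x ^ n))) has_sum Re ?F) {0<..}"
        using has_sum_Re[OF has_sum_infsum[OF ss]] .
      have Re_f: "Re (?f n * of_real (x ^ n)) = (\<Sum>a | a dvd n. Re (\<xi> a)) * x ^ n" for n
        by (simp flip: of_real_power)
      have "real K / 2 = (\<Sum>m=1..K. x ^ K\<^sup>2)" by (simp add: xK)
      also have "\<dots> \<le> (\<Sum>m=1..K. Re (?f (m\<^sup>2) * of_real (x ^ m\<^sup>2)))"
      proof (rule sum_mono)
        fix m assume m: "m \<in> {1..K}"
        have "x ^ K\<^sup>2 \<le> x ^ m\<^sup>2" using m x0 x1 by (intro power_decreasing) (auto intro: power_mono)
        also have "\<dots> \<le> (\<Sum>a | a dvd m\<^sup>2. Re (\<xi> a)) * x ^ m\<^sup>2"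
        proof -
          have "1 * x ^ m\<^sup>2 \<le> (\<Sum>a | a dvd m\<^sup>2. Re (\<xi> a)) * x ^ m\<^sup>2"
            using real_char_divisor_sum(2)[OF c(1) d0 r, of m] m x0 by (intro mult_right_mono) auto
          then show ?thesis by simp
        qed
        finally show "x ^ K\<^sup>2 \<le> Re (?f (m\<^sup>2) * of_real (x ^ m\<^sup>2))" unfolding Re_f .
      qed
      also have "\<dots> = (\<Sum>n\<in>(\<lambda>m. m\<^sup>2) ` {1..K}. Re (?f n * of_real (x ^ n)))"
        by (subst sum.reindex) (auto simp: inj_on_def)
      also have "\<dots> \<le> Re ?F"
      proof (rule finite_sum_le_has_sum[OF hs])
        fix n assume "n \<in> {0<..} - (\<lambda>m. m\<^sup>2) ` {1..K}"
        then have "n > 0" by auto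
        then show "0 \<le> Re (?f n * of_real (x ^ n))"
          unfolding Re_f using real_char_divisor_sum(1)[OF c(1) d0 r, of n] x0 by (intro mult_nonneg_nonneg) auto
      qed auto
      finally show ?thesis .
    qed
    also have "\<dots> \<le> norm ?F" by (rule complex_Re_le_cmod)
    finally show False using F by (simp add: K_def)
  qed
  with l show ?thesis by (rule that)
qed

lemma real_char_L_ge:
  assumes c: "\<xi> \<in> dchars d" "\<xi> \<noteq> trivial_char d" and d: "d \<ge> 1" and r: "\<And>n. cnj (\<xi> n) = \<xi> n"
  shows "eventually (\<lambda>\<eta>. \<forall>s. 1 < s \<and> s \<le> 1 + \<eta> \<longrightarrow> norm (Lser \<xi> 0 s) \<ge> \<eta>) (at_right 0)"
proof -
  have d0: "d > 0" using d by simp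
  obtain l where l: "(\<lambda>M. \<Sum>n<M. \<xi> n * of_real (lw 0 1 (real n))) \<longlonglongrightarrow> l" "l \<noteq> 0"
    using real_char_L1_nonzero[OF c d r] by blast
  have lip: "norm (Lser \<xi> 0 s - l) \<le> (L_bound d)\<^sup>2 * \<bar>s - 1\<bar>" if s: "1 < s" "s \<le> 2" for s
  proof -
    have "(\<lambda>M. norm ((\<Sum>n<M. \<xi> n * of_real (lw 0 s (real n))) - (\<Sum>n<M. \<xi> n * of_real (lw 0 1 (real n)))))
       \<longlonglongrightarrow> norm (Lser \<xi> 0 s - l)"
      using L_sums[of \<xi> s 0] norm_dchars_le[OF c(1)] d s l unfolding sums_def
      by (intro tendsto_norm tendsto_diff) auto
    then show ?thesis
      by (rule LIMSEQ_le_const2) (use nontrivial_char_partial_lipschitz[OF c d, where s = s and s' = 1] s in auto)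
  qed
  define \<eta>0 where "\<eta>0 = min 1 (norm l / ((L_bound d)\<^sup>2 + 1))"
  have "\<eta>0 > 0" using l by (auto simp: \<eta>0_def intro!: divide_pos_pos add_nonneg_pos)
  then have "eventually (\<lambda>\<eta>. \<eta> \<in> {0<..<\<eta>0}) (at_right 0)" by (rule eventually_at_right_real)
  then show ?thesis
  proof eventually_elim
    case (elim \<eta>)
    show ?case
    proof (intro allI impI)
      fix s assume s: "1 < s \<and> s \<le> 1 + \<eta>"
      have e1: "\<eta> \<le> 1" "\<eta> \<le> norm l / ((L_bound d)\<^sup>2 + 1)" using elim by (auto simp: \<eta>0_def)
      have "\<eta> * ((L_bound d)\<^sup>2 + 1) \<le> norm l" using e1(2) by (simp add: pos_le_divide_eq add_nonneg_pos)
      moreover have "norm (Lser \<xi> 0 s - l) \<le> (L_bound d)\<^sup>2 * \<eta>"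
        using lip[of s] s e1(1) by (intro order.trans[OF lip] mult_left_mono) auto
      moreover have "norm l \<le> norm (Lser \<xi> 0 s) + norm (Lser \<xi> 0 s - l)"
        using norm_triangle_ineq4[of "Lser \<xi> 0 s" "Lser \<xi> 0 s - l"] by simp
      ultimately show "\<eta> \<le> norm (Lser \<xi> 0 s)" by (simp add: algebra_simps)
    qed
  qed
qed

lemma real_chars_L_ge:
  assumes d: "d \<ge> 1"
  obtains \<eta> :: real where "\<eta> > 0"
    "\<And>\<xi> s. \<xi> \<in> dchars d \<Longrightarrow> \<xi> \<noteq> trivial_char d \<Longrightarrow> (\<And>n. cnj (\<xi> n) = \<xi> n) \<Longrightarrow> 1 < s \<Longrightarrow> s \<le> 1 + \<eta> \<Longrightarrow> norm (Lser \<xi> 0 s) \<ge> \<eta>"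
proof -
  let ?X = "{\<xi> \<in> dchars d. \<xi> \<noteq> trivial_char d \<and> (\<forall>n. cnj (\<xi> n) = \<xi> n)}"
  have "finite ?X" using finite_dchars[of d] d by simp
  then have "eventually (\<lambda>\<eta>. \<forall>\<xi>\<in>?X. \<forall>s. 1 < s \<and> s \<le> 1 + \<eta> \<longrightarrow> norm (Lser \<xi> 0 s) \<ge> \<eta>) (at_right 0)"
    by (rule eventually_ball_finite) (auto intro!: real_char_L_ge[OF _ _ d])
  then have "eventually (\<lambda>\<eta>. \<eta> > 0 \<and> (\<forall>\<xi>\<in>?X. \<forall>s. 1 < s \<and> s \<le> 1 + \<eta> \<longrightarrow> norm (Lser \<xi> 0 s) \<ge> \<eta>)) (at_right (0::real))"
    using eventually_at_right_less[of "0::real"] by eventually_elim auto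
  then obtain \<eta> :: real where "\<eta> > 0" "\<forall>\<xi>\<in>?X. \<forall>s. 1 < s \<and> s \<le> 1 + \<eta> \<longrightarrow> norm (Lser \<xi> 0 s) \<ge> \<eta>"
    using eventually_happens'[OF trivial_limit_at_right_real] by blast
  then show ?thesis by (intro that[of \<eta>]) auto
qed

lemma cong_1_power:
  fixes u :: int
  assumes "[u = 1] (mod int R)"
  shows "[u ^ (R ^ i) = 1] (mod int R ^ Suc i)"
proof (induction i)
  case (Suc i)
  let ?v = "u ^ (R ^ i)"
  have "[?v = 1] (mod int R)" using cong_pow[OF assms, of "R ^ i"] by simp
  then have "[(\<Sum>j<R. ?v ^ j) = (\<Sum>j<R. 1 ^ j)] (mod int R)" by (intro cong_sum cong_pow)
  then have "int R dvd (\<Sum>j<R. ?v ^ j) \<longleftrightarrow> int R dvd (\<Sum>j<R. 1 ^ j)" by (rule cong_dvd_iff)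
  then have "int R dvd (\<Sum>j<R. ?v ^ j)" by simp
  moreover have "int R ^ Suc i dvd ?v - 1" using Suc by (simp add: cong_iff_dvd_diff)
  ultimately have "int R ^ Suc i * int R dvd (?v - 1) * (\<Sum>j<R. ?v ^ j)" by (intro mult_dvd_mono)
  also have "(?v - 1) * (\<Sum>j<R. ?v ^ j) = ?v ^ R - 1" by (rule power_diff_1_eq[symmetric])
  finally show ?case by (simp add: cong_iff_dvd_diff power_mult[symmetric] mult.commute)
qed (use assms in simp)

text \<open>
  A number congruent to 1 modulo \<open>R\<close> has \<open>R^E\<close>-th power 1 modulo \<open>d\<close>. As \<open>R^E\<close> is odd, a character
  with values \<open>1\<close> and \<open>-1\<close> is trivial on such numbers, hence has period \<open>R\<close>. This makes the lower bound
  for real characters independent of \<open>E\<close>.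
\<close>

lemma real_char_descends:
  assumes c: "\<xi> \<in> dchars d" and sq: "(\<lambda>n. \<xi> n ^ 2) = trivial_char d"
    and R: "R dvd d" "d dvd R ^ E" "odd R" "R > 1"
  shows "\<xi> \<in> dchars R" "trivial_char R = trivial_char d"
proof -
  have d0: "d > 0" using R by (metis dvd_pos_nat zero_less_power less_trans zero_less_one)
  have cop: "coprime n d \<longleftrightarrow> coprime n R" for n
    using R by (meson coprime_divisors coprime_power_right_iff dvd_refl)
  show "trivial_char R = trivial_char d" by (rule ext) (simp add: trivial_char_def cop)
  have per: "\<xi> (n + R) = \<xi> n" for n
  proof (cases "coprime n R")
    case False
    have "coprime (n + R) R \<longleftrightarrow> coprime n R" by (simp only: coprime_iff_gcd_eq_1 gcd_add1)
    then show ?thesis using False dcharsD(4)[OF c] cop by metis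
  next
    case True
    then have cn: "coprime n d" by (simp add: cop)
    obtain n' where n': "[n * n' = 1] (mod d)" using cong_solve_coprime_nat[OF cn] by auto
    define u where "u = (n + R) * n'"
    have "[n * n' = 1] (mod R)" using n' R(1) by (rule cong_dvd_modulus_nat)
    moreover have "[u = n * n'] (mod R)" by (simp add: u_def cong_def algebra_simps)
    ultimately have "[u = 1] (mod R)" by (metis cong_trans)
    then have "[int u = 1] (mod int R)" by (metis cong_int_iff of_nat_1)
    from cong_1_power[OF this, of E] have "[int (u ^ (R ^ E)) = int 1] (mod int (R ^ Suc E))" by simp
    then have "[u ^ (R ^ E) = 1] (mod R ^ Suc E)" by (simp only: cong_int_iff)
    then have "[u ^ (R ^ E) = 1] (mod d)" by (rule cong_dvd_modulus_nat) (use R in auto)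
    then have p1: "\<xi> u ^ (R ^ E) = 1" using dchars_cong[OF c] dchars_power[OF c] dcharsD(1)[OF c] by force
    have cu: "coprime u d"
      using \<open>[u = 1] (mod R)\<close> cop by (metis cong_imp_coprime cong_sym coprime_1_left)
    have s1: "\<xi> u ^ 2 = 1" using fun_cong[OF sq, of u] cu by (simp add: trivial_char_def)
    have "odd (R ^ E)" using R(3) by simp
    then obtain j where "R ^ E = 2 * j + 1" by (rule oddE)
    then have "\<xi> u = 1" using p1 s1 by (simp add: power_mult)
    then have "\<xi> (n + R) * \<xi> n' = \<xi> n * \<xi> n'"
      using dchars_cong[OF c n'] dcharsD(1,2)[OF c] by (simp add: u_def)
    moreover have "\<xi> n' \<noteq> 0"
      using dchars_cong[OF c n'] dcharsD(1,2)[OF c] by (metis mult_zero_right zero_neq_one One_nat_def)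
    ultimately show ?thesis by simp
  qed
  then show "\<xi> \<in> dchars R" using c cop by (simp add: dchars_def)
qed

lemma cnj_eq_of_square:
  assumes c: "\<xi> \<in> dchars d" "d > 0" and sq: "(\<lambda>n. \<xi> n ^ 2) = trivial_char d"
  shows "cnj (\<xi> n) = \<xi> n"
proof (cases "coprime n d")
  case True
  then have "\<xi> n ^ 2 = 1" using fun_cong[OF sq, of n] by (simp add: trivial_char_def)
  then show ?thesis by (auto simp: power2_eq_1_iff)
next
  case False
  then have "\<xi> n = 0" using dcharsD(4)[OF c(1)] by blast
  then show ?thesis by simp
qed

section \<open>Primes in progressions to moduli composed of fixed primes\<close>

lemma Sser_nontrivial_char_le:
  assumes c: "\<xi> \<in> dchars d" "\<xi> \<noteq> trivial_char d" and d: "d \<ge> 1" and s: "1 < s" "s \<le> 2"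
    and B: "B \<ge> L_bound d" and L0: "norm (Lser \<xi> 0 s) \<ge> 1 / (128 * B ^ 7)"
  shows "norm (Sser \<xi> k s) \<le> fact k * (1024 * B ^ 9) ^ Suc k"
proof -
  have d0: "d > 0" using d by simp
  have l: "0 \<le> ln (real d)" using d by simp
  then have B25: "B \<ge> 25" using B by (simp add: L_bound_def)
  have "norm (Sser \<xi> k s) \<le> fact k * (8 * B\<^sup>2 / (1 / (128 * B ^ 7))) ^ Suc k"
  proof (rule recursion_upper_bound[where Z = "\<lambda>k. Lser \<xi> k s"])
    show "Lser \<xi> (Suc k) s = (\<Sum>j\<le>k. of_nat (k choose j) * Sser \<xi> j s * Lser \<xi> (k - j) s)" for k
      by (rule L_recursion[OF bounded_cmult_dchars[OF c(1) d0] s])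
    show "norm (Lser \<xi> j s) \<le> fact j * B ^ Suc j" for j
    proof -
      have "norm (Lser \<xi> j s) \<le> fact j * L_bound d ^ Suc j" by (rule norm_Lser_le[OF c d s])
      also have "\<dots> \<le> fact j * B ^ Suc j" using B l by (intro mult_left_mono power_mono) (auto simp: L_bound_def)
      finally show ?thesis .
    qed
    show "norm (Lser \<xi> 0 s) \<ge> 1 / (128 * B ^ 7)" by fact
    have "(1::real) \<le> B ^ 7" using B25 by (intro one_le_power) auto
    then have "1 \<le> 128 * B ^ 7" by linarith
    then show "1 / (128 * B ^ 7) \<le> 1" using B25 by (simp add: divide_le_eq_1)
  qed (use B25 in auto)
  also have "8 * B\<^sup>2 / (1 / (128 * B ^ 7)) = 1024 * B ^ 9" by (simp flip: power_add)
  finally show ?thesis .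
qed

text \<open>
  Proper prime powers are of the form \<open>x^2 y^3\<close>, so a sum over them is dominated by a product of two
  convergent series.
\<close>

lemma summable_square_cube:
  "(\<lambda>n. real n powr (-13/16)) summable_on {x\<^sup>2 * y ^ 3 | x y :: nat. x > 0 \<and> y > 0}"
    (is "?f summable_on ?A")
proof -
  define X where "X = (\<lambda>a::nat. complex_of_real (real a powr (-13/8)))"
  define Y where "Y = (\<lambda>a::nat. complex_of_real (real a powr (-39/16)))"
  have "summable (\<lambda>a. norm (X a))" "summable (\<lambda>a. norm (Y a))"
    unfolding X_def Y_def by (simp_all add: summable_real_powr_iff)
  then have XY: "X abs_summable_on UNIV" "Y abs_summable_on UNIV"
    by (auto intro!: norm_summable_imp_summable_on)
  have S: "(\<lambda>p. norm (X (fst p) * Y (snd p))) summable_on B" for B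
    using infsum_mult_pairs(1)[OF XY] summable_on_subset_banach by (simp add: case_prod_unfold) blast
  define g where "g = (\<lambda>n::nat. SOME p. n = (fst p)\<^sup>2 * snd p ^ 3 \<and> fst p > 0 \<and> snd p > (0::nat))"
  have g: "n = (fst (g n))\<^sup>2 * snd (g n) ^ 3 \<and> fst (g n) > 0 \<and> snd (g n) > 0" if "n \<in> ?A" for n
  proof -
    from that obtain x y where "n = x\<^sup>2 * y ^ 3" "x > 0" "y > 0" by auto
    then have "n = (fst (x, y))\<^sup>2 * snd (x, y) ^ 3 \<and> fst (x, y) > 0 \<and> snd (x, y) > 0" by simp
    then show ?thesis unfolding g_def by (rule someI)
  qed
  have inj: "inj_on g ?A"
  proof (rule inj_onI)
    fix m n assume mn: "m \<in> ?A" "n \<in> ?A" "g m = g n"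
    have "m = (fst (g m))\<^sup>2 * snd (g m) ^ 3" using g[OF mn(1)] by blast
    also have "\<dots> = (fst (g n))\<^sup>2 * snd (g n) ^ 3" by (simp only: mn(3))
    also have "\<dots> = n" using g[OF mn(2)] by (blast intro: sym)
    finally show "m = n" .
  qed
  have "((\<lambda>p. norm (X (fst p) * Y (snd p))) \<circ> g) summable_on ?A"
    using S summable_on_reindex[OF inj] by blast
  then show ?thesis
  proof (rule summable_on_cong[THEN iffD1, rotated])
    fix n assume n: "n \<in> ?A"
    let ?x = "real (fst (g n))" and ?y = "real (snd (g n))"
    have pos: "?x > 0" "?y > 0" using g[OF n] by auto
    have "n = (fst (g n))\<^sup>2 * snd (g n) ^ 3" using g[OF n] by blast
    then have "real n = real ((fst (g n))\<^sup>2 * snd (g n) ^ 3)" by (rule arg_cong)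
    also have "\<dots> = ?x powr 2 * ?y powr 3" using pos by (simp add: powr_numeral)
    finally have n2: "real n = ?x powr 2 * ?y powr 3" .
    have "real n powr (-13/16) = (?x powr 2) powr (-13/16) * (?y powr 3) powr (-13/16)"
      unfolding n2 by (rule powr_mult)
    also have "\<dots> = ?x powr (-13/8) * ?y powr (-39/16)" unfolding powr_powr by simp
    finally have "real n powr (-13/16) = ?x powr (-13/8) * ?y powr (-39/16)" .
    then show "((\<lambda>p. norm (X (fst p) * Y (snd p))) \<circ> g) n = real n powr (-13/16)"
      by (simp add: X_def Y_def norm_mult)
  qed
qed

lemma nonprime_primepow_square_cube:
  assumes "primepow (n::nat)" "\<not> prime n"
  shows "n \<in> {x\<^sup>2 * y ^ 3 | x y :: nat. x > 0 \<and> y > 0}"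
proof -
  obtain p i where p: "prime p" "i > 0" "n = p ^ i" using assms(1) by (auto simp: primepow_def)
  have "i \<noteq> 1" using p assms(2) by auto
  have p0: "p > 0" using p prime_gt_0_nat by auto
  show ?thesis
  proof (cases "even i")
    case True
    then obtain j where "i = 2 * j" by auto
    then have "n = (p ^ j)\<^sup>2 * 1 ^ 3" using p by (simp add: power_mult[symmetric] mult.commute)
    then show ?thesis using p0 by (intro CollectI exI[of _ "p ^ j"] exI[of _ 1]) auto
  next
    case False
    then obtain j where j: "i = 2 * j + 1" by (auto elim: oddE)
    with \<open>i \<noteq> 1\<close> obtain l where "j = Suc l" by (cases j) auto
    then have "n = (p ^ l)\<^sup>2 * p ^ 3" using p j by (simp add: power_mult[symmetric] mult.commute power2_eq_square power3_eq_cube mult_2_right flip: power_add)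
    then show ?thesis using p0 by (intro CollectI exI[of _ "p ^ l"] exI[of _ p]) auto
  qed
qed

text \<open>
  The factor \<open>8^k k!\<close> is negligible compared to the total weight \<open>k! L^(k+1)\<close>, even after
  multiplication by a modulus \<open>d \<le> 2^k\<close>.
\<close>

lemma nonprime_sum_le:
  obtains c :: real where "c > 0"
    "\<And>k s. 1 < s \<Longrightarrow> s \<le> 2 \<Longrightarrow> (\<Sum>n. if prime n then 0 else mangoldt n * lw k s (real n)) \<le> c * (8 ^ k * fact k)"
proof -
  define T where "T = (\<lambda>n::nat. if prime n then 0 else mangoldt n * real n powr (-7/8))"
  let ?A = "{x\<^sup>2 * y ^ 3 | x y :: nat. x > 0 \<and> y > 0}"
  have T0: "T n \<ge> 0" for n by (simp add: T_def mangoldt_nonneg)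
  have "T summable_on ?A"
  proof (rule summable_on_comparison_test)
    show "(\<lambda>n. 16 * real n powr (-13/16)) summable_on ?A"
      by (intro summable_on_cmult_right summable_square_cube)
    fix n assume "n \<in> ?A"
    then have n: "n > 0" by auto
    have "mangoldt n \<le> ln (real n)" using n by (rule mangoldt_le)
    also have "\<dots> \<le> 16 * real n powr (1/16)" using ln_power_le[of "real n" "1/16" 1] n by simp
    finally have "mangoldt n * real n powr (-7/8) \<le> 16 * real n powr (1/16) * real n powr (-7/8)"
      by (intro mult_right_mono) auto
    also have "\<dots> = 16 * (real n powr (1/16) * real n powr (-7/8))" by (simp only: mult.assoc)
    also have "real n powr (1/16) * real n powr (-7/8) = real n powr (-13/16)" by (subst powr_add [symmetric]) simp
    finally show "T n \<le> 16 * real n powr (-13/16)" by (simp add: T_def)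
  qed (rule T0)
  moreover have "T n = 0" if "n \<notin> ?A" for n
    using nonprime_primepow_square_cube[of n] that by (auto simp: T_def mangoldt_def)
  ultimately have "T summable_on UNIV"
    by (subst summable_on_cong_neutral[where T = ?A and g = T]) auto
  then have sT: "summable T" by (rule summable_on_imp_summable)
  show ?thesis
  proof (rule that[of "suminf T + 1"])
    show "suminf T + 1 > 0" using suminf_nonneg[OF sT] T0 by (simp add: add_nonneg_pos)
    fix k :: nat and s :: real assume s: "1 < s" "s \<le> 2"
    have le: "(if prime n then 0 else mangoldt n * lw k s (real n)) \<le> (8 ^ k * fact k) * T n" for n
    proof (cases "n = 0")
      case False
      then have n: "real n \<ge> 1" by simp
      have "lw k s (real n) \<le> (fact k * 8 ^ k * real n powr (1/8)) * real n powr (-1)"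
        unfolding lw_def using ln_power_le[OF n, of "1/8" k] n s by (intro mult_mono powr_mono) auto
      also have "\<dots> = fact k * 8 ^ k * (real n powr (1/8) * real n powr (-1))" by (simp only: mult.assoc)
      also have "real n powr (1/8) * real n powr (-1) = real n powr (-7/8)" by (subst powr_add [symmetric]) simp
      finally have "mangoldt n * lw k s (real n) \<le> mangoldt n * (fact k * 8 ^ k * real n powr (-7/8))"
        by (intro mult_left_mono mangoldt_nonneg)
      then show ?thesis by (simp add: T_def mult_ac)
    qed (simp add: T_def)
    have "(\<Sum>n. if prime n then 0 else mangoldt n * lw k s (real n)) \<le> (\<Sum>n. (8 ^ k * fact k) * T n)"
    proof (rule suminf_le[OF le])
      show "summable (\<lambda>n. if prime n then 0 else mangoldt n * lw k s (real n))"
        by (rule summable_comparison_test'[OF summable_mangoldt_lw[OF s, of k], of 0])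
           (auto simp: mangoldt_nonneg lw_of_nat_nonneg simp del: mangoldt_prime)
      show "summable (\<lambda>n. (8 ^ k * fact k) * T n)" by (intro summable_mult sT)
    qed
    also have "\<dots> = (8 ^ k * fact k) * suminf T" using sT by (rule suminf_mult)
    also have "\<dots> \<le> (suminf T + 1) * (8 ^ k * fact k)" by (simp add: algebra_simps)
    finally show "(\<Sum>n. if prime n then 0 else mangoldt n * lw k s (real n)) \<le> (suminf T + 1) * (8 ^ k * fact k)" .
  qed
qed

lemma progression_sum_eq:
  assumes d: "odd d" "d > 0" and b: "coprime b d" and s: "1 < s" "s \<le> 2"
  shows "of_real (real (card (dchars d)) * (\<Sum>n. if [n = b] (mod d) then mangoldt n * lw k s (real n) else 0))
     = (\<Sum>\<xi>\<in>dchars d. cnj (\<xi> b) * Sser \<xi> k s)"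
proof -
  let ?t = "\<lambda>n. if [n = b] (mod d) then mangoldt n * lw k s (real n) else 0"
  have "summable ?t"
    by (rule summable_comparison_test'[OF summable_mangoldt_lw[OF s, of k], of 0])
       (auto simp: mangoldt_nonneg lw_of_nat_nonneg simp del: mangoldt_prime)
  then have "(\<lambda>n. complex_of_real (real (card (dchars d)) * ?t n)) sums of_real (real (card (dchars d)) * suminf ?t)"
    by (intro sums_of_real sums_mult summable_sums)
  moreover have "(\<lambda>n. \<Sum>\<xi>\<in>dchars d. cnj (\<xi> b) * (\<xi> n * mangoldt n * of_real (lw k s (real n))))
      sums (\<Sum>\<xi>\<in>dchars d. cnj (\<xi> b) * Sser \<xi> k s)"
    using norm_dchars_le d s by (intro sums_sum sums_mult S_sums) auto
  moreover have "(\<Sum>\<xi>\<in>dchars d. cnj (\<xi> b) * (\<xi> n * mangoldt n * of_real (lw k s (real n))))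
     = complex_of_real (real (card (dchars d)) * ?t n)" for n
  proof -
    have "(\<Sum>\<xi>\<in>dchars d. cnj (\<xi> b) * (\<xi> n * mangoldt n * of_real (lw k s (real n))))
       = (\<Sum>\<xi>\<in>dchars d. cnj (\<xi> b) * \<xi> n) * (mangoldt n * of_real (lw k s (real n)))"
      by (simp add: sum_distrib_right mult.assoc)
    then show ?thesis by (simp add: dchars_orthogonality[OF d b])
  qed
  ultimately show ?thesis by (simp only: sums_unique2)
qed

text \<open>
  By orthogonality the \<open>\<phi>(d)\<close>-fold sum over the class differs from the sum over all units by at most
  \<open>\<phi>(d)\<close> contributions of size \<open>k! (1024 B^9)^(k+1)\<close>. Since \<open>L\<close> is more than 16 times \<open>1024 B^9\<close> and
  \<open>d \<le> 2^k\<close>, they amount to at most an eighth of \<open>k! L^(k+1)\<close>.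
\<close>

theorem primes_in_progression:
  fixes R :: nat
  assumes R: "odd R" "R > 1"
  obtains c0 :: real where
    "\<And>E d B k b L. R dvd d \<Longrightarrow> d dvd R ^ E \<Longrightarrow> B \<ge> L_bound (real (R ^ E)) \<Longrightarrow> B \<ge> c0 \<Longrightarrow> B \<ge> real (k + 1) \<Longrightarrow>
       R ^ E \<le> 2 ^ k \<Longrightarrow> L = 10 ^ 5 * B ^ 9 \<Longrightarrow> coprime b d \<Longrightarrow>
       (\<Sum>n. if prime n \<and> [n = b] (mod d) then lw (Suc k) (1 + 1 / L) (real n) else 0)
          \<ge> fact k * L ^ Suc k / (8 * real d)"
proof -
  obtain \<eta> :: real where \<eta>: "\<eta> > 0"
    "\<And>\<xi> s. \<xi> \<in> dchars R \<Longrightarrow> \<xi> \<noteq> trivial_char R \<Longrightarrow> (\<And>n. cnj (\<xi> n) = \<xi> n) \<Longrightarrow> 1 < s \<Longrightarrow> s \<le> 1 + \<eta> \<Longrightarrow> norm (Lser \<xi> 0 s) \<ge> \<eta>"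
    using real_chars_L_ge[of R] R by auto
  obtain c1 :: real where c1: "c1 > 0"
    "\<And>k s. 1 < s \<Longrightarrow> s \<le> 2 \<Longrightarrow> (\<Sum>n. if prime n then 0 else mangoldt n * lw k s (real n)) \<le> c1 * (8 ^ k * fact k)"
    using nonprime_sum_le by blast
  \<comment> \<open>The three entries serve the proper prime powers, the primes dividing \<open>R\<close> and the real characters, in this order.\<close>
  define c0 where "c0 = max (8 * c1) (max (16 * real R * ln R) (1 / \<eta>))"
  have R3: "R \<ge> 3" using R by (cases "R = 2") auto
  show ?thesis
  proof (rule that[of c0])
    fix E d k b :: nat and B L :: real
    assume d: "R dvd d" "d dvd R ^ E" and B: "B \<ge> L_bound (real (R ^ E))" "B \<ge> c0" "B \<ge> real (k + 1)"
      and k: "R ^ E \<le> 2 ^ k" and L: "L = 10 ^ 5 * B ^ 9" and b: "coprime b d"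
    have RE0: "R ^ E > 0" using R by simp
    have d0: "d > 0" using d RE0 by (metis dvd_pos_nat)
    have dR: "d \<ge> R" using d d0 by (simp add: dvd_imp_le)
    have d1: "d \<ge> 1" "d > 1" using dR R by auto
    have dE: "d \<le> R ^ E" using d RE0 by (simp add: dvd_imp_le)
    have "real d \<le> real (2 ^ k)" unfolding of_nat_le_iff using dE k by (rule le_trans)
    then have dk: "real d \<le> 2 ^ k" by simp
    have "odd (R ^ E)" using R by simp
    then have od: "odd d" using d(2) dvd_trans by blast
    have "real d \<le> real (R ^ E)" using dE by (simp only: of_nat_le_iff)
    then have "ln (real d) \<le> ln (real (R ^ E))" using d0 RE0 by (subst ln_le_cancel_iff) auto
    then have L_bound: "B \<ge> L_bound d" using B(1) by (simp add: L_bound_def)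
    have "0 \<le> ln (real d)" using d1 by simp
    then have B25: "B \<ge> 25" using L_bound by (simp add: L_bound_def)
    have Bpow: "B \<le> B ^ n" if "n > 0" for n using B25 that power_increasing[of 1 n B] by simp
    have LB: "L \<ge> 10 ^ 5 * B" using Bpow[of 9] by (simp add: L)
    have Lc: "L \<ge> c0" using LB B B25 by simp
    have L16: "L \<ge> 16" using LB B25 by simp
    let ?s = "1 + 1 / L"
    have s: "1 < ?s" "?s \<le> 2" using L16 by auto
    define X where "X = fact k * L ^ Suc k"
    have X0: "X > 0" using L16 by (auto simp: X_def)
    have nonp: "norm (Sser \<xi> k ?s) \<le> fact k * (1024 * B ^ 9) ^ Suc k" if c: "\<xi> \<in> dchars d" "\<xi> \<noteq> trivial_char d" for \<xi>
    proof (rule Sser_nontrivial_char_le[OF c d1(1) s L_bound])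
      show "norm (Lser \<xi> 0 ?s) \<ge> 1 / (128 * B ^ 7)"
      proof (cases "(\<lambda>n. \<xi> n ^ 2) = trivial_char d")
        case False
        show ?thesis
          using LB B25 by (intro Lser_complex_char_ge[OF c False d1(1) L_bound s(1)]) (auto simp: L field_simps)
      next
        case True
        note desc = real_char_descends[OF c(1) True d R]
        have e1: "1 / \<eta> \<le> B" using B(2) by (simp add: c0_def)
        have "1 / (128 * B ^ 7) \<le> 1 / B" using Bpow[of 7] B25 by (intro divide_left_mono) auto
        also have "\<dots> \<le> \<eta>" using e1 \<eta>(1) B25 by (simp add: field_simps)
        finally have 1: "1 / (128 * B ^ 7) \<le> \<eta>" .
        have "1 / L \<le> 1 / B" using LB B25 by (intro divide_left_mono) auto
        also have "\<dots> \<le> \<eta>" using e1 \<eta>(1) B25 by (simp add: field_simps)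
        finally have "?s \<le> 1 + \<eta>" by simp
        then have "norm (Lser \<xi> 0 ?s) \<ge> \<eta>"
          using \<eta>(2)[OF desc(1) _ cnj_eq_of_square[OF c(1) d0 True] s(1)] c(2) desc(2) by simp
        then show ?thesis using 1 by linarith
      qed
    qed
    let ?t = "\<lambda>n. mangoldt n * lw k ?s (real n)"
    have t0: "?t n \<ge> 0" for n by (intro mult_nonneg_nonneg mangoldt_nonneg lw_of_nat_nonneg)
    have sm: "summable (\<lambda>n. if P n then ?t n else 0)" for P
      by (rule summable_comparison_test'[OF summable_mangoldt_lw[OF s, of k], of 0])
         (auto simp: mangoldt_nonneg lw_of_nat_nonneg simp del: mangoldt_prime)
    define N where "N = (\<Sum>n. if \<not> prime n then ?t n else 0)"
    define P where "P = (\<Sum>n. if prime n \<and> n dvd R then ?t n else 0)"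
    define U where "U = (\<Sum>n. if [n = b] (mod d) then ?t n else 0)"
    define H where "H = real (card (dchars d))"
    define S0 where "S0 = (\<Sum>n. ?t n)"
    define Sd where "Sd = (\<Sum>n. if coprime n d then ?t n else 0)"
    have S0: "S0 \<ge> X / 2"
      unfolding S0_def X_def by (rule mangoldt_lw_sum_ge) (use LB B(3) B25 in simp)
    have H: "0 < H" "H \<le> real d"
      using card_dchars[OF od d1(2)] totient_le[of d] d0 by (auto simp: H_def)
    have "8 * real d * (c1 * 8 ^ k) \<le> 8 * 2 ^ k * (c1 * 8 ^ k)"
      using dk c1 by (intro mult_right_mono mult_left_mono) auto
    also have "\<dots> = (8 * c1) * 16 ^ k" by (simp flip: power_mult_distrib)
    also have "\<dots> \<le> L * L ^ k"
      using Lc L16 c1 by (intro mult_mono power_mono) (auto simp: c0_def)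
    finally have "8 * real d * (c1 * (8 ^ k * fact k)) \<le> X"
      by (simp add: X_def mult_ac)
    moreover have "N \<le> c1 * (8 ^ k * fact k)"
    proof -
      have "(\<lambda>n. if \<not> prime n then ?t n else 0) = (\<lambda>n. if prime n then 0 else ?t n)" by (rule ext) simp
      then show ?thesis using c1(2)[OF s, of k] unfolding N_def by simp
    qed
    then have "8 * real d * N \<le> 8 * real d * (c1 * (8 ^ k * fact k))" by (rule mult_left_mono) simp
    ultimately have "N * (8 * real d) \<le> X" by (simp only: mult.commute[of N])
    then have N: "N \<le> X / (8 * real d)" using d0 by (simp add: pos_le_divide_eq)
    have "X / (8 * real d) \<le> X / 16" using X0 dR R3 by (intro divide_left_mono) auto
    then have N16: "N \<le> X / 16" using N by linarith
    have P: "P \<le> X / 16"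
    proof -
      have lR: "ln (real R) \<ge> 1"
      proof -
        have "exp 1 \<le> real R" using R3 exp_le by linarith
        then show ?thesis using R by (subst ln_ge_iff) auto
      qed
      have "P = (\<Sum>n | prime n \<and> n dvd R. ?t n)"
        unfolding P_def using R by (subst suminf_finite[of "{n. prime n \<and> n dvd R}"]) (auto intro!: sum.cong)
      also have "\<dots> \<le> (\<Sum>n | prime n \<and> n dvd R. ln R ^ Suc k)"
      proof (rule sum_mono)
        fix n assume "n \<in> {n. prime n \<and> n dvd R}"
        then have n: "1 \<le> n" "n \<le> R" using R prime_ge_1_nat by (auto intro: dvd_imp_le)
        have "?t n \<le> lw (Suc k) ?s (real n)" by (rule mangoldt_lw_le)
        also have "\<dots> \<le> ln R ^ Suc k * 1"
        proof -
          have "-?s \<le> 0" using s by linarith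
          then have "real n powr (-?s) \<le> real n powr 0" using n by (intro powr_mono) auto
          also have "\<dots> = 1" using n by simp
          finally show ?thesis unfolding lw_def using n by (intro mult_mono power_mono) auto
        qed
        finally show "?t n \<le> ln R ^ Suc k" by simp
      qed
      also have "\<dots> \<le> R * ln R ^ Suc k"
      proof -
        have "card {n. prime n \<and> n dvd R} \<le> card {1..R}"
        proof (intro card_mono subsetI)
          fix n assume n: "n \<in> {n. prime n \<and> n dvd R}"
          then have "n \<le> R" using R by (auto intro!: dvd_imp_le)
          then show "n \<in> {1..R}" using n prime_ge_1_nat[of n] by auto
        qed auto
        then show ?thesis using lR by (simp add: mult_right_mono)
      qed
      also have "\<dots> \<le> (16 * real R * ln R) ^ Suc k / 16"
      proof -
        have "16 * real R \<le> (16 * real R) ^ Suc k" using R by (intro self_le_power) auto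
        then have "16 * real R * ln R ^ Suc k \<le> (16 * real R) ^ Suc k * ln R ^ Suc k"
          using lR by (intro mult_right_mono) auto
        moreover have "(16 * real R * ln R) ^ Suc k = (16 * real R) ^ Suc k * ln R ^ Suc k"
          by (rule power_mult_distrib)
        ultimately show ?thesis by linarith
      qed
      also have "\<dots> \<le> L ^ Suc k / 16"
        using Lc lR by (intro divide_right_mono power_mono) (auto simp: c0_def)
      also have "\<dots> \<le> X / 16"
      proof -
        have "1 * L ^ Suc k \<le> X" unfolding X_def using L16 by (intro mult_right_mono) (auto simp: fact_ge_1)
        then show ?thesis by simp
      qed
      finally show ?thesis .
    qed
    have Sd: "Sd \<ge> X / 2 - X / 16 - X / 16"
    proof -
      have "S0 \<le> (\<Sum>n. (if coprime n d then ?t n else 0) + ((if \<not> prime n then ?t n else 0) + (if prime n \<and> n dvd R then ?t n else 0)))"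
        unfolding S0_def
      proof (rule suminf_le)
        fix n
        have "n dvd R" if "prime n" "\<not> coprime n d"
        proof -
          have "n dvd d" using that by (meson prime_imp_coprime)
          then have "n dvd R ^ E" using d(2) dvd_trans by blast
          then show ?thesis using that(1) by (rule prime_dvd_power[rotated])
        qed
        then show "?t n \<le> (if coprime n d then ?t n else 0) + ((if \<not> prime n then ?t n else 0) + (if prime n \<and> n dvd R then ?t n else 0))"
          using t0[of n] by auto
      qed (intro summable_add sm summable_mangoldt_lw s)+
      also have "\<dots> = Sd + (N + P)"
        unfolding Sd_def N_def P_def by (simp only: suminf_add[symmetric] sm summable_add)
      finally show ?thesis using S0 N16 P by linarith
    qed
    have Sp: "Sser (trivial_char d) k ?s = of_real Sd"
    proof -
      have "(\<lambda>n. trivial_char d n * mangoldt n * complex_of_real (lw k ?s (real n))) sums Sser (trivial_char d) k ?s"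
        using norm_dchars_le[OF trivial_char_in_dchars d0] s by (intro S_sums) auto
      moreover have "(\<lambda>n. complex_of_real (if coprime n d then ?t n else 0)) sums of_real Sd"
        unfolding Sd_def by (intro sums_of_real summable_sums sm)
      moreover have "trivial_char d n * mangoldt n * complex_of_real (lw k ?s (real n)) = complex_of_real (if coprime n d then ?t n else 0)" for n
        by (simp add: trivial_char_def)
      ultimately show ?thesis by (simp only: sums_unique2)
    qed
    have HU: "H * U \<ge> X / 4"
    proof -
      have "complex_of_real (H * U) = (\<Sum>\<xi>\<in>dchars d. cnj (\<xi> b) * Sser \<xi> k ?s)"
        unfolding H_def U_def by (rule progression_sum_eq[OF od d0 b s])
      also have "\<dots> = cnj (trivial_char d b) * Sser (trivial_char d) k ?s + (\<Sum>\<xi>\<in>dchars d - {trivial_char d}. cnj (\<xi> b) * Sser \<xi> k ?s)"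
        by (rule sum.remove[OF finite_dchars[OF d0] trivial_char_in_dchars])
      also have "cnj (trivial_char d b) * Sser (trivial_char d) k ?s = of_real Sd" using b by (simp add: trivial_char_def Sp)
      finally have "complex_of_real (Sd - H * U) = - (\<Sum>\<xi>\<in>dchars d - {trivial_char d}. cnj (\<xi> b) * Sser \<xi> k ?s)" by simp
      then have "norm (complex_of_real (Sd - H * U)) = norm (\<Sum>\<xi>\<in>dchars d - {trivial_char d}. cnj (\<xi> b) * Sser \<xi> k ?s)"
        by (simp only: norm_minus_cancel)
      then have "\<bar>Sd - H * U\<bar> = norm (\<Sum>\<xi>\<in>dchars d - {trivial_char d}. cnj (\<xi> b) * Sser \<xi> k ?s)"
        by (simp only: norm_of_real)
      also have "\<dots> \<le> (\<Sum>\<xi>\<in>dchars d - {trivial_char d}. fact k * (1024 * B ^ 9) ^ Suc k)"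
      proof (rule sum_norm_le)
        fix \<xi> assume c: "\<xi> \<in> dchars d - {trivial_char d}"
        have "norm (cnj (\<xi> b) * Sser \<xi> k ?s) = norm (Sser \<xi> k ?s)"
          using c norm_dchars[of \<xi> d b] b d0 by (simp add: norm_mult)
        then show "norm (cnj (\<xi> b) * Sser \<xi> k ?s) \<le> fact k * (1024 * B ^ 9) ^ Suc k"
          using nonp[of \<xi>] c by simp
      qed
      also have "\<dots> \<le> real d * (fact k * (1024 * B ^ 9) ^ Suc k)"
      proof -
        have "real (card (dchars d - {trivial_char d})) \<le> real d"
          using H(2) card_mono[OF finite_dchars[OF d0], of "dchars d - {trivial_char d}"] unfolding H_def by force
        then show ?thesis using B25 by (simp only: sum_constant) (intro mult_right_mono, auto)
      qed
      also have "\<dots> \<le> X / 8"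
      proof -
        have "8 * real d \<le> 8 * 2 ^ k" using dk by simp
        also have "\<dots> \<le> 16 * 16 ^ k" by (intro mult_mono power_mono) auto
        finally have "8 * real d * (1024 * B ^ 9) ^ Suc k \<le> 16 ^ Suc k * (1024 * B ^ 9) ^ Suc k"
          using B25 by (intro mult_right_mono) auto
        also have "\<dots> = (16 * (1024 * B ^ 9)) ^ Suc k" by (rule power_mult_distrib[symmetric])
        also have "\<dots> \<le> L ^ Suc k" using B25 by (intro power_mono) (auto simp: L)
        finally have "fact k * (8 * real d * (1024 * B ^ 9) ^ Suc k) \<le> X" unfolding X_def by (intro mult_left_mono) auto
        moreover have "fact k * (8 * real d * (1024 * B ^ 9) ^ Suc k) = 8 * (real d * (fact k * (1024 * B ^ 9) ^ Suc k))"
          by (simp only: mult_ac)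
        ultimately show ?thesis by linarith
      qed
      finally show ?thesis using Sd by linarith
    qed
    have "real d * U \<ge> X / 4"
    proof -
      have "U \<ge> 0" unfolding U_def using t0 by (intro suminf_nonneg sm) auto
      then have "H * U \<le> real d * U" using H by (intro mult_right_mono) auto
      then show ?thesis using HU by linarith
    qed
    then have U: "U \<ge> X / (4 * real d)" using d0 by (simp add: field_simps)
    have "U \<le> (\<Sum>n. (if prime n \<and> [n = b] (mod d) then ?t n else 0) + (if \<not> prime n then ?t n else 0))"
      unfolding U_def by (rule suminf_le) (use t0 in \<open>auto intro!: summable_add sm\<close>)
    also have "\<dots> = (\<Sum>n. if prime n \<and> [n = b] (mod d) then ?t n else 0) + N"
      unfolding N_def by (simp only: suminf_add[symmetric] sm)
    also have "(\<lambda>n. if prime n \<and> [n = b] (mod d) then ?t n else 0)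
      = (\<lambda>n. if prime n \<and> [n = b] (mod d) then lw (Suc k) ?s (real n) else 0)"
      by (rule ext) (auto simp: lw_Suc)
    finally have "(\<Sum>n. if prime n \<and> [n = b] (mod d) then lw (Suc k) ?s (real n) else 0) \<ge> X / (4 * real d) - X / (8 * real d)"
      using U N by linarith
    also have "X / (4 * real d) - X / (8 * real d) = X / (8 * real d)" using d0 by (simp add: field_simps)
    finally show "(\<Sum>n. if prime n \<and> [n = b] (mod d) then lw (Suc k) ?s (real n) else 0)
          \<ge> fact k * L ^ Suc k / (8 * real d)" unfolding X_def .
  qed
qed

section \<open>Divisor sums and residue classes\<close>

lemma sigma_mult_coprime:
  assumes "coprime a b" "a > 0" "b > 0"
  shows "sigma (a * b) = sigma a * sigma b"
  unfolding sigma_def sum_divisors_coprime[OF assms] by (simp add: sum_product)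

lemma sigma_prime: "prime p \<Longrightarrow> sigma p = p + 1"
  using sum_divisors_prime_power[of p "\<lambda>d. d" 1] by (simp add: sigma_def)

lemma sigma_mult_prime_le:
  assumes p: "prime p" and m: "m > 0"
  shows "sigma (m * p) \<le> 2 * p * sigma m"
proof -
  have p1: "p \<ge> 1" using p prime_ge_1_nat by auto
  have fin: "finite {d. d dvd m}" using m by simp
  have "{d. d dvd m * p} \<subseteq> {d. d dvd m} \<union> (*) p ` {d. d dvd m}"
  proof
    fix d assume "d \<in> {d. d dvd m * p}"
    then have d: "d dvd m * p" by simp
    show "d \<in> {d. d dvd m} \<union> (*) p ` {d. d dvd m}"
    proof (cases "p dvd d")
      case True
      then obtain d' where d': "d = p * d'" by auto
      then have "d' dvd m" using d p1 by (simp add: mult.commute[of m])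
      then show ?thesis using d' by blast
    next
      case False
      then have "coprime d p" using prime_imp_coprime[OF p False] by (simp only: coprime_commute)
      then show ?thesis using d by (simp add: coprime_dvd_mult_left_iff)
    qed
  qed
  then have "sigma (m * p) \<le> (\<Sum>d\<in>{d. d dvd m} \<union> (*) p ` {d. d dvd m}. d)"
    unfolding sigma_def using fin by (intro sum_mono2) auto
  also have "\<dots> \<le> (\<Sum>d\<in>{d. d dvd m}. d) + (\<Sum>d\<in>(*) p ` {d. d dvd m}. d)"
    using fin by (simp add: sum_Un_nat)
  also have "(\<Sum>d\<in>(*) p ` {d. d dvd m}. d) = p * sigma m"
    using p1 by (subst sum.reindex) (auto simp: inj_on_def sigma_def sum_distrib_left)
  also have "(\<Sum>d\<in>{d. d dvd m}. d) + p * sigma m \<le> p * sigma m + p * sigma m"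
    using p1 by (simp add: sigma_def)
  finally show ?thesis by simp
qed

text \<open>
  Multiplication by a prime at most doubles the ratio of \<open>\<sigma>(n)\<close> to \<open>n\<close>, so the ratio of a number
  of exceptional form is at most \<open>4 k\<close>.
\<close>

lemma not_exceptional:
  assumes n: "n > 0" and s: "sigma n > 4 * k * n"
  shows "\<not> exceptional_form k n"
proof
  assume "exceptional_form k n"
  then consider m p where "k_perfect k m" "prime p" "n = m * p"
    | m p q where "k_perfect k m" "prime p" "prime q" "n = m * p * q"
    unfolding exceptional_form_def by blast
  then show False
  proof cases
    case 1
    then have "sigma n \<le> 2 * p * (k * m)" using sigma_mult_prime_le[of p m] by (simp add: k_perfect_def)
    also have "\<dots> \<le> 4 * k * n" using 1 by simp
    finally show False using s by simp
  next
    case 2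
    have mp: "m * p > 0" using 2 n by (simp add: k_perfect_def)
    have "sigma n \<le> 2 * q * sigma (m * p)" using sigma_mult_prime_le[of q "m * p"] 2 mp by simp
    also have "\<dots> \<le> 2 * q * (2 * p * (k * m))"
      using 2 sigma_mult_prime_le[of p m] by (intro mult_left_mono) (auto simp: k_perfect_def)
    also have "\<dots> = 4 * k * n" using 2 by simp
    finally show False using s by simp
  qed
qed

text \<open>
  The divisors \<open>n! / i\<close> with \<open>i \<le> n\<close> already add up to \<open>n!\<close> times a harmonic number.
\<close>

lemma exists_abundant: "\<exists>m>0. sigma m > K * m"
proof -
  have "filterlim (harm :: nat \<Rightarrow> real) at_top sequentially" by (rule harm_at_top)
  then have "eventually (\<lambda>n. harm n > real K) sequentially"
    unfolding filterlim_at_top_dense by blast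
  then obtain n where n: "harm n > real K" by (auto simp: eventually_sequentially)
  have "real K * fact n < harm n * fact n" using n by simp
  also have "\<dots> = (\<Sum>i=1..n. real (fact n div i))"
  proof -
    have "real (fact n div i) = inverse (real i) * fact n" if "i \<in> {1..n}" for i
      using that by (subst real_of_nat_div) (auto simp: dvd_fact field_simps)
    then show ?thesis by (simp add: harm_def sum_distrib_right)
  qed
  also have "\<dots> = real (\<Sum>i=1..n. fact n div i)" by simp
  also have "(\<Sum>i=1..n. fact n div i) = (\<Sum>d\<in>(\<lambda>i. fact n div i) ` {1..n}. d)"
  proof -
    have "inj_on (\<lambda>i. fact n div i :: nat) {1..n}"
    proof (rule inj_onI)
      fix i j :: nat assume ij: "i \<in> {1..n}" "j \<in> {1..n}" "(fact n :: nat) div i = fact n div j"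
      have "i dvd (fact n :: nat)" "j dvd (fact n :: nat)" using ij by (auto intro: dvd_fact)
      then have "i * (fact n div i) = (fact n :: nat)" "j * (fact n div j) = (fact n :: nat)" by auto
      then have "i * (fact n div i) = j * (fact n div i :: nat)" using ij by simp
      moreover have "(fact n div i :: nat) \<noteq> 0"
        using \<open>i * (fact n div i) = (fact n :: nat)\<close> by (metis fact_nonzero mult_0_right)
      ultimately show "i = j" by simp
    qed
    then show ?thesis by (simp add: sum.reindex)
  qed
  also have "\<dots> \<le> sigma (fact n)"
    unfolding sigma_def by (intro sum_mono2) (auto simp: dvd_fact intro!: div_dvd_iff_mult[THEN iffD2] simp: mult.commute)
  finally have "real K * fact n < real (sigma (fact n))" by simp
  then have "real (K * fact n) < real (sigma (fact n))" by simp
  then show ?thesis by (intro exI[of _ "fact n"]) (simp only: of_nat_less_iff fact_gt_zero)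
qed

lemma card_divisors_primorial_power:
  assumes "finite P" "\<And>p. p \<in> P \<Longrightarrow> prime (p::nat)"
  shows "card {x. x dvd (\<Prod>P) ^ e} = (e + 1) ^ card P"
  using assms
proof (induction P rule: finite_induct)
  case (insert p P)
  have p: "prime p" using insert by auto
  have "coprime p (\<Prod>P)"
    using insert by (intro prod_coprime_right) (auto intro: primes_coprime)
  then have cop: "coprime (p ^ e) ((\<Prod>P) ^ e)" by simp
  have pos: "p ^ e > 0" "(\<Prod>P) ^ e > 0" using insert prime_gt_0_nat by (auto intro!: prod_pos)
  have "card {x. x dvd p ^ e * (\<Prod>P) ^ e} = card ({x. x dvd p ^ e} \<times> {x. x dvd (\<Prod>P) ^ e})"
    using bij_betw_same_card[OF bij_betw_divisors_coprime[OF cop pos]] by simp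
  also have "\<dots> = (e + 1) * (e + 1) ^ card P"
  proof -
    have "inj_on (\<lambda>j. p ^ j) {..e}" using prime_gt_1_nat[OF p] by (auto simp: inj_on_def)
    then have "card {x. x dvd p ^ e} = e + 1"
      unfolding divisors_prime_power_nat[OF p] by (simp add: card_image)
    then show ?thesis using insert by (simp add: card_cartesian_product)
  qed
  finally show ?case using insert by (simp add: power_mult_distrib)
qed simp

lemma exists_finite_primes: "\<exists>P. finite P \<and> card P = J \<and> (\<forall>p\<in>P. prime p \<and> p > (M::nat))"
proof -
  have "infinite ({p::nat. prime p} - {..M})" using primes_infinite by (simp add: Diff_infinite_finite)
  then obtain P where "P \<subseteq> {p. prime p} - {..M}" "finite P" "card P = J"
    using infinite_arbitrarily_large by blast
  then show ?thesis by (intro exI[of _ P]) auto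
qed

lemma fact_add_le: "(fact (n + i) :: nat) \<le> fact n * (n + i) ^ i"
proof (induction i)
  case (Suc i)
  have "(fact (n + Suc i) :: nat) = (n + Suc i) * fact (n + i)" by simp
  also have "\<dots> \<le> (n + Suc i) * (fact n * (n + Suc i) ^ i)"
    using Suc by (intro mult_left_mono order.trans[OF Suc] power_mono) auto
  finally show ?case by (simp add: algebra_simps)
qed simp

lemma fact_double_le: "(fact (2 * k) :: real) \<le> 4 ^ k * (fact k)\<^sup>2"
proof -
  have "fact (2 * k) = real (2 * k choose k) * (fact k)\<^sup>2"
    using binomial_fact[of k "2 * k", where 'a = real] by (simp add: power2_eq_square)
  also have "\<dots> \<le> real (2 ^ (2 * k)) * (fact k)\<^sup>2"
    by (intro mult_right_mono) (simp_all only: of_nat_le_iff binomial_le_pow2 zero_le_power2)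
  also have "real (2 ^ (2 * k)) = 4 ^ k" by (simp add: power_mult)
  finally show ?thesis .
qed

text \<open>
  The congruence determines the class of \<open>q\<close> because \<open>t\<close> is invertible; the solution is a unit because a common
  prime factor with \<open>R\<close> would divide \<open>s\<close>.
\<close>

lemma class_exists:
  fixes x R t s u e :: nat
  assumes x: "x dvd R ^ e" and R: "R > 1" and t: "coprime t R" and s: "coprime s R"
  obtains b where "coprime b (x * R\<^sup>2)" "\<And>q. [q = b] (mod x * R\<^sup>2) \<Longrightarrow> [t * q + s = u * x * R] (mod x * R\<^sup>2)"
proof -
  have R0: "R > 0" using R by simp
  have x0: "x > 0" using x R0 by (metis dvd_pos_nat zero_less_power)
  have xc: "coprime y R \<Longrightarrow> coprime y (x * R\<^sup>2)" for y
    using x by (meson coprime_divisors coprime_mult_right_iff coprime_power_right_iff dvd_refl)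
  let ?d = "x * R\<^sup>2"
  have d0: "?d > 0" using x0 R0 by simp
  obtain t' where t': "[t * t' = 1] (mod ?d)" using cong_solve_coprime_nat[OF xc[OF t]] by auto
  define b where "b = t' * (u * x * R + s * (?d - 1))"
  have tb: "[t * b + s = u * x * R] (mod ?d)"
  proof -
    have "[t * t' * (u * x * R + s * (?d - 1)) + s = 1 * (u * x * R + s * (?d - 1)) + s] (mod ?d)"
      using t' by (intro cong_add cong_mult) auto
    moreover have "1 * (u * x * R + s * (?d - 1)) + s = u * x * R + ?d * s"
    proof -
      have "s * (?d - 1) + s = ?d * s" using d0 by (cases ?d) auto
      then show ?thesis by (simp only: mult_1 add.assoc)
    qed
    moreover have "[u * x * R + ?d * s = u * x * R] (mod ?d)" by (simp add: cong_def)
    moreover have "t * b = t * t' * (u * x * R + s * (?d - 1))" unfolding b_def by (simp only: mult.assoc)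
    ultimately show ?thesis by (simp only:) (rule cong_trans)
  qed
  have "coprime b R"
  proof (rule ccontr)
    assume "\<not> coprime b R"
    then have "gcd b R \<noteq> 1" unfolding coprime_iff_gcd_eq_1 .
    then obtain p where "prime p" "p dvd gcd b R" using prime_factor_nat by blast
    then have p: "prime p" "p dvd b" "p dvd R" by auto
    have d: "p dvd ?d" using dvd_mult[OF dvd_mult[OF p(3), of R], of x] by (simp only: power2_eq_square)
    have "[t * b + s = u * x * R] (mod p)" using tb d by (rule cong_dvd_modulus_nat)
    then have "p dvd t * b + s \<longleftrightarrow> p dvd u * x * R" by (rule cong_dvd_iff)
    then have "p dvd t * b + s" using dvd_mult[OF p(3), of "u * x"] by (simp only:)
    moreover have "p dvd t * b" using p(2) by (rule dvd_mult)
    ultimately have "p dvd s" by (simp only: dvd_add_right_iff)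
    then show False using coprime_common_divisor[OF s _ p(3)] p(1) not_prime_unit by blast
  qed
  show ?thesis
  proof (rule that[of b])
    show "coprime b ?d" using \<open>coprime b R\<close> by (rule xc)
    fix q assume "[q = b] (mod ?d)"
    then have "[t * q + s = t * b + s] (mod ?d)" by (intro cong_add cong_mult) auto
    then show "[t * q + s = u * x * R] (mod ?d)" using tb by (rule cong_trans)
  qed
qed

lemma class_form:
  assumes "[y = u * x * R] (mod x * R\<^sup>2)" "x > 0" "u < R" "(R::nat) > 1"
  obtains w where "y = x * R * (R * w + u)"
proof -
  have "u * x * R < x * R\<^sup>2" using assms by (simp add: power2_eq_square)
  then have "y mod (x * R\<^sup>2) = u * x * R" using assms by (simp add: cong_def)
  then have "y = x * R\<^sup>2 * (y div (x * R\<^sup>2)) + u * x * R" by (metis mult_div_mod_eq)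
  then have "y = x * R * (R * (y div (x * R\<^sup>2)) + u)" by (simp add: power2_eq_square algebra_simps)
  then show ?thesis by (rule that)
qed

text \<open>
  The cofactors \<open>R w + u\<close> are coprime to \<open>R\<close>, so \<open>x\<close> and \<open>x'\<close> divide each other.
\<close>

lemma class_unique:
  assumes eq: "x * R * (R * w + u) = x' * R * (R * w' + u')"
    and x: "x dvd R ^ e" "x' dvd R ^ e" and u: "u \<in> {1, 2}" "u' \<in> {1, 2}" and R: "odd R" "(R::nat) > 1"
  shows "x = x'" "u = u'"
proof -
  have "R \<noteq> 2" using R(1) by auto
  then have R0: "R > 0" and R3: "R > 2" using R(2) by auto
  have cop: "coprime z (R * v + i)" if "i \<in> {1, 2}" "z dvd R ^ e" for z v i
  proof -
    have "coprime R i" using that(1) R(1) by auto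
    moreover have "gcd R (v * R + i) = gcd R i" by (rule gcd_add_mult)
    ultimately have "coprime R (R * v + i)" by (simp only: coprime_iff_gcd_eq_1 mult.commute)
    then show ?thesis using that(2) by (meson coprime_divisors coprime_power_left_iff dvd_refl)
  qed
  have e2: "x * (R * w + u) = x' * (R * w' + u')" using eq R0 by simp
  have "x dvd x' * (R * w' + u')" using e2 by (metis dvd_triv_left)
  then have 1: "x dvd x'" using cop[OF u(2) x(1)] by (simp add: coprime_dvd_mult_left_iff)
  have "x' dvd x * (R * w + u)" using e2 by simp
  then have 2: "x' dvd x" using cop[OF u(1) x(2)] by (simp add: coprime_dvd_mult_left_iff)
  show xx: "x = x'" using 1 2 by (rule dvd_antisym)
  have "x > 0" using x(1) R0 by (metis dvd_pos_nat zero_less_power)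
  then have "R * w + u = R * w' + u'" using e2 xx by simp
  then have "(R * w + u) mod R = (R * w' + u') mod R" by simp
  then show "u = u'" using u R3 by auto
qed

section \<open>Counting solutions\<close>

text \<open>
  The inequality of the means replaces \<open>ln q ln r\<close> by \<open>(ln N)^2 / 4\<close>. The resulting factor
  \<open>4^(-k-1)\<close> is essential: in \<open>divisor_count_le\<close> it cancels the quotient of \<open>(2 k)!\<close> and \<open>(k!)^2\<close>.
\<close>

lemma pair_weight_le:
  fixes q r t s N :: nat and sx :: real
  assumes q: "q \<ge> 1" and r: "r \<ge> 1" and t: "t \<ge> 1" and N: "N = (t * q + s) * (t * r + s)"
    and sx: "1 \<le> sx" "sx \<le> 2"
  shows "lw (Suc k) sx q * lw (Suc k) sx r \<le> real (t + s) ^ 4 / 4 ^ Suc k * lw (2 * k + 2) sx N"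
proof -
  have "q * r \<le> (t * q + s) * (t * r + s)"
    using t by (intro mult_le_mono) (auto intro: trans_le_add1)
  then have qrN: "q * r \<le> N" using N by simp
  have "t * q + s \<le> (t + s) * q" "t * r + s \<le> (t + s) * r" using q r by (auto simp: algebra_simps)
  then have "N \<le> ((t + s) * q) * ((t + s) * r)" unfolding N by (rule mult_le_mono)
  then have NK: "N \<le> (t + s)\<^sup>2 * (q * r)" by (simp add: power2_eq_square mult_ac)
  have qr: "q * r \<ge> 1" using q r by simp
  have N1: "N \<ge> 1" using qr qrN by linarith
  have l: "0 \<le> ln (real q)" "0 \<le> ln (real r)" using q r by auto
  have "ln (real q) + ln (real r) = ln (real (q * r))" using q r by (simp add: ln_mult)
  also have "\<dots> \<le> ln (real N)"
  proof -
    have "real (q * r) \<le> real N" using qrN by (simp only: of_nat_le_iff)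
    moreover have "0 < real (q * r)" using q r by simp
    ultimately show ?thesis by (intro ln_mono)
  qed
  finally have lN: "ln (real q) + ln (real r) \<le> ln (real N)" .
  have "4 * (ln (real q) * ln (real r)) \<le> (ln (real q) + ln (real r))\<^sup>2"
    using zero_le_power2[of "ln (real q) - ln (real r)"] by (simp add: power2_eq_square algebra_simps)
  also have "\<dots> \<le> (ln (real N))\<^sup>2" using lN l by (intro power_mono) auto
  finally have "ln (real q) * ln (real r) \<le> (ln (real N))\<^sup>2 / 4" by simp
  then have "(ln (real q) * ln (real r)) ^ Suc k \<le> ((ln (real N))\<^sup>2 / 4) ^ Suc k"
    using l by (intro power_mono) auto
  also have "\<dots> = ln (real N) ^ (2 * k + 2) / 4 ^ Suc k"
  proof -
    have "((ln (real N))\<^sup>2) ^ Suc k = ln (real N) ^ (2 * k + 2)" unfolding power_mult[symmetric] by simp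
    then show ?thesis unfolding power_divide by simp
  qed
  finally have A: "(ln (real q) * ln (real r)) ^ Suc k \<le> ln (real N) ^ (2 * k + 2) / 4 ^ Suc k" .
  have ts: "real (t + s) \<ge> 1" using t by simp
  have "real N powr sx \<le> real ((t + s)\<^sup>2 * (q * r)) powr sx"
    using NK sx by (intro powr_mono2) (auto simp only: of_nat_le_iff of_nat_0_le_iff)
  also have "\<dots> = (real (t + s) ^ 2) powr sx * real (q * r) powr sx" by (simp add: powr_mult)
  also have "\<dots> \<le> real (t + s) ^ 4 * real (q * r) powr sx"
  proof (rule mult_right_mono)
    have "(real (t + s) ^ 2) powr sx \<le> (real (t + s) ^ 2) powr 2"
      using ts sx by (intro powr_mono) (auto simp: one_le_power)
    also have "\<dots> = (real (t + s) ^ 2) ^ 2" using ts by (subst powr_numeral) auto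
    also have "\<dots> = real (t + s) ^ 4" unfolding power_mult[symmetric] by simp
    finally show "(real (t + s) ^ 2) powr sx \<le> real (t + s) ^ 4" .
  qed simp
  finally have B0: "real N powr sx \<le> real (t + s) ^ 4 * real (q * r) powr sx" .
  have pos: "real N powr sx > 0" "real (q * r) powr sx > 0" using N1 qr by auto
  have B: "real q powr (-sx) * real r powr (-sx) \<le> real (t + s) ^ 4 * real N powr (-sx)"
  proof -
    have "real q powr (-sx) * real r powr (-sx) = inverse (real (q * r) powr sx)"
      by (simp add: powr_minus powr_mult)
    also have "\<dots> \<le> real (t + s) ^ 4 * inverse (real N powr sx)"
      using B0 pos by (simp add: field_simps)
    finally show ?thesis by (simp add: powr_minus)
  qed
  have "lw (Suc k) sx q * lw (Suc k) sx r = (ln (real q) * ln (real r)) ^ Suc k * (real q powr (-sx) * real r powr (-sx))"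
    unfolding lw_def power_mult_distrib by (simp only: mult_ac)
  also have "\<dots> \<le> (ln (real N) ^ (2 * k + 2) / 4 ^ Suc k) * (real (t + s) ^ 4 * real N powr (-sx))"
    by (rule mult_mono[OF A B]) (use N1 in auto)
  also have "\<dots> = real (t + s) ^ 4 / 4 ^ Suc k * lw (2 * k + 2) sx N" unfolding lw_def by simp
  finally show ?thesis .
qed

lemma solution_from_pair:
  fixes k m q r s t a :: nat
  assumes m: "m > 0" and s: "s = sigma m" "s > 4 * k * m" and t: "t = s - k * m" and k: "k > 0"
    and q: "prime q" "prime r" "q \<noteq> r" "q > m" "r > m"
    and a: "a = sigma (m * q * r) - k * (m * q * r)"
  shows "t * a + s\<^sup>2 = (t * q + s) * (t * r + s) + s * t" "m * q * r \<le> a" "sigma (m * q * r) = k * (m * q * r) + a"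
    "\<not> exceptional_form k (m * q * r)"
proof -
  have pos: "q > 0" "r > 0" using q prime_gt_0_nat by auto
  have nd: "\<not> q dvd m" "\<not> r dvd m" using q m by (auto dest: dvd_imp_le)
  have "coprime q m" "coprime r m" "coprime q r"
    using q nd by (auto intro: prime_imp_coprime primes_coprime)
  then have cop: "coprime m q" "coprime (m * q) r" by (auto simp: coprime_commute)
  have sig: "sigma (m * q * r) = s * (q + 1) * (r + 1)"
    using sigma_mult_coprime[OF cop(2)] sigma_mult_coprime[OF cop(1)] m pos q(1,2) s(1) by (simp add: sigma_prime)
  have "4 * k * (m * q * r) = (4 * k * m) * (q * r)" by simp
  also have "\<dots> < s * (q * r)" using s(2) pos by (intro mult_strict_right_mono) auto
  also have "\<dots> \<le> s * ((q + 1) * (r + 1))" by (intro mult_le_mono) auto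
  finally have big: "4 * k * (m * q * r) < sigma (m * q * r)" unfolding sig by (simp only: mult.assoc)
  show "\<not> exceptional_form k (m * q * r)" using big m pos by (intro not_exceptional) auto
  show e: "sigma (m * q * r) = k * (m * q * r) + a" using a big by simp
  have "1 * (m * q * r) \<le> k * (m * q * r)" using k by (intro mult_le_mono1) auto
  then show "m * q * r \<le> a" using big e by linarith
  have tk: "int t = int s - int k * int m" using t s(2) by (simp add: of_nat_diff)
  have ia: "int a = int s * (int q + 1) * (int r + 1) - int k * (int m * int q * int r)"
  proof -
    have "int (sigma (m * q * r)) = int (k * (m * q * r)) + int a" by (subst e) (simp only: of_nat_add)
    then show ?thesis unfolding sig by (simp add: algebra_simps)
  qed
  have "int (t * a + s\<^sup>2) = int ((t * q + s) * (t * r + s) + s * t)"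
    unfolding of_nat_add of_nat_mult of_nat_power ia tk by (simp add: power2_eq_square algebra_simps)
  then show "t * a + s\<^sup>2 = (t * q + s) * (t * r + s) + s * t" by (simp only: of_nat_eq_iff)
qed

lemma pair_injective:
  assumes "(q::nat) * r = q' * r'" "prime q" "prime r" "prime q'" "prime r'"
  shows "q = q' \<and> r = r' \<or> q = r' \<and> r = q'"
proof -
  have "q dvd q' * r'" using assms(1) by (metis dvd_triv_left)
  then have "q dvd q' \<or> q dvd r'" using assms by (simp add: prime_dvd_mult_iff)
  then have "q = q' \<or> q = r'" using assms by (auto dest: primes_dvd_imp_eq)
  moreover have "q > 0" "q' > 0" "r' > 0" using assms prime_gt_0_nat by auto
  ultimately show ?thesis using assms(1) by (auto simp: mult.commute)
qed

text \<open>
  The weights of all pairs \<open>(q, r)\<close> are added up in two ways. For each divisor \<open>x\<close> of \<open>R^e\<close> the two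
  residue classes contribute their full share, which gives the number of divisors as a factor. On the
  other hand, the pairs are sorted by the product \<open>N = (t q + s)(t r + s)\<close>: it is a multiple of
  \<open>R^(e+2)\<close>, and the pairs belonging to it give different solutions of one equation, so there are at
  most \<open>(ln N)^c\<close> of them. Since the main terms of both sides agree up to constants and powers of \<open>K\<close> and \<open>L\<close>,
  the number of divisors is bounded by such powers.
\<close>

lemma divisor_count_le:
  fixes k m s t R e c a0 :: nat and C L :: real
  assumes m: "m > 0" and s: "s = sigma m" "s > 4 * k * m" and t: "t = s - k * m" and k: "k > 0"
    and R: "odd R" "R > 1" "coprime t R" "coprime s R" "R > t * m + s"
    and c: "C \<le> real c" and a0: "a0 \<ge> 3" and Ra: "R ^ (e + 2) > s * (k * m) + t * a0"
    and few: "\<And>a. a > a0 \<Longrightarrow> real (card {n. 0 < n \<and> n \<le> a \<and> sigma n = k * n + a \<and> \<not> exceptional_form k n}) \<le> ln (real a) powr C"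
    and L: "L \<ge> 6" and RK: "R ^ (e + 2) \<le> 2 ^ K"
    and primes: "\<And>d b. R dvd d \<Longrightarrow> d dvd R ^ (e + 2) \<Longrightarrow> coprime b d \<Longrightarrow>
       (\<Sum>n. if prime n \<and> [n = b] (mod d) then lw (Suc K) (1 + 1 / L) (real n) else 0) \<ge> fact K * L ^ Suc K / (8 * real d)"
  shows "real (card {x. x dvd R ^ e}) \<le> 128 * (real R)\<^sup>2 * real (t + s) ^ 4 * real (2 * K + 2 + c) ^ (c + 2) * L ^ (c + 1)"
proof -
  define sx where "sx = 1 + 1 / L"
  have sx: "1 < sx" "sx \<le> 2" using L by (auto simp: sx_def)
  have R0: "R > 0" and R3: "R \<ge> 3" using R by (auto, cases "R = 2") auto
  have ts: "t \<le> s" "t \<ge> 1" "s \<ge> 1" using t s(2) by auto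
  define X where "X = fact K * L ^ Suc K"
  have X0: "X > 0" using L by (simp add: X_def)
  let ?D = "{x. x dvd R ^ e}"
  have finD: "finite ?D" using R0 by simp
  have x0: "x > 0" if "x \<in> ?D" for x using that R0 by (metis dvd_pos_nat mem_Collect_eq zero_less_power)
  let ?M = "\<lambda>x. x * R\<^sup>2"
  have M: "R dvd ?M x" "?M x dvd R ^ (e + 2)" if "x \<in> ?D" for x
    using that by (auto simp: power_add power2_eq_square)
  have "\<exists>b. coprime b (?M x) \<and> (\<forall>q. [q = b] (mod ?M x) \<longrightarrow> [t * q + s = u * x * R] (mod ?M x))" if "x \<in> ?D" for x u
    using class_exists[of x R e t s u] that R by (metis mem_Collect_eq)
  then obtain b where b: "\<And>x u. x \<in> ?D \<Longrightarrow> coprime (b x u) (?M x)"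
      "\<And>x u q. x \<in> ?D \<Longrightarrow> [q = b x u] (mod ?M x) \<Longrightarrow> [t * q + s = u * x * R] (mod ?M x)"
    by metis
  define Q where "Q = (\<lambda>Y u x. {q. q < Y \<and> prime q \<and> [q = b x u] (mod ?M x)})"
  have finQ: "finite (Q Y u x)" for Y u x by (auto simp: Q_def)
  have form: "\<exists>w. t * q + s = x * R * (R * w + u)" if "x \<in> ?D" "q \<in> Q Y u x" "u \<in> {1, 2}" for x q Y u
  proof -
    have "[q = b x u] (mod ?M x)" using that(2) by (simp add: Q_def)
    with that(1) have "[t * q + s = u * x * R] (mod ?M x)" by (rule b(2))
    moreover have "u < R" using that(3) R3 by auto
    ultimately show ?thesis using class_form[OF _ x0[OF that(1)] _ R(2)] by metis
  qed
  have Qgt: "q > m" if "x \<in> ?D" "q \<in> Q Y u x" "u \<in> {1, 2}" for x q Y u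
  proof -
    from form[OF that] obtain w where w: "t * q + s = x * R * (R * w + u)" by blast
    have "1 * R * 1 \<le> x * R * (R * w + u)" using x0[OF that(1)] that(3) by (intro mult_le_mono) auto
    then have "t * m + s < t * q + s" using w R(5) by linarith
    then show ?thesis by simp
  qed
  have uniq: "x = x'" "u = u'" if "x \<in> ?D" "q \<in> Q Y u x" "u \<in> {1, 2}" "x' \<in> ?D" "q \<in> Q Y u' x'" "u' \<in> {1, 2}" for x x' q Y u u'
    using form[OF that(1-3)] form[OF that(4-6)] class_unique[of x R _ u x' _ u' e] that R by (metis mem_Collect_eq)+
  \<comment> \<open>Half of the lower bound is reached by the primes below a common bound \<open>Y\<close>, so that only finitely many pairs matter.\<close>
  have "eventually (\<lambda>Y. X / (16 * real (?M x)) \<le> (\<Sum>q\<in>Q Y u x. lw (Suc K) sx (real q))) sequentially" if x: "x \<in> ?D" for x u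
  proof -
    let ?f = "\<lambda>n. if prime n \<and> [n = b x u] (mod ?M x) then lw (Suc K) sx (real n) else 0"
    have "summable ?f"
      by (rule summable_comparison_test'[OF summable_lw[OF sx, of "Suc K"], of 0])
         (auto simp: lw_of_nat_nonneg)
    then have "(\<lambda>Y. \<Sum>n<Y. ?f n) \<longlonglongrightarrow> suminf ?f" by (rule summable_LIMSEQ)
    moreover have "X / (16 * real (?M x)) < suminf ?f"
    proof -
      have "real (?M x) > 0" using x0[OF x] R0 by simp
      moreover have "X / (16 * z) < X / (8 * z)" if "z > 0" for z using X0 that by (simp add: field_simps)
      ultimately have "X / (16 * real (?M x)) < X / (8 * real (?M x))" by blast
      also have "\<dots> \<le> suminf ?f" using primes[OF M[OF x] b(1)[OF x, of u]] unfolding X_def sx_def .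
      finally show ?thesis .
    qed
    ultimately have "eventually (\<lambda>Y. X / (16 * real (?M x)) < (\<Sum>n<Y. ?f n)) sequentially" by (rule order_tendstoD(1))
    moreover have "(\<Sum>n<Y. ?f n) = (\<Sum>q\<in>Q Y u x. lw (Suc K) sx (real q))" for Y
    proof -
      have "Q Y u x = {n \<in> {..<Y}. prime n \<and> [n = b x u] (mod ?M x)}" by (auto simp: Q_def)
      then show ?thesis by (simp only: sum.inter_filter finite_lessThan)
    qed
    ultimately show ?thesis by (auto elim: eventually_mono)
  qed
  then have "eventually (\<lambda>Y. \<forall>x\<in>?D. \<forall>u\<in>{1,2}. X / (16 * real (?M x)) \<le> (\<Sum>q\<in>Q Y u x. lw (Suc K) sx (real q))) sequentially"
    by (intro eventually_ball_finite finD ballI) auto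
  then obtain Y where Y: "\<And>x u. x \<in> ?D \<Longrightarrow> u \<in> {1,2} \<Longrightarrow> X / (16 * real (?M x)) \<le> (\<Sum>q\<in>Q Y u x. lw (Suc K) sx (real q))"
    unfolding eventually_sequentially by blast
  let ?w = "\<lambda>q::nat. lw (Suc K) sx (real q)"
  \<comment> \<open>The first prime uses the unit 1 and the second the unit 2: the pair is then ordered, and its two entries differ even when \<open>x\<^sup>2 = R ^ e\<close>.\<close>
  define PP where "PP = (\<lambda>x. Q Y 1 x \<times> Q Y 2 (R ^ e div x))"
  define P where "P = (\<Union>x\<in>?D. PP x)"
  have comp: "R ^ e div x \<in> ?D" "x * (R ^ e div x) = R ^ e" if "x \<in> ?D" for x using that by auto
  have finP: "finite P" using finD finQ by (auto simp: P_def PP_def)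
  define NN where "NN = (\<lambda>(q, r). (t * q + s) * (t * r + s))"
  have props: "prime q" "prime r" "q \<noteq> r" "q > m" "r > m" "R ^ (e + 2) dvd NN (q, r)" if qrP: "(q, r) \<in> P" for q r
  proof -
    obtain x where x: "x \<in> ?D" "q \<in> Q Y 1 x" "r \<in> Q Y 2 (R ^ e div x)" using qrP by (auto simp: P_def PP_def)
    note y = comp[OF x(1)]
    show "prime q" "prime r" using x by (auto simp: Q_def)
    show "q > m" "r > m" using Qgt[OF x(1,2)] Qgt[OF y(1) x(3)] by auto
    show "q \<noteq> r" using uniq(2)[OF x(1,2) _ y(1), of 2] x(3) by auto
    obtain w w' where w: "t * q + s = x * R * (R * w + 1)" "t * r + s = (R ^ e div x) * R * (R * w' + 2)"
      using form[OF x(1,2)] form[OF y(1) x(3)] by auto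
    have "NN (q, r) = (x * (R ^ e div x)) * R\<^sup>2 * ((R * w + 1) * (R * w' + 2))"
      unfolding NN_def case_prod_conv w by (simp only: power2_eq_square mult_ac)
    also have "\<dots> = R ^ (e + 2) * ((R * w + 1) * (R * w' + 2))" by (simp only: y(2) power_add)
    finally show "R ^ (e + 2) dvd NN (q, r)" by simp
  qed
  define S where "S = (\<Sum>p\<in>P. lw (2 * K + 2) sx (real (NN p)))"
  have "real (card ?D) * (X\<^sup>2 / (256 * real (R ^ (e + 4)))) = (\<Sum>x\<in>?D. X\<^sup>2 / (256 * real (R ^ (e + 4))))" by simp
  also have "\<dots> \<le> (\<Sum>x\<in>?D. \<Sum>p\<in>PP x. ?w (fst p) * ?w (snd p))"
  proof (rule sum_mono)
    fix x assume x: "x \<in> ?D"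
    have "?M x * ?M (R ^ e div x) = (x * (R ^ e div x)) * R ^ 4" by (simp add: power2_eq_square eval_nat_numeral)
    also have "\<dots> = R ^ (e + 4)" unfolding comp(2)[OF x] by (simp add: power_add)
    finally have "real (?M x) * real (?M (R ^ e div x)) = real (R ^ (e + 4))" by (metis of_nat_mult)
    then have "X\<^sup>2 / (256 * real (R ^ (e + 4))) = (X / (16 * real (?M x))) * (X / (16 * real (?M (R ^ e div x))))"
      by (simp add: power2_eq_square)
    also have "\<dots> \<le> (\<Sum>q\<in>Q Y 1 x. ?w q) * (\<Sum>r\<in>Q Y 2 (R ^ e div x). ?w r)"
      using Y[OF x, of 1] Y[OF comp(1)[OF x], of 2] X0
      by (intro mult_mono) (auto intro!: sum_nonneg lw_of_nat_nonneg)
    also have "\<dots> = (\<Sum>p\<in>PP x. ?w (fst p) * ?w (snd p))"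
      by (simp add: PP_def sum_product sum.cartesian_product case_prod_unfold)
    finally show "X\<^sup>2 / (256 * real (R ^ (e + 4))) \<le> (\<Sum>p\<in>PP x. ?w (fst p) * ?w (snd p))" .
  qed
  also have "\<dots> = (\<Sum>p\<in>P. ?w (fst p) * ?w (snd p))"
    unfolding P_def
  proof (rule sum.UNION_disjoint[symmetric])
    show "\<forall>x\<in>?D. \<forall>y\<in>?D. x \<noteq> y \<longrightarrow> PP x \<inter> PP y = {}"
      using uniq(1)[of _ _ Y 1 _ 1] by (fastforce simp: PP_def)
  qed (use finD finQ in \<open>auto simp: PP_def\<close>)
  also have "\<dots> \<le> (\<Sum>p\<in>P. real (t + s) ^ 4 / 4 ^ Suc K * lw (2 * K + 2) sx (real (NN p)))"
  proof (rule sum_mono)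
    fix p assume "p \<in> P"
    then have "prime (fst p)" "prime (snd p)" by (auto simp: P_def PP_def Q_def)
    then show "?w (fst p) * ?w (snd p) \<le> real (t + s) ^ 4 / 4 ^ Suc K * lw (2 * K + 2) sx (real (NN p))"
      using sx ts prime_ge_1_nat by (intro pair_weight_le) (auto simp: NN_def case_prod_unfold)
  qed
  also have "\<dots> = real (t + s) ^ 4 / 4 ^ Suc K * (\<Sum>p\<in>P. lw (2 * K + 2) sx (real (NN p)))"
    by (rule sum_distrib_left[symmetric])
  finally have low: "real (card ?D) * (X\<^sup>2 / (256 * real (R ^ (e + 4)))) \<le> real (t + s) ^ 4 / 4 ^ Suc K * S"
    unfolding S_def .
  have "S = (\<Sum>N\<in>NN ` P. \<Sum>p\<in>{p \<in> P. NN p = N}. lw (2 * K + 2) sx (real (NN p)))"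
    unfolding S_def by (rule sum.image_gen[OF finP])
  also have "\<dots> = (\<Sum>N\<in>NN ` P. real (card {p \<in> P. NN p = N}) * lw (2 * K + 2) sx (real N))"
    by (intro sum.cong) auto
  also have "\<dots> \<le> (\<Sum>N\<in>NN ` P. lw (2 * K + 2 + c) sx (real N))"
  proof (rule sum_mono)
    fix N assume "N \<in> NN ` P"
    then obtain q0 r0 where qr0: "(q0, r0) \<in> P" "N = NN (q0, r0)" by auto
    define a where "a = (\<lambda>q r. sigma (m * q * r) - k * (m * q * r))"
    \<comment> \<open>All pairs with the same product \<open>N\<close> lead to the same right-hand side \<open>aa\<close> of the equation.\<close>
    note sol = solution_from_pair[OF m s t k]
    define aa where "aa = a q0 r0"
    have aeq: "t * a q r + s\<^sup>2 = NN (q, r) + s * t" if "(q, r) \<in> P" for q r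
      using sol(1)[OF props(1-5)[OF that], of "a q r"] by (simp add: a_def NN_def)
    have same: "a q r = aa" if "(q, r) \<in> P" "NN (q, r) = N" for q r
    proof -
      have "t * a q r = t * aa" using aeq[OF that(1)] aeq[OF qr0(1)] that(2) qr0(2) unfolding aa_def by linarith
      then show ?thesis using ts by simp
    qed
    have N0: "N > 0" unfolding qr0(2) NN_def using ts by simp
    have st: "s\<^sup>2 = s * (k * m) + s * t" using t s(2) by (simp add: power2_eq_square flip: distrib_left)
    have taN: "t * aa + s * (k * m) = N" using aeq[OF qr0(1)] st qr0(2) unfolding aa_def by linarith
    have "R ^ (e + 2) dvd N" using props(6)[OF qr0(1)] qr0(2) by simp
    then have "R ^ (e + 2) \<le> N" using N0 by (rule dvd_imp_le)
    then have "t * a0 < t * aa" using taN Ra by linarith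
    then have aa0: "aa > a0" by simp
    have "aa \<le> t * aa" using ts by simp
    then have aaN: "aa \<le> N" using taN by linarith
    let ?S = "{n. 0 < n \<and> n \<le> aa \<and> sigma n = k * n + aa \<and> \<not> exceptional_form k n}"
    have "card {p \<in> P. NN p = N} \<le> card ?S"
    proof (rule card_inj_on_le)
      show "finite ?S" by (rule finite_subset[of _ "{..aa}"]) auto
      show "(\<lambda>(q, r). m * q * r) ` {p \<in> P. NN p = N} \<subseteq> ?S"
      proof
        fix n assume "n \<in> (\<lambda>(q, r). m * q * r) ` {p \<in> P. NN p = N}"
        then obtain q r where qr: "(q, r) \<in> P" "NN (q, r) = N" "n = m * q * r" by auto
        have "aa = sigma (m * q * r) - k * (m * q * r)" using same[OF qr(1,2)] by (simp add: a_def)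
        from sol(2-4)[OF props(1-5)[OF qr(1)] this] show "n \<in> ?S"
          using qr(3) m props(1,2)[OF qr(1)] prime_gt_0_nat by auto
      qed
      show "inj_on (\<lambda>(q, r). m * q * r) {p \<in> P. NN p = N}"
      proof (rule inj_onI)
        fix p p' assume p: "p \<in> {p \<in> P. NN p = N}" "p' \<in> {p \<in> P. NN p = N}"
          "(case p of (q, r) \<Rightarrow> m * q * r) = (case p' of (q, r) \<Rightarrow> m * q * r)"
        obtain q r q' r' where pp: "p = (q, r)" "p' = (q', r')" by (metis surj_pair)
        have P: "(q, r) \<in> P" "(q', r') \<in> P" using p pp by auto
        have "q * r = q' * r'" using p(3) pp m by simp
        then have "q = q' \<and> r = r' \<or> q = r' \<and> r = q'"
          using pair_injective props(1,2)[OF P(1)] props(1,2)[OF P(2)] by blast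
        moreover have "q \<noteq> r'"
        proof
          assume "q = r'"
          obtain x x' where "x \<in> ?D" "q \<in> Q Y 1 x" "x' \<in> ?D" "r' \<in> Q Y 2 (R ^ e div x')" using P by (auto simp: P_def PP_def)
          then show False using uniq(2)[of x q Y 1 "R ^ e div x'" 2] comp(1)[of x'] \<open>q = r'\<close> by auto
        qed
        ultimately show "p = p'" using pp by simp
      qed
    qed
    then have "real (card {p \<in> P. NN p = N}) \<le> ln (real aa) powr C" using few[OF aa0] by linarith
    also have "\<dots> \<le> ln (real N) ^ c"
    proof -
      have "exp 1 \<le> real aa" using aa0 a0 exp_le by linarith
      then have l1: "1 \<le> ln (real aa)" using aa0 by (subst ln_ge_iff) auto
      have "ln (real aa) powr C \<le> ln (real aa) powr real c" using l1 c by (intro powr_mono) auto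
      also have "\<dots> = ln (real aa) ^ c" using l1 by (simp add: powr_realpow)
      also have "\<dots> \<le> ln (real N) ^ c"
        using aaN aa0 N0 l1 by (intro power_mono) auto
      finally show ?thesis .
    qed
    finally have "real (card {p \<in> P. NN p = N}) * lw (2 * K + 2) sx (real N) \<le> ln (real N) ^ c * lw (2 * K + 2) sx (real N)"
      by (intro mult_right_mono lw_of_nat_nonneg)
    also have "\<dots> = lw (2 * K + 2 + c) sx (real N)" by (simp add: lw_def power_add mult_ac)
    finally show "real (card {p \<in> P. NN p = N}) * lw (2 * K + 2) sx (real N) \<le> lw (2 * K + 2 + c) sx (real N)" .
  qed
  finally have S1: "S \<le> (\<Sum>N\<in>NN ` P. lw (2 * K + 2 + c) sx (real N))" .
  define j where "j = 2 * K + 2 + c"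
  define D where "D = R ^ (e + 2)"
  have D0: "D > 0" using R0 by (simp add: D_def)
  have "finite (NN ` P)" using finP by simp
  then obtain Z where Z: "\<And>N. N \<in> NN ` P \<Longrightarrow> N \<le> Z" unfolding finite_nat_set_iff_bounded_le by blast
  have sub: "NN ` P \<subseteq> (\<lambda>M. D * M) ` {1..Z}"
  proof
    fix N assume N: "N \<in> NN ` P"
    then obtain q r where qr: "(q, r) \<in> P" "N = NN (q, r)" by auto
    have "D dvd N" using props(6)[OF qr(1)] qr(2) by (simp only: D_def)
    then obtain M where M: "N = D * M" by auto
    have "N > 0" unfolding qr(2) NN_def using ts by simp
    then have "M \<ge> 1" using M by (cases M) auto
    moreover have "1 * M \<le> D * M" using D0 by (intro mult_le_mono1) simp
    then have "M \<le> Z" using Z[OF N] M by linarith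
    ultimately have "M \<in> {1..Z}" by simp
    then show "N \<in> (\<lambda>M. D * M) ` {1..Z}" using M by blast
  qed
  have "(\<Sum>N\<in>NN ` P. lw j sx (real N)) \<le> (\<Sum>N\<in>(\<lambda>M. D * M) ` {1..Z}. lw j sx (real N))"
    by (rule sum_mono2[OF _ sub]) (auto intro: lw_of_nat_nonneg)
  also have "\<dots> = (\<Sum>M=1..Z. lw j sx (real D * real M))"
    using D0 by (subst sum.reindex) (auto simp: inj_on_def)
  finally have S2: "(\<Sum>N\<in>NN ` P. lw j sx (real N)) \<le> (\<Sum>M=1..Z. lw j sx (real D * real M))" .
  have sL: "1 / (sx - 1) = L" using L by (simp add: sx_def)
  have "real D * (\<Sum>M=1..Z. lw j sx (real D * real M)) \<le> fact j * (1 / (sx - 1)) ^ Suc j + real D * (6 * 2 ^ j * fact j)"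
    using D0 by (intro lw_sum_multiples_le sx) simp
  also have "\<dots> \<le> fact j * L ^ Suc j + fact j * L ^ Suc j"
  proof -
    have "real D \<le> real (2 ^ K)" using RK by (simp only: of_nat_le_iff D_def)
    also have "\<dots> = 2 ^ K" by simp
    also have "\<dots> \<le> 2 ^ j" by (intro power_increasing) (auto simp: j_def)
    finally have "real D * (6 * 2 ^ j) \<le> 2 ^ j * (6 * 2 ^ j)" by (intro mult_right_mono) auto
    also have "\<dots> = 6 * 4 ^ j" by (simp flip: power_mult_distrib)
    also have "\<dots> \<le> L * L ^ j" using L by (intro mult_mono power_mono) auto
    finally have "real D * (6 * 2 ^ j) * fact j \<le> L * L ^ j * fact j" by (intro mult_right_mono) auto
    then show ?thesis unfolding sL by (simp add: mult_ac)
  qed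
  finally have S3: "real D * (\<Sum>M=1..Z. lw j sx (real D * real M)) \<le> fact j * L ^ Suc j + fact j * L ^ Suc j" .
  have "real D * S \<le> real D * (\<Sum>M=1..Z. lw j sx (real D * real M))"
    using S1 S2 unfolding j_def by (intro mult_left_mono) auto
  then have S4: "real D * S \<le> 2 * (fact j * L ^ Suc j)" using S3 by linarith
  have "(fact j :: nat) \<le> fact (2 * K) * j ^ (c + 2)"
    using fact_add_le[of "2 * K" "c + 2"] by (simp add: j_def add_ac)
  then have "real (fact j) \<le> real (fact (2 * K) * j ^ (c + 2))" by (simp only: of_nat_le_iff)
  then have "(fact j :: real) \<le> fact (2 * K) * real j ^ (c + 2)" by simp
  also have "\<dots> \<le> (4 ^ K * (fact K)\<^sup>2) * real j ^ (c + 2)" by (intro mult_right_mono fact_double_le) auto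
  finally have fj: "(fact j :: real) \<le> (4 ^ K * (fact K)\<^sup>2) * real j ^ (c + 2)" .
  define T where "T = real (t + s) ^ 4"
  have T0: "T \<ge> 0" by (simp add: T_def)
  have R4: "real (R ^ (e + 4)) = (real R)\<^sup>2 * real D" by (simp add: D_def power_add power2_eq_square eval_nat_numeral)
  have DR: "real D > 0" "real R > 0" using D0 R0 by auto
  have "real (card ?D) * X\<^sup>2 \<le> 256 * real (R ^ (e + 4)) * (T / 4 ^ Suc K * S)"
    using low DR unfolding R4 T_def by (simp add: field_simps)
  also have "\<dots> = 256 * (real R)\<^sup>2 * T / 4 ^ Suc K * (real D * S)" unfolding R4 by (simp add: mult_ac)
  also have "\<dots> \<le> 256 * (real R)\<^sup>2 * T / 4 ^ Suc K * (2 * (fact j * L ^ Suc j))"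
    using S4 T0 by (intro mult_left_mono) auto
  also have "\<dots> \<le> 256 * (real R)\<^sup>2 * T / 4 ^ Suc K * (2 * (((4 ^ K * (fact K)\<^sup>2) * real j ^ (c + 2)) * L ^ Suc j))"
    using fj T0 L by (intro mult_left_mono mult_right_mono) auto
  also have "\<dots> = 128 * (real R)\<^sup>2 * T * real j ^ (c + 2) * L ^ (c + 1) * X\<^sup>2"
  proof -
    have "L ^ Suc j = L ^ (c + 1) * (L ^ Suc K)\<^sup>2"
      unfolding j_def power_mult[symmetric] power_add[symmetric] by (rule arg_cong[of _ _ "\<lambda>i. L ^ i"]) simp
    then show ?thesis by (simp add: X_def power_mult_distrib)
  qed
  finally have "real (card ?D) * X\<^sup>2 \<le> 128 * (real R)\<^sup>2 * T * real j ^ (c + 2) * L ^ (c + 1) * X\<^sup>2" .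
  then have "real (card ?D) \<le> 128 * (real R)\<^sup>2 * T * real j ^ (c + 2) * L ^ (c + 1)"
    using X0 by (simp only: mult_le_cancel_right_pos zero_less_power)
  then show ?thesis unfolding T_def j_def .
qed

theorem proposition4p2:
  fixes k :: nat and C :: real
  assumes "k > 0" and "C > 0"
  shows "infinite {a::nat. a > 0 \<and>
           real (card {n. 0 < n \<and> n \<le> a \<and> sigma n = k * n + a \<and> \<not> exceptional_form k n})
             > ln (real a) powr C}"
proof
  let ?A = "{a::nat. a > 0 \<and>
           real (card {n. 0 < n \<and> n \<le> a \<and> sigma n = k * n + a \<and> \<not> exceptional_form k n})
             > ln (real a) powr C}"
  assume "finite ?A"
  then obtain a1 where a1: "\<And>a. a \<in> ?A \<Longrightarrow> a \<le> a1" unfolding finite_nat_set_iff_bounded_le by blast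
  define a0 where "a0 = max 3 a1"
  have few: "real (card {n. 0 < n \<and> n \<le> a \<and> sigma n = k * n + a \<and> \<not> exceptional_form k n}) \<le> ln (real a) powr C"
    if "a > a0" for a
    using a1[of a] that by (force simp: a0_def)
  obtain m where m: "m > 0" "sigma m > 4 * k * m" using exists_abundant[of "4 * k"] by blast
  define s where "s = sigma m"
  define t where "t = s - k * m"
  have sm: "s > 4 * k * m" using m by (simp add: s_def)
  have st: "t > 0" "s > 0" "t \<le> s" using sm by (auto simp: t_def)
  define c where "c = nat \<lceil>C\<rceil>"
  have c: "C \<le> real c" unfolding c_def by (rule real_nat_ceiling_ge)
  \<comment> \<open>The upper bound obtained for \<open>(e + 1) ^ J\<close> grows with exponent \<open>(c + 2) + 9 (c + 1) = 10 c + 11\<close> in \<open>e\<close>.\<close>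
  define J where "J = 10 * c + 12"
  obtain P where P: "finite P" "card P = J" "\<And>p. p \<in> P \<Longrightarrow> prime p" "\<And>p. p \<in> P \<Longrightarrow> p > t * m + s + 2"
    using exists_finite_primes[of J "t * m + s + 2"] by blast
  define R where "R = \<Prod>P"
  have cop: "coprime y R" if "0 < y" "y \<le> s" for y
    unfolding R_def
  proof (rule prod_coprime_right)
    fix p assume p: "p \<in> P"
    have "\<not> p dvd y" using P(4)[OF p] that by (auto dest: dvd_imp_le)
    then have "coprime p y" by (rule prime_imp_coprime[OF P(3)[OF p]])
    then show "coprime y p" by (rule coprime_commute[THEN iffD1])
  qed
  have oR: "odd R"
  proof -
    have "1 \<le> k * m" using assms(1) m(1) by simp
    moreover have "4 * (k * m) < s" using sm by (simp add: mult.assoc)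
    ultimately have "2 \<le> s" by linarith
    then have "coprime 2 R" by (intro cop) auto
    then show ?thesis by simp
  qed
  obtain p where p: "p \<in> P" using P(2) by (cases "P = {}") (auto simp: J_def)
  have "p dvd R" unfolding R_def using P(1) p by (intro dvd_prodI)
  moreover have "R > 0" unfolding R_def using P(3) prime_gt_0_nat by (intro prod_pos) auto
  ultimately have "p \<le> R" by (rule dvd_imp_le)
  then have Rbig: "R > t * m + s + 2" using P(4)[OF p] by simp
  have R1: "R > 1" using Rbig by simp
  obtain c0 :: real where c0:
    "\<And>E d B k b L. R dvd d \<Longrightarrow> d dvd R ^ E \<Longrightarrow> B \<ge> L_bound (real (R ^ E)) \<Longrightarrow> B \<ge> c0 \<Longrightarrow> B \<ge> real (k + 1) \<Longrightarrow>
       R ^ E \<le> 2 ^ k \<Longrightarrow> L = 10 ^ 5 * B ^ 9 \<Longrightarrow> coprime b d \<Longrightarrow>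
       (\<Sum>n. if prime n \<and> [n = b] (mod d) then lw (Suc k) (1 + 1 / L) (real n) else 0)
          \<ge> fact k * L ^ Suc k / (8 * real d)"
    using primes_in_progression[OF oR R1] by blast
  \<comment> \<open>\<open>U\<close> is chosen such that \<open>B = U * E\<close> satisfies all the lower bounds required of \<open>B\<close> at once.\<close>
  define U where "U = max c0 0 + 26 + 2 * real R"
  have U: "U \<ge> c0" "U \<ge> 26 + 2 * real R" by (auto simp: U_def)
  define V where "V = 128 * (real R)\<^sup>2 * real (t + s) ^ 4 * real (2 * R + 2 + c) ^ (c + 2) * (10 ^ 5 * U ^ 9) ^ (c + 1) * 2 ^ (10 * c + 11)"
  have est: "real (e + 1) \<le> V" if e: "e \<ge> s * (k * m) + t * a0" for e
  proof -
    define E where "E = e + 2"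
    define K where "K = R * E"
    define B where "B = U * real E"
    define L where "L = 10 ^ 5 * B ^ 9"
    have E1: "real E \<ge> 1" by (simp add: E_def)
    have UE: "U \<le> B" using mult_left_mono[OF E1, of U] U by (simp add: B_def)
    have B26: "B \<ge> 26" using UE U by linarith
    have "R < 2 ^ R" by (rule less_exp)
    then have "R ^ E \<le> (2 ^ R) ^ E" by (intro power_mono) auto
    then have RK: "R ^ E \<le> 2 ^ K" by (simp add: K_def power_mult)
    have "ln (real R) \<le> real R" using R1 ln_le_minus_one[of "real R"] by simp
    then have "real E * ln (real R) \<le> real E * real R" by (intro mult_left_mono) auto
    then have "L_bound (real (R ^ E)) \<le> 25 + 2 * (real E * real R)" using R1 by (simp add: L_bound_def ln_realpow)
    also have "\<dots> \<le> 25 * real E + 2 * (real E * real R)" using E1 by simp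
    also have "\<dots> \<le> (26 + 2 * real R) * real E" by (simp add: algebra_simps)
    also have "\<dots> \<le> B" unfolding B_def using U by (intro mult_right_mono) auto
    finally have BB: "L_bound (real (R ^ E)) \<le> B" .
    have "real (K + 1) \<le> real R * real E + real E" using E1 by (simp add: K_def)
    also have "\<dots> \<le> (26 + 2 * real R) * real E" by (simp add: algebra_simps)
    also have "\<dots> \<le> B" unfolding B_def using U by (intro mult_right_mono) auto
    finally have BK: "real (K + 1) \<le> B" .
    have "(1::real) \<le> B ^ 9" using B26 by (intro one_le_power) auto
    then have L6: "L \<ge> 6" by (simp add: L_def)
    have "real (card {x. x dvd R ^ e}) \<le> 128 * (real R)\<^sup>2 * real (t + s) ^ 4 * real (2 * K + 2 + c) ^ (c + 2) * L ^ (c + 1)"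
    proof (rule divisor_count_le[OF m(1) s_def sm t_def assms(1) oR R1 _ _ _ c _ _ few L6])
      show "coprime t R" "coprime s R" using cop st by auto
      show "R > t * m + s" using Rbig by simp
      show "a0 \<ge> 3" by (simp add: a0_def)
      have "e + 2 < 2 ^ (e + 2)" by (rule less_exp)
      also have "(2::nat) ^ (e + 2) \<le> R ^ (e + 2)" using R1 by (intro power_mono) auto
      finally show "R ^ (e + 2) > s * (k * m) + t * a0" using e by linarith
      show "R ^ (e + 2) \<le> 2 ^ K" using RK by (simp add: E_def)
      show "fact K * L ^ Suc K / (8 * real d) \<le> (\<Sum>n. if prime n \<and> [n = b] (mod d) then lw (Suc K) (1 + 1 / L) (real n) else 0)"
        if "R dvd d" "d dvd R ^ (e + 2)" "coprime b d" for d b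
        using that UE U by (intro c0[where E = E and B = B] BB BK RK L_def) (auto simp: E_def)
    qed
    also have "card {x. x dvd R ^ e} = (e + 1) ^ J"
      unfolding R_def using card_divisors_primorial_power[OF P(1,3), of e] P(2) by simp
    finally have "real (e + 1) ^ J \<le> 128 * (real R)\<^sup>2 * real (t + s) ^ 4 * real (2 * K + 2 + c) ^ (c + 2) * L ^ (c + 1)"
      by (simp only: of_nat_power)
    also have "\<dots> \<le> 128 * (real R)\<^sup>2 * real (t + s) ^ 4 * (real (2 * R + 2 + c) * real E) ^ (c + 2) * L ^ (c + 1)"
    proof -
      have "2 * K + 2 + c \<le> (2 * R + 2 + c) * E" unfolding K_def E_def by (simp add: algebra_simps)
      then have "real (2 * K + 2 + c) \<le> real (2 * R + 2 + c) * real E" by (metis of_nat_le_iff of_nat_mult)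
      then show ?thesis using L6 by (intro mult_right_mono mult_left_mono power_mono) auto
    qed
    also have "\<dots> = 128 * (real R)\<^sup>2 * real (t + s) ^ 4 * real (2 * R + 2 + c) ^ (c + 2) * (10 ^ 5 * U ^ 9) ^ (c + 1) * real E ^ (10 * c + 11)"
    proof -
      have p1: "L ^ (c + 1) = (10 ^ 5 * U ^ 9) ^ (c + 1) * real E ^ (9 * (c + 1))"
        unfolding L_def B_def by (simp only: power_mult_distrib power_mult mult.assoc)
      have p2: "real E ^ (10 * c + 11) = real E ^ (c + 2) * real E ^ (9 * (c + 1))"
      proof -
        have "10 * c + 11 = (c + 2) + 9 * (c + 1)" by simp
        then show ?thesis by (simp only: power_add)
      qed
      show ?thesis unfolding p1 p2 power_mult_distrib[of "real (2 * R + 2 + c)" "real E"] by (simp only: mult_ac)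
    qed
    also have "\<dots> \<le> 128 * (real R)\<^sup>2 * real (t + s) ^ 4 * real (2 * R + 2 + c) ^ (c + 2) * (10 ^ 5 * U ^ 9) ^ (c + 1) * (2 * real (e + 1)) ^ (10 * c + 11)"
      using U by (intro mult_left_mono power_mono mult_nonneg_nonneg) (auto simp: E_def)
    also have "\<dots> = V * real (e + 1) ^ (10 * c + 11)" unfolding V_def power_mult_distrib[of 2] by (simp only: mult_ac)
    finally have "real (e + 1) ^ J \<le> V * real (e + 1) ^ (10 * c + 11)" .
    moreover have JS: "J = Suc (10 * c + 11)" by (simp add: J_def)
    have "real (e + 1) ^ J = real (e + 1) * real (e + 1) ^ (10 * c + 11)" unfolding JS by (rule power_Suc)
    ultimately have "real (e + 1) * real (e + 1) ^ (10 * c + 11) \<le> V * real (e + 1) ^ (10 * c + 11)" by linarith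
    then show ?thesis by (rule mult_right_le_imp_le) simp
  qed
  define e where "e = s * (k * m) + t * a0 + nat \<lceil>V\<rceil>"
  have "V \<le> real (nat \<lceil>V\<rceil>)" by (rule real_nat_ceiling_ge)
  also have "\<dots> < real (e + 1)" unfolding of_nat_less_iff e_def by linarith
  finally show False using est[of e] by (simp add: e_def)
qed

end
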